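(* Let $p$ be a prime and let $(\alpha_n)_{n\ge1}$ be a sequence of positive real numbers satisfying $$\liminf_{n\to\infty}\frac{n\alpha_n}{\log n}>1.$$ For each $n$, let $A_n\in\mathrm{Mat}_n(\mathbb{F}_p)$ be an $\alpha_n$-balanced random matrix, and let $X_n:=\mathrm{Cok}_{\mathbb{F}_p[t]}(tI_n-A_n)$. Then, for every fixed finite $\mathbb{F}_p[t]$-module $G$, $$\lim_{n\to\infty}\mathbb{E}\,\#\mathrm{Sur}_{\mathbb{F}_p[t]}(X_n,G)=1.$$
   Context: $\mathbb{F}_p$ is the field with $p$ elements and $\mathrm{Mat}_n(\mathbb{F}_p)$ the set of $n\times n$ matrices over it. For $\alpha>0$, a random variable $\xi\in\mathbb{F}_p$ is $\alpha$-balanced if $\mathbf{P}(\xi=a)\le 1-\alpha$ for every $a\in\mathbb{F}_p$. A random matrix over $\mathbb{F}_p$ is $\alpha$-balanced if its entries are independent and each is $\alpha$-balanced (the entries need not be identically distributed). $\mathrm{Cok}_{\mathbb{F}_p[t]}(tI_n-A_n)=\mathbb{F}_p[t]^n/(tI_n-A_n)\mathbb{F}_p[t]^n$ is the cokernel of $tI_n-A_n$ acting on column vectors in $\mathbb{F}_p[t]^n$; it is a finite $\mathbb{F}_p[t]$-module. $\mathrm{Sur}_{\mathbb{F}_p[t]}(X,G)$ is the set of surjective $\mathbb{F}_p[t]$-module homomorphisms $X\to G$. *)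

theory Defs
  imports
    "HOL-Probability.Probability"
    "Jordan_Normal_Form.Char_Poly"
    "Jordan_Normal_Form.VS_Connect"
    "Berlekamp_Zassenhaus.Finite_Field"
begin

section \<open>Quotient modules, cokernels and surjections\<close>

text \<open>
  The module analogue of a factor ring: the elements are the additive cosets of \<open>N\<close>, and
  \<open>r \<odot> (N + x) = N + r x\<close>. The fields \<open>mult\<close> and \<open>one\<close> carry no meaning in a module.
\<close>

definition quotient_module ::
    "('r, 'b, 'm) module_scheme \<Rightarrow> 'b set \<Rightarrow> ('r, 'b set) module" where
  "quotient_module M N =
    \<lparr>carrier = a_rcosets\<^bsub>M\<^esub> N, mult = undefined, one = undefined,
     zero = N, add = set_add M,
     smult = (\<lambda>r X. \<Union>x\<in>X. N +>\<^bsub>M\<^esub> (r \<odot>\<^bsub>M\<^esub> x))\<rparr>"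

lemma abelian_subgroup_submodule:
  assumes "submodule R N M"
  shows "abelian_subgroup N M"
proof -
  interpret submodule R N M by fact
  interpret Module.module R M by (rule module)
  have inv: "\<ominus>\<^bsub>M\<^esub> x \<in> N" if "x \<in> N" for x
  proof -
    have "x \<in> carrier M" using that subset by blast
    then have "\<ominus>\<^bsub>M\<^esub> x = (\<ominus>\<^bsub>R\<^esub> \<one>\<^bsub>R\<^esub>) \<odot>\<^bsub>M\<^esub> x"
      using smult_l_minus[of "\<one>\<^bsub>R\<^esub>" x] by simp
    then show ?thesis using that smult_closed by simp
  qed
  have "subgroup N (add_monoid M)"
  proof (rule group.subgroupI)
    show "N \<noteq> {}" using submodule.zero_closed[OF assms] by blast
  qed (use subset m_closed inv in
        \<open>auto simp: a_inv_def[symmetric] intro: M.add.is_group\<close>)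
  then show ?thesis
    by (intro abelian_subgroupI3 additive_subgroupI) (auto intro: M.abelian_group_axioms)
qed

lemma quotient_module_smult_coset:
  assumes "submodule R N M" "r \<in> carrier R" "x \<in> carrier M"
  shows "r \<odot>\<^bsub>quotient_module M N\<^esub> (N +>\<^bsub>M\<^esub> x) = N +>\<^bsub>M\<^esub> (r \<odot>\<^bsub>M\<^esub> x)"
proof -
  interpret submodule R N M by fact
  interpret Module.module R M by (rule module)
  interpret abelian_subgroup N M using assms(1) by (rule abelian_subgroup_submodule)
  have "N +>\<^bsub>M\<^esub> (r \<odot>\<^bsub>M\<^esub> y) = N +>\<^bsub>M\<^esub> (r \<odot>\<^bsub>M\<^esub> x)" if y: "y \<in> N +>\<^bsub>M\<^esub> x" for y
  proof -
    from y obtain h where h: "h \<in> N" "y = h \<oplus>\<^bsub>M\<^esub> x"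
      by (auto simp: a_r_coset_def r_coset_def)
    have "h \<in> carrier M" using h(1) subset by blast
    then have "r \<odot>\<^bsub>M\<^esub> y = r \<odot>\<^bsub>M\<^esub> h \<oplus>\<^bsub>M\<^esub> r \<odot>\<^bsub>M\<^esub> x"
      using assms h by (simp add: smult_r_distr)
    moreover have "r \<odot>\<^bsub>M\<^esub> h \<in> N" using assms h by simp
    ultimately have "r \<odot>\<^bsub>M\<^esub> y \<in> N +>\<^bsub>M\<^esub> (r \<odot>\<^bsub>M\<^esub> x)"
      by (auto simp: a_r_coset_def r_coset_def)
    then show ?thesis using a_repr_independence' assms by simp
  qed
  moreover have "x \<in> N +>\<^bsub>M\<^esub> x" using assms a_rcos_self by simp
  ultimately have "(\<Union>y\<in>N +>\<^bsub>M\<^esub> x. N +>\<^bsub>M\<^esub> (r \<odot>\<^bsub>M\<^esub> y)) = N +>\<^bsub>M\<^esub> (r \<odot>\<^bsub>M\<^esub> x)"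
    by blast
  then show ?thesis by (simp add: quotient_module_def)
qed

lemma module_quotient_module:
  assumes "submodule R N M"
  shows "Module.module R (quotient_module M N)"
proof -
  interpret submodule R N M by fact
  interpret Module.module R M by (rule module)
  interpret abelian_subgroup N M using assms by (rule abelian_subgroup_submodule)
  let ?Q = "quotient_module M N"
  have coset: "\<exists>x\<in>carrier M. X = N +>\<^bsub>M\<^esub> x" if "X \<in> carrier ?Q" for X
    using that by (auto simp: quotient_module_def A_RCOSETS_def' a_r_coset_def)
  have closed: "N +>\<^bsub>M\<^esub> x \<in> carrier ?Q" if "x \<in> carrier M" for x
    using that by (auto simp: quotient_module_def A_RCOSETS_def' a_r_coset_def)
  have add: "(N +>\<^bsub>M\<^esub> x) \<oplus>\<^bsub>?Q\<^esub> (N +>\<^bsub>M\<^esub> y) = N +>\<^bsub>M\<^esub> (x \<oplus>\<^bsub>M\<^esub> y)"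
    if "x \<in> carrier M" "y \<in> carrier M" for x y
    using that a_rcos_sum by (simp add: quotient_module_def)
  have zero: "\<zero>\<^bsub>?Q\<^esub> = N +>\<^bsub>M\<^esub> \<zero>\<^bsub>M\<^esub>"
    using M.a_coset_add_zero a_subset by (simp add: quotient_module_def)
  note smult = quotient_module_smult_coset[OF assms]
  have "abelian_group ?Q"
  proof (rule abelian_groupI)
    show "\<exists>Y\<in>carrier ?Q. Y \<oplus>\<^bsub>?Q\<^esub> X = \<zero>\<^bsub>?Q\<^esub>" if X: "X \<in> carrier ?Q" for X
    proof -
      from coset[OF X] obtain x where x: "x \<in> carrier M" "X = N +>\<^bsub>M\<^esub> x" by blast
      then show ?thesis
        by (intro bexI[of _ "N +>\<^bsub>M\<^esub> (\<ominus>\<^bsub>M\<^esub> x)"]) (simp_all add: add zero closed M.l_neg)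
    qed
  qed (auto dest!: coset simp: add zero closed M.a_ac)
  then show ?thesis
    by (intro moduleI)
      (auto dest!: coset intro: R.is_cring
        simp: add smult closed smult_l_distr smult_r_distr smult_assoc1)
qed

definition cokernel :: "'a::comm_ring_1 mat \<Rightarrow> ('a, 'a vec set) module" where
  "cokernel B =
    quotient_module (module_vec TYPE('a) (dim_row B))
      ((\<lambda>v. B *\<^sub>v v) ` carrier_vec (dim_col B))"

lemma module_cokernel: "Module.module class_ring (cokernel B)"
  unfolding cokernel_def
proof (rule module_quotient_module)
  interpret vec_module "TYPE('a)" "dim_row B" .
  show "submodule class_ring ((\<lambda>v. B *\<^sub>v v) ` carrier_vec (dim_col B)) V"
  proof (rule submodule.intro)
    let ?I = "(\<lambda>v. B *\<^sub>v v) ` carrier_vec (dim_col B)"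
    have B: "B \<in> carrier_mat (dim_row B) (dim_col B)" by simp
    show "Module.module class_ring V" by (rule module_axioms)
    show "?I \<subseteq> carrier V"
      by (auto simp: module_vec_simps intro: mult_mat_vec_carrier[OF B])
    show "\<zero>\<^bsub>V\<^esub> \<in> ?I"
      using B by (auto simp: module_vec_simps intro!: image_eqI[of _ _ "0\<^sub>v (dim_col B)"])
    show "x \<oplus>\<^bsub>V\<^esub> y \<in> ?I" if "x \<in> ?I" "y \<in> ?I" for x y
      using that by (auto simp: module_vec_simps mult_add_distrib_mat_vec[OF B, symmetric])
    show "c \<odot>\<^bsub>V\<^esub> x \<in> ?I" if "x \<in> ?I" for c x
    proof -
      from that obtain v where v: "v \<in> carrier_vec (dim_col B)" "x = B *\<^sub>v v" by blast
      then have "c \<cdot>\<^sub>v x = B *\<^sub>v (c \<cdot>\<^sub>v v)" by (intro eq_vecI) auto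
      then show ?thesis using v by (simp add: module_vec_simps)
    qed
  qed
qed

text \<open>
  Restricting to extensional functions makes each homomorphism count once, whatever the values of
  a HOL function outside the carrier.
\<close>

definition module_sur ::
    "('r, 'c) ring_scheme \<Rightarrow> ('r, 'a, 'd) module_scheme \<Rightarrow> ('r, 'b, 'e) module_scheme \<Rightarrow>
      ('a \<Rightarrow> 'b) set" where
  "module_sur R M N =
    {f \<in> module_hom R M N. f \<in> extensional (carrier M) \<and> f ` carrier M = carrier N}"

section \<open>Balanced random matrices\<close>

definition balanced :: "'w measure \<Rightarrow> real \<Rightarrow> ('w \<Rightarrow> 'a) \<Rightarrow> bool" where
  "balanced M \<alpha> \<xi> \<longleftrightarrow>
    \<xi> \<in> measurable M (count_space UNIV) \<and>
    (\<forall>a. measure M {\<omega> \<in> space M. \<xi> \<omega> = a} \<le> 1 - \<alpha>)"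

definition balanced_matrix :: "'w measure \<Rightarrow> nat \<Rightarrow> real \<Rightarrow> ('w \<Rightarrow> 'a mat) \<Rightarrow> bool" where
  "balanced_matrix M n \<alpha> A \<longleftrightarrow>
    (\<forall>\<omega>\<in>space M. A \<omega> \<in> carrier_mat n n) \<and>
    prob_space.indep_vars M (\<lambda>_. count_space UNIV) (\<lambda>ij \<omega>. A \<omega> $$ ij) ({..<n} \<times> {..<n}) \<and>
    (\<forall>i<n. \<forall>j<n. balanced M \<alpha> (\<lambda>\<omega>. A \<omega> $$ (i, j)))"

end

(*
  A surjection from the cokernel onto G is a tuple g of n elements of G that generates G and satisfies
  t g_j = SUM_i A_ij g_i for every j. Writing G as a finite F_p-space V with an operator T and using
  the independence of the columns, the expectation becomes a sum over the tuples g spanning V of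
  PROD_j P(SUM_i A_ij g_i = T g_j).

  By Fourier inversion each factor is 1/|V| up to the products of the |E chi(A_ij u(g_i))|, where u
  runs over the nonzero functionals. For all but exponentially few g these products are at most
  exp(-theta n alpha_n) with theta < 1 fixed and theta n alpha_n > (1 + eps) log n, so the n factors
  together contribute (1 + o(1)) |V|^(-n). Parseval gives the sharp constant, and an exponential
  moment gives the concentration although the entries are not identically distributed.

  The remaining g are sorted by a subspace W that contains g_i for all i outside a small set S and such
  that every functional that is nonzero on W is nonzero at a positive proportion of the g_i. Modulo W
  only the k = |S| entries in S matter, and they hit a given coset with probability at most
  (1 + (1 - 2 alpha)^k) / 2. The n-th power of this beats the number of choices of S and of the g_i
  with i in S, again exactly because n alpha_n exceeds (1 + eps) log n.
*)

theory Submission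
  imports Defs "HOL-Library.Function_Algebras" "HOL-Real_Asymp.Real_Asymp"
begin

section \<open>Additive characters and subspaces\<close>

text \<open>The exponent has to be sharp. Each of the n columns carries a relative error of order
  exp(- \<theta> n \<alpha>), so n exp(- \<theta> n \<alpha>) must vanish for some \<theta> < 1. A
  pointwise bound on |E chi| loses a factor depending on p and misses the threshold 1. The mean does
  not: over the p characters, 1 - |E chi|^2 averages at least 2 \<alpha> (1 - \<alpha>), with
  equality for laws with atoms 1 - \<alpha> and \<alpha>. A uniform tuple g makes each u(g_i)
  uniform, so the randomness behind the concentration is that of g, not of the matrix. The pointwise
  bound serves only tuples for which averaging fails; its error is a mere power of 1/n, which the
  exponential rarity of these tuples absorbs.

  The strata are equally tight: one exceptional index costs n q choices and gains (1 - \<alpha>)^n.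

  Generation over F_p[t] becomes spanning over F_p because the relations make the span of the g_i
  stable under t. Being \<alpha>-balanced weakens as \<alpha> decreases, so \<alpha>_n can be
  lowered to a log n / n with 1 < a < liminf, and then it tends to 0.\<close>

definition chi :: "'p::prime_card mod_ring \<Rightarrow> complex" where
  "chi a = cis (2 * pi * real_of_int (to_int_mod_ring a) / real CARD('p))"

lemma chi_zero [simp]: "chi 0 = 1"
  by (simp add: chi_def)

lemma norm_chi [simp]: "norm (chi a) = 1"
  by (simp add: chi_def)

lemma chi_add: "chi (a + b) = chi a * chi b"
  for a b :: "'p::prime_card mod_ring"
proof -
  let ?p = "int CARD('p)"
  let ?s = "to_int_mod_ring a + to_int_mod_ring b"
  have "real_of_int (?s mod ?p) = real_of_int ?s - real_of_int ?p * real_of_int (?s div ?p)"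
    by (simp add: minus_mult_div_eq_mod [symmetric])
  then have "2 * pi * real_of_int (?s mod ?p) / real_of_int ?p =
      2 * pi * real_of_int ?s / real_of_int ?p - 2 * pi * real_of_int (?s div ?p)"
    by (simp only: right_diff_distrib diff_divide_distrib) simp
  then have "chi (a + b) = cis (2 * pi * real_of_int ?s / real_of_int ?p) *
      cis (- (2 * pi * real_of_int (?s div ?p)))"
    by (simp add: chi_def to_int_mod_ring_add cis_mult)
  also have "cis (- (2 * pi * real_of_int (?s div ?p))) = 1"
    by (metis Ints_of_int cis_multiple_2pi mult_minus_right of_int_minus)
  finally show ?thesis
    by (simp add: chi_def cis_mult add_divide_distrib distrib_left)
qed

lemma chi_uminus: "chi (- a) = cnj (chi a)"
proof -
  have "chi (- a) * chi a = 1" by (simp flip: chi_add)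
  moreover have "cnj (chi a) * chi a = 1"
    by (metis complex_norm_square mult.commute norm_chi of_real_1 power_one)
  ultimately show ?thesis
    by (metis mult_cancel_right zero_neq_one mult_zero_right)
qed

lemma chi_diff: "chi (a - b) = chi a * cnj (chi b)"
  by (metis chi_add chi_uminus add_uminus_conv_diff)

lemma chi_sum: "chi (sum f A) = (\<Prod>x\<in>A. chi (f x))"
  by (induction A rule: infinite_finite_induct) (simp_all add: chi_add)

lemma chi_eq_1_iff [simp]: "chi a = 1 \<longleftrightarrow> a = 0"
  for a :: "'p::prime_card mod_ring"
proof
  let ?t = "to_int_mod_ring a"
  assume "chi a = 1"
  then have "cos (2 * pi * real_of_int ?t / real CARD('p)) = 1"
    by (simp add: chi_def complex_eq_iff)
  then obtain k :: int where "2 * pi * real_of_int ?t / real CARD('p) = real_of_int k * 2 * pi"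
    unfolding cos_one_2pi_int by blast
  then have "real_of_int ?t = real_of_int (k * int CARD('p))"
    by (simp add: field_simps)
  then have "?t = k * int CARD('p)"
    using of_int_eq_iff by blast
  moreover have "0 \<le> ?t" "?t < int CARD('p)"
    using range_to_int_mod_ring[where 'a = 'p] by auto
  ultimately have "?t = 0"
    by (metis mod_mult_self2_is_0 mod_pos_pos_trivial)
  then show "a = 0" by simp
qed simp

lemma Re_chi_le: "Re (chi a) \<le> 1"
  using complex_Re_le_cmod[of "chi a"] by simp

text \<open>Finitely many values \<open>1 - Re (chi a)\<close> are positive off 0, so their minimum
  works; inserting 1 caps it. This \<open>\<kappa>\<close> depends on p alone and enters only the
  crude pointwise bounds.\<close>

lemma chi_separates:
  obtains \<kappa> :: real where "0 < \<kappa>" "\<kappa> \<le> 1"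
    "\<And>a :: 'p::prime_card mod_ring. a \<noteq> 0 \<Longrightarrow> \<kappa> \<le> 1 - Re (chi a)"
proof -
  let ?X = "insert 1 ((\<lambda>a :: 'p mod_ring. 1 - Re (chi a)) ` (UNIV - {0}))"
  have "0 < 1 - Re (chi a)" if "a \<noteq> 0" for a :: "'p mod_ring"
  proof -
    have "Re (chi a) \<noteq> 1"
      using that norm_chi[of a] chi_eq_1_iff[of a]
      by (auto simp: cmod_def complex_eq_iff)
    then show ?thesis using Re_chi_le[of a] by simp
  qed
  then have "0 < Min ?X" by (subst Min_gr_iff) auto
  moreover have "Min ?X \<le> 1" by (rule Min_le) auto
  moreover have "Min ?X \<le> 1 - Re (chi a)" if "a \<noteq> 0" for a :: "'p mod_ring"
    by (rule Min_le) (use that in auto)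
  ultimately show ?thesis using that by blast
qed

lemma sum_chi_mult:
  fixes d :: "'p::prime_card mod_ring"
  assumes "d \<noteq> 0"
  shows "(\<Sum>a\<in>UNIV. chi (d * a)) = 0"
proof -
  have "(\<Sum>a\<in>UNIV. chi (d * a)) = (\<Sum>a\<in>UNIV. chi (d * (a + 1)))"
    by (rule sum.reindex_bij_witness[of _ "\<lambda>a. a + 1" "\<lambda>a. a - 1"]) auto
  also have "\<dots> = (\<Sum>a\<in>UNIV. chi (d * a)) * chi d"
    by (simp add: distrib_left chi_add sum_distrib_right)
  finally show ?thesis
    by (metis assms chi_eq_1_iff mult_cancel_left2)
qed

lemma sum_chi: "(\<Sum>a\<in>UNIV. chi (a :: 'p::prime_card mod_ring)) = 0"
  using sum_chi_mult[of "1 :: 'p mod_ring"] by simp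

section \<open>Coordinate spaces over F_p, the standard pairing and annihilators\<close>

definition scal :: "'a::times \<Rightarrow> (nat \<Rightarrow> 'a) \<Rightarrow> nat \<Rightarrow> 'a" where
  "scal a v = (\<lambda>k. a * v k)"

lemma scal_apply [simp]: "scal a v k = a * v k"
  by (simp add: scal_def)

lemma sum_fun_apply: "sum f A k = (\<Sum>i\<in>A. f i k)"
  for f :: "'i \<Rightarrow> 'k \<Rightarrow> 'a::comm_monoid_add"
  by (induction A rule: infinite_finite_induct) simp_all

definition subsp :: "(nat \<Rightarrow> 'a::comm_ring_1) set \<Rightarrow> bool" where
  "subsp W \<longleftrightarrow> 0 \<in> W \<and> (\<forall>v\<in>W. \<forall>w\<in>W. v + w \<in> W) \<and> (\<forall>a. \<forall>v\<in>W. scal a v \<in> W)"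

lemma subsp_zero: "subsp W \<Longrightarrow> 0 \<in> W"
  and subsp_add: "subsp W \<Longrightarrow> v \<in> W \<Longrightarrow> w \<in> W \<Longrightarrow> v + w \<in> W"
  and subsp_scal: "subsp W \<Longrightarrow> v \<in> W \<Longrightarrow> scal a v \<in> W"
  by (auto simp: subsp_def)

lemma subsp_diff:
  assumes "subsp W" "v \<in> W" "w \<in> W"
  shows "v - w \<in> W"
proof -
  have "v - w = v + scal (- 1) w" by (rule ext) (unfold minus_apply plus_fun_apply scal_apply, simp)
  also have "\<dots> \<in> W" using assms by (intro subsp_add subsp_scal)
  finally show ?thesis .
qed

lemma subsp_sum: "subsp W \<Longrightarrow> (\<And>i. i \<in> A \<Longrightarrow> f i \<in> W) \<Longrightarrow> sum f A \<in> W"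
  by (induction A rule: infinite_finite_induct) (auto simp: subsp_zero subsp_add)

text \<open>The r-dimensional coordinate space, as functions on all of \<open>nat\<close> supported
  below \<open>r\<close>: one type serves every dimension, and 0, + and - come from the pointwise
  function algebra.\<close>

definition vspace :: "nat \<Rightarrow> (nat \<Rightarrow> 'a::zero) set" where
  "vspace r = {v. \<forall>k\<ge>r. v k = 0}"

lemma subsp_vspace: "subsp (vspace r)"
  by (auto simp: subsp_def vspace_def)

lemma finite_vspace [simp]: "finite (vspace r :: (nat \<Rightarrow> 'a::{finite,zero}) set)"
proof (rule finite_subset)
  let ?e = "\<lambda>h k. if k < r then h k else (0::'a)"
  show "vspace r \<subseteq> ?e ` PiE {..<r} (\<lambda>_. UNIV)"
  proof
    fix v :: "nat \<Rightarrow> 'a" assume v: "v \<in> vspace r"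
    have "v k = ?e (restrict v {..<r}) k" for k
      using v by (cases "k < r") (simp_all add: vspace_def)
    then have "v = ?e (restrict v {..<r})" by (rule ext)
    moreover have "restrict v {..<r} \<in> PiE {..<r} (\<lambda>_. UNIV)" by simp
    ultimately show "v \<in> ?e ` PiE {..<r} (\<lambda>_. UNIV)" by (rule image_eqI)
  qed
qed (simp add: finite_PiE)

definition dot :: "nat \<Rightarrow> (nat \<Rightarrow> 'a::comm_ring_1) \<Rightarrow> (nat \<Rightarrow> 'a) \<Rightarrow> 'a" where
  "dot r v w = (\<Sum>k<r. v k * w k)"

lemma dot_commute: "dot r v w = dot r w v"
  by (simp add: dot_def mult.commute)

lemma dot_add_right: "dot r u (v + w) = dot r u v + dot r u w"
  by (simp add: dot_def distrib_left sum.distrib)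

lemma dot_scal_right: "dot r u (scal a v) = a * dot r u v"
  by (simp add: dot_def sum_distrib_left mult_ac)

lemma dot_diff_right: "dot r u (v - w) = dot r u v - dot r u w"
  by (simp add: dot_def right_diff_distrib sum_subtractf)

lemma dot_zero_right [simp]: "dot r u 0 = 0"
  by (simp add: dot_def)

lemma dot_sum_right: "dot r u (sum f A) = (\<Sum>i\<in>A. dot r u (f i))"
  unfolding dot_def sum_fun_apply sum_distrib_left by (rule sum.swap)

text \<open>Translating \<open>W\<close> by \<open>scal c w\<close> with \<open>f w = 1\<close>
  shifts the values of \<open>f\<close> by \<open>c\<close>; averaging over all \<open>c\<close>
  replaces \<open>f v\<close> by a uniform field element. The form without division serves complex
  \<open>G\<close> (characters) and real \<open>G\<close> (exponential moments) alike.\<close>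

lemma equidistributed:
  fixes W :: "(nat \<Rightarrow> 'p::prime_card mod_ring) set" and G :: "'p mod_ring \<Rightarrow> 'b::comm_semiring_1"
  assumes W: "finite W" "subsp W"
    and add: "\<And>v w. f (v + w) = f v + f w" and scal: "\<And>a v. f (scal a v) = a * f v"
    and nz: "\<exists>w\<in>W. f w \<noteq> 0"
  shows "of_nat CARD('p) * (\<Sum>v\<in>W. G (f v)) = of_nat (card W) * (\<Sum>c\<in>UNIV. G c)"
proof -
  from nz obtain w0 where w0: "w0 \<in> W" "f w0 \<noteq> 0" by blast
  define w where "w = scal (1 / f w0) w0"
  have w: "w \<in> W" "f w = 1"
    using w0 W by (simp_all add: w_def scal subsp_scal)
  have diff: "f (v - u) = f v - f u" for u v
    using add[of "v - u" u] by simp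
  have shift: "(\<Sum>v\<in>W. G (f v)) = (\<Sum>v\<in>W. G (f v + c))" for c
    by (rule sum.reindex_bij_witness[of _ "\<lambda>v. v + scal c w" "\<lambda>v. v - scal c w"])
      (use W w in \<open>auto simp: add scal diff intro: subsp_add subsp_diff subsp_scal\<close>)
  have "of_nat CARD('p) * (\<Sum>v\<in>W. G (f v)) = (\<Sum>c\<in>(UNIV :: 'p mod_ring set). \<Sum>v\<in>W. G (f v))"
    by simp
  also have "\<dots> = (\<Sum>c\<in>UNIV. \<Sum>v\<in>W. G (f v + c))"
    by (intro sum.cong refl shift)
  also have "\<dots> = (\<Sum>v\<in>W. \<Sum>c\<in>UNIV. G (f v + c))"
    by (rule sum.swap)
  also have "\<dots> = (\<Sum>v\<in>W. \<Sum>c\<in>UNIV. G c)"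
  proof (rule sum.cong[OF refl])
    fix v
    show "(\<Sum>c\<in>UNIV. G (f v + c)) = (\<Sum>c\<in>UNIV. G c)"
      by (rule sum.reindex_bij_witness[of _ "\<lambda>c. c - f v" "\<lambda>c. c + f v"]) (auto simp: add_ac)
  qed
  finally show ?thesis by simp
qed

lemma equidistributed_dot:
  fixes W :: "(nat \<Rightarrow> 'p::prime_card mod_ring) set" and G :: "'p mod_ring \<Rightarrow> 'b::comm_semiring_1"
  assumes "finite W" "subsp W" "\<exists>w\<in>W. dot r u w \<noteq> 0"
  shows "of_nat CARD('p) * (\<Sum>v\<in>W. G (dot r u v)) = of_nat (card W) * (\<Sum>c\<in>UNIV. G c)"
  using assms by (intro equidistributed) (auto simp: dot_add_right dot_scal_right)

lemma sum_chi_dot: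
  fixes W :: "(nat \<Rightarrow> 'p::prime_card mod_ring) set"
  assumes "finite W" "subsp W"
  shows "(\<Sum>v\<in>W. chi (dot r u v)) = (if \<forall>w\<in>W. dot r u w = 0 then of_nat (card W) else 0)"
  using equidistributed_dot[OF assms, of r u chi] by (auto simp: sum_chi)

lemma dot_nondegenerate:
  assumes "v \<in> vspace r" "v \<noteq> 0"
  shows "\<exists>u\<in>vspace r. dot r v u \<noteq> 0"
proof -
  from assms obtain k where k: "k < r" "v k \<noteq> 0"
    by (auto simp: vspace_def fun_eq_iff) (metis not_le)
  let ?u = "\<lambda>j. if j = k then 1 else 0"
  have "dot r v ?u = (\<Sum>j<r. if k = j then v j else 0)"
    unfolding dot_def by (intro sum.cong) auto
  also have "\<dots> = v k" using k by simp
  finally show ?thesis using k by (intro bexI[of _ ?u]) (auto simp: vspace_def)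
qed

lemma sum_chi_vspace:
  fixes v :: "nat \<Rightarrow> 'p::prime_card mod_ring"
  assumes "v \<in> vspace r"
  shows "(\<Sum>u\<in>vspace r. chi (dot r u v)) = (if v = 0 then of_nat (card (vspace r :: (nat \<Rightarrow> 'p mod_ring) set)) else 0)"
proof -
  have "(\<Sum>u\<in>vspace r. chi (dot r u v)) = (\<Sum>u\<in>vspace r. chi (dot r v u))"
    by (simp add: dot_commute)
  also have "\<dots> = (if v = 0 then of_nat (card (vspace r :: (nat \<Rightarrow> 'p mod_ring) set)) else 0)"
    using dot_nondegenerate[OF assms]
    by (auto simp: sum_chi_dot subsp_vspace dot_commute[of r 0])
  finally show ?thesis .
qed

definition annih :: "nat \<Rightarrow> (nat \<Rightarrow> 'a::comm_ring_1) set \<Rightarrow> (nat \<Rightarrow> 'a) set" where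
  "annih r W = {u \<in> vspace r. \<forall>w\<in>W. dot r u w = 0}"

text \<open>Double counting of the sum of \<open>chi (dot r u v)\<close> over all \<open>u\<close>
  and all \<open>v\<close> in \<open>W\<close>: summing over \<open>v\<close> first detects
  \<open>u\<close> in the annihilator, summing over \<open>u\<close> first detects
  \<open>v = 0\<close>.\<close>

lemma card_annih:
  fixes W :: "(nat \<Rightarrow> 'p::prime_card mod_ring) set"
  assumes W: "subsp W" "W \<subseteq> vspace r"
  shows "card (annih r W) * card W = card (vspace r :: (nat \<Rightarrow> 'p mod_ring) set)"
proof -
  let ?V = "vspace r :: (nat \<Rightarrow> 'p mod_ring) set"
  have fin: "finite W" using W finite_subset finite_vspace by blast
  have "(\<Sum>u\<in>?V. \<Sum>v\<in>W. chi (dot r u v)) =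
      (\<Sum>u\<in>?V. if u \<in> annih r W then of_nat (card W) else 0)"
    by (intro sum.cong) (auto simp: sum_chi_dot[OF fin W(1)] annih_def)
  also have "\<dots> = of_nat (card (annih r W) * card W)"
    by (subst sum.If_cases) (auto simp: Int_absorb1 annih_def Int_def)
  finally have "of_nat (card (annih r W) * card W) = (\<Sum>v\<in>W. \<Sum>u\<in>?V. chi (dot r u v))"
    by (subst sum.swap) simp
  also have "\<dots> = (\<Sum>v\<in>W. if v = 0 then of_nat (card ?V) else 0)"
    using W by (intro sum.cong refl sum_chi_vspace) auto
  also have "\<dots> = of_nat (card ?V)"
    using fin subsp_zero[OF W(1)] by simp
  finally show ?thesis using of_nat_eq_iff by blast
qed

section \<open>Sums of balanced random multiples\<close>

definition balanced_law :: "real \<Rightarrow> ('a::finite \<Rightarrow> real) \<Rightarrow> bool" where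
  "balanced_law \<alpha> m \<longleftrightarrow> (\<forall>a. 0 \<le> m a \<and> m a \<le> 1 - \<alpha>) \<and> (\<Sum>a\<in>UNIV. m a) = 1"

lemma balanced_lawD:
  assumes "balanced_law \<alpha> m"
  shows "0 \<le> m a" "m a \<le> 1 - \<alpha>" "(\<Sum>a\<in>UNIV. m a) = 1"
  using assms by (auto simp: balanced_law_def)

text \<open>
  The extremal case is a law with two atoms \<open>1 - \<alpha>\<close> and \<open>\<alpha>\<close>, whose heavier atom sits at the
  largest value of \<open>c\<close>.
\<close>

lemma balanced_sum_le:
  fixes mu c :: "'a::finite \<Rightarrow> real"
  assumes mu: "balanced_law \<alpha> mu" and \<alpha>: "\<alpha> \<le> 1 / 2"
    and c: "\<And>a. 0 \<le> c a" "\<And>a. c a \<le> m" "(\<Sum>a\<in>UNIV. c a) \<le> 1" and m: "1 / 2 \<le> m"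
  shows "(\<Sum>a\<in>UNIV. mu a * c a) \<le> \<alpha> + (1 - 2 * \<alpha>) * m"
proof (cases "\<exists>a. c a > 1 / 2")
  case True
  then obtain a0 where a0: "c a0 > 1 / 2" by blast
  have split: "(\<Sum>a\<in>UNIV. f a) = f a0 + (\<Sum>a\<in>UNIV - {a0}. f a)" for f :: "'a \<Rightarrow> real"
    by (simp add: sum.remove)
  have rest: "c a \<le> 1 - c a0" if "a \<noteq> a0" for a
  proof -
    have "c a \<le> (\<Sum>a\<in>UNIV - {a0}. c a)"
      using that c(1) by (intro member_le_sum) auto
    then show ?thesis using c(3) split[of c] by linarith
  qed
  have "(\<Sum>a\<in>UNIV - {a0}. mu a * c a) \<le> (\<Sum>a\<in>UNIV - {a0}. mu a * (1 - c a0))"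
    by (intro sum_mono mult_left_mono rest) (auto simp: balanced_lawD[OF mu])
  also have "\<dots> = (1 - mu a0) * (1 - c a0)"
    using balanced_lawD(3)[OF mu] split[of mu] by (simp add: sum_distrib_right[symmetric])
  finally have "(\<Sum>a\<in>UNIV. mu a * c a) \<le> (1 - c a0) + mu a0 * (2 * c a0 - 1)"
    using split[of "\<lambda>a. mu a * c a"] by (simp add: algebra_simps)
  also have "\<dots> \<le> (1 - c a0) + (1 - \<alpha>) * (2 * c a0 - 1)"
    using a0 balanced_lawD(2)[OF mu] by (intro add_left_mono mult_right_mono) auto
  also have "\<dots> = \<alpha> + (1 - 2 * \<alpha>) * c a0" by (simp add: algebra_simps)
  also have "\<dots> \<le> \<alpha> + (1 - 2 * \<alpha>) * m"
    using \<alpha> c(2) by (intro add_left_mono mult_left_mono) auto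
  finally show ?thesis .
next
  case False
  then have "(\<Sum>a\<in>UNIV. mu a * c a) \<le> (\<Sum>a\<in>UNIV. mu a * (1 / 2))"
    by (intro sum_mono mult_left_mono) (auto simp: balanced_lawD[OF mu] not_less)
  also have "\<dots> = 1 / 2" using balanced_lawD(3)[OF mu] by (simp flip: sum_divide_distrib)
  also have "\<dots> = \<alpha> + (1 - 2 * \<alpha>) * (1 / 2)" by (simp add: field_simps)
  also have "\<dots> \<le> \<alpha> + (1 - 2 * \<alpha>) * m"
    using \<alpha> m by (intro add_left_mono mult_left_mono) auto
  finally show ?thesis .
qed

text \<open>Here the weights are the law itself, capped by \<open>1 - \<alpha>\<close>. The
  right-hand side is \<open>(1 - \<alpha>)^2 + \<alpha>^2\<close>, the collision probability of the
  two-atom law.\<close>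

lemma balanced_sum_square_le:
  assumes "balanced_law \<alpha> m" "\<alpha> \<le> 1 / 2"
  shows "(\<Sum>a\<in>UNIV. m a * m a) \<le> 1 - 2 * \<alpha> * (1 - \<alpha>)"
proof -
  have "(\<Sum>a\<in>UNIV. m a * m a) \<le> \<alpha> + (1 - 2 * \<alpha>) * (1 - \<alpha>)"
    using assms by (intro balanced_sum_le) (auto simp: balanced_lawD)
  then show ?thesis by (simp add: algebra_simps)
qed

section \<open>Fourier transforms of balanced laws\<close>

definition muhat :: "('p::prime_card mod_ring \<Rightarrow> real) \<Rightarrow> 'p mod_ring \<Rightarrow> complex" where
  "muhat m c = (\<Sum>a\<in>UNIV. of_real (m a) * chi (a * c))"

text \<open>The difference of two independent copies has the squared modulus as its transform. In
  this form it can be bounded term by term and summed over \<open>c\<close>.\<close>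

lemma norm_muhat_square:
  "(norm (muhat m c))\<^sup>2 = (\<Sum>a\<in>UNIV. \<Sum>b\<in>UNIV. m a * m b * Re (chi ((a - b) * c)))"
proof -
  have "complex_of_real ((norm (muhat m c))\<^sup>2) = muhat m c * cnj (muhat m c)"
    by (rule complex_norm_square)
  also have "\<dots> = (\<Sum>a\<in>UNIV. \<Sum>b\<in>UNIV. of_real (m a * m b) * chi ((a - b) * c))"
    unfolding muhat_def cnj_sum sum_product
    by (intro sum.cong refl) (simp add: left_diff_distrib chi_diff)
  finally have "Re (complex_of_real ((norm (muhat m c))\<^sup>2)) =
      Re (\<Sum>a\<in>UNIV. \<Sum>b\<in>UNIV. of_real (m a * m b) * chi ((a - b) * c))"
    by simp
  then show ?thesis by (simp flip: of_real_mult)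
qed

definition gap :: "('p::prime_card mod_ring \<Rightarrow> real) \<Rightarrow> 'p mod_ring \<Rightarrow> real" where
  "gap m c = 1 - (norm (muhat m c))\<^sup>2"

lemma gap_eq:
  assumes "balanced_law \<alpha> m"
  shows "gap m c = (\<Sum>a\<in>UNIV. \<Sum>b\<in>UNIV. m a * m b * (1 - Re (chi ((a - b) * c))))"
proof -
  have "1 = (\<Sum>a\<in>UNIV. m a) * (\<Sum>b\<in>UNIV. m b)"
    using balanced_lawD(3)[OF assms] by simp
  also have "\<dots> = (\<Sum>a\<in>UNIV. \<Sum>b\<in>UNIV. m a * m b)"
    by (rule sum_product)
  finally show ?thesis
    by (simp add: gap_def norm_muhat_square right_diff_distrib sum_subtractf)
qed

lemma gap_nonneg: "balanced_law \<alpha> m \<Longrightarrow> 0 \<le> gap m c"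
  unfolding gap_eq
  by (intro sum_nonneg mult_nonneg_nonneg) (auto simp: Re_chi_le intro: balanced_lawD)

lemma gap_zero: "balanced_law \<alpha> m \<Longrightarrow> gap m 0 = 0"
  by (simp add: gap_eq)

text \<open>Two independent copies differ with probability at least \<open>\<alpha>\<close>, and
  each pair \<open>a \<noteq> b\<close> contributes at least \<open>\<kappa>\<close> times its
  probability.\<close>

lemma gap_ge:
  assumes m: "balanced_law \<alpha> m"
    and \<kappa>: "0 < \<kappa>" "\<And>a :: 'p::prime_card mod_ring. a \<noteq> 0 \<Longrightarrow> \<kappa> \<le> 1 - Re (chi a)"
    and c: "c \<noteq> (0 :: 'p mod_ring)"
  shows "\<kappa> * \<alpha> \<le> gap m c"
proof -
  have "\<kappa> * \<alpha> = (\<Sum>a\<in>UNIV. m a * (\<kappa> * \<alpha>))"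
    using balanced_lawD(3)[OF m] by (simp flip: sum_distrib_right)
  also have "\<dots> \<le> (\<Sum>a\<in>UNIV. m a * (\<kappa> * (1 - m a)))"
    using balanced_lawD[OF m] \<kappa>(1) by (intro sum_mono mult_left_mono) (auto simp: algebra_simps)
  also have "\<dots> = (\<Sum>a\<in>UNIV. \<Sum>b\<in>UNIV - {a}. m a * m b * \<kappa>)"
  proof (rule sum.cong[OF refl])
    fix a
    have "1 - m a = (\<Sum>b\<in>UNIV - {a}. m b)"
      using balanced_lawD(3)[OF m] by (simp add: sum.remove[of UNIV a])
    then show "m a * (\<kappa> * (1 - m a)) = (\<Sum>b\<in>UNIV - {a}. m a * m b * \<kappa>)"
      by (simp add: sum_distrib_left sum_distrib_right mult_ac)
  qed
  also have "\<dots> \<le> (\<Sum>a\<in>UNIV. \<Sum>b\<in>UNIV - {a}. m a * m b * (1 - Re (chi ((a - b) * c))))"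
    using c by (intro sum_mono mult_left_mono \<kappa>(2)) (auto simp: balanced_lawD[OF m])
  also have "\<dots> \<le> (\<Sum>a\<in>UNIV. \<Sum>b\<in>UNIV. m a * m b * (1 - Re (chi ((a - b) * c))))"
    by (intro sum_mono sum_mono2 mult_nonneg_nonneg)
      (auto simp: balanced_lawD[OF m] Re_chi_le)
  finally show ?thesis by (simp add: gap_eq[OF m])
qed

text \<open>Parseval: the squared moduli sum to p times the collision probability. The resulting
  mean \<open>2 * \<alpha> * (1 - \<alpha>)\<close> of \<open>gap\<close> has a constant independent
  of p, and this is what makes the threshold sharp.\<close>

lemma sum_gap_ge:
  fixes m :: "'p::prime_card mod_ring \<Rightarrow> real"
  assumes m: "balanced_law \<alpha> m" "\<alpha> \<le> 1 / 2"
  shows "2 * real CARD('p) * \<alpha> * (1 - \<alpha>) \<le> (\<Sum>c\<in>UNIV. gap m c)"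
proof -
  have char: "(\<Sum>c\<in>UNIV. Re (chi (d * c))) = (if d = 0 then real CARD('p) else 0)"
    for d :: "'p mod_ring"
  proof (cases "d = 0")
    case False
    then show ?thesis by (simp add: sum_chi_mult flip: Re_sum)
  qed simp
  have "(\<Sum>c\<in>UNIV. (norm (muhat m c))\<^sup>2) =
      (\<Sum>a\<in>UNIV. \<Sum>b\<in>UNIV. m a * m b * (\<Sum>c\<in>UNIV. Re (chi ((a - b) * c))))"
    unfolding norm_muhat_square sum_distrib_left
    by (subst sum.swap, rule sum.cong[OF refl], rule sum.swap)
  also have "\<dots> = (\<Sum>a\<in>UNIV. \<Sum>b\<in>UNIV. if a = b then m a * m b * real CARD('p) else 0)"
    unfolding char by (intro sum.cong refl) auto
  also have "\<dots> = real CARD('p) * (\<Sum>a\<in>UNIV. m a * m a)"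
    by (simp add: sum_distrib_left mult_ac)
  also have "\<dots> \<le> real CARD('p) * (1 - 2 * \<alpha> * (1 - \<alpha>))"
    by (intro mult_left_mono balanced_sum_square_le m) auto
  finally show ?thesis
    by (simp add: gap_def sum_subtractf algebra_simps)
qed

text \<open>
  Truncation at the order of \<open>\<alpha>\<close> keeps the exponential moment at scale \<open>1 / \<alpha>\<close> under control: entries
  may be far more spread out than \<open>\<alpha>\<close>-balancedness requires.
\<close>

definition tgap :: "real \<Rightarrow> ('p::prime_card mod_ring \<Rightarrow> real) \<Rightarrow> 'p mod_ring \<Rightarrow> real" where
  "tgap \<alpha> m c = min (gap m c) (2 * real CARD('p) * \<alpha>)"

lemma tgap_nonneg: "balanced_law \<alpha> m \<Longrightarrow> 0 \<le> \<alpha> \<Longrightarrow> 0 \<le> tgap \<alpha> m c"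
  by (simp add: tgap_def gap_nonneg)

lemma tgap_le: "tgap \<alpha> (m :: 'p::prime_card mod_ring \<Rightarrow> real) c \<le> 2 * real CARD('p) * \<alpha>"
  by (simp add: tgap_def)

lemma tgap_zero: "balanced_law \<alpha> m \<Longrightarrow> 0 \<le> \<alpha> \<Longrightarrow> tgap \<alpha> m 0 = 0"
  by (simp add: tgap_def gap_zero)

lemma tgap_ge:
  assumes "balanced_law \<alpha> m" "0 \<le> \<alpha>"
    and "0 < \<kappa>" "\<kappa> \<le> 1" "\<And>a :: 'p::prime_card mod_ring. a \<noteq> 0 \<Longrightarrow> \<kappa> \<le> 1 - Re (chi a)"
    and "c \<noteq> (0 :: 'p mod_ring)"
  shows "\<kappa> * \<alpha> \<le> tgap \<alpha> m c"
proof -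
  have "1 \<le> 2 * real CARD('p)"
    using zero_less_card_finite[where 'a = 'p] by linarith
  then have "\<kappa> * \<alpha> \<le> (2 * real CARD('p)) * \<alpha>"
    using assms by (intro mult_right_mono) auto
  then show ?thesis
    using gap_ge[OF assms(1,3,5,6)] by (simp add: tgap_def)
qed

text \<open>The ceiling \<open>2 * real CARD('p) * \<alpha>\<close> already exceeds the claimed
  bound for the whole sum. So a single truncated term suffices, and if no term is truncated then
  \<open>sum_gap_ge\<close> applies.\<close>

lemma sum_tgap_ge:
  fixes m :: "'p::prime_card mod_ring \<Rightarrow> real"
  assumes m: "balanced_law \<alpha> m" "0 \<le> \<alpha>" "\<alpha> \<le> 1 / 2"
  shows "2 * real CARD('p) * \<alpha> * (1 - \<alpha>) \<le> (\<Sum>c\<in>UNIV. tgap \<alpha> m c)"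
proof (cases "\<exists>c. gap m c > 2 * real CARD('p) * \<alpha>")
  case True
  then obtain c where "gap m c > 2 * real CARD('p) * \<alpha>" by blast
  then have "2 * real CARD('p) * \<alpha> = tgap \<alpha> m c" by (simp add: tgap_def)
  also have "\<dots> \<le> (\<Sum>c\<in>UNIV. tgap \<alpha> m c)"
    by (rule member_le_sum) (auto simp: tgap_nonneg m)
  also have "2 * real CARD('p) * \<alpha> * (1 - \<alpha>) \<le> 2 * real CARD('p) * \<alpha>"
    using m by (intro mult_left_le) auto
  finally show ?thesis by simp
next
  case False
  then have "tgap \<alpha> m c = gap m c" for c by (simp add: tgap_def not_less min_absorb1)
  then show ?thesis using sum_gap_ge[OF m(1,3)] by simp
qed

lemma norm_muhat_le:
  "norm (muhat m c) \<le> exp (- tgap \<alpha> m c / 2)"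
proof -
  have "(norm (muhat m c))\<^sup>2 \<le> 1 + - tgap \<alpha> m c"
    by (simp add: tgap_def gap_def)
  also have "\<dots> \<le> exp (- tgap \<alpha> m c)"
    by (rule exp_ge_add_one_self)
  also have "\<dots> = (exp (- tgap \<alpha> m c / 2))\<^sup>2"
    by (simp flip: exp_double)
  finally show ?thesis by (rule power2_le_imp_le) simp
qed

text \<open>For laws \<open>mu i\<close>, the probability that the combination of the
  \<open>g i\<close> with independent coefficients lies in \<open>C\<close>. As a finite sum it
  needs no measure space, and the free index set \<open>I\<close> allows conditioning on part of the
  coefficients.\<close>

definition hit :: "(nat \<Rightarrow> 'a::{comm_ring_1,finite} \<Rightarrow> real) \<Rightarrow> (nat \<Rightarrow> nat \<Rightarrow> 'a) \<Rightarrow> nat set \<Rightarrow>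
    (nat \<Rightarrow> 'a) set \<Rightarrow> real" where
  "hit mu g I C = (\<Sum>x\<in>PiE I (\<lambda>_. UNIV).
    if (\<Sum>i\<in>I. scal (x i) (g i)) \<in> C then \<Prod>i\<in>I. mu i (x i) else 0)"

lemma hit_empty: "hit mu g {} C = (if 0 \<in> C then 1 else 0)"
  by (simp add: hit_def)

lemma hit_insert:
  assumes "finite I" "i \<notin> I"
  shows "hit mu g (insert i I) C =
    (\<Sum>a\<in>UNIV. mu i a * hit mu g I {u. scal a (g i) + u \<in> C})"
proof -
  let ?F = "\<lambda>I x. if (\<Sum>i\<in>I. scal (x i) (g i)) \<in> C then \<Prod>i\<in>I. mu i (x i) else 0"
  have inj: "inj_on (\<lambda>(y, x). x(i := y)) (UNIV \<times> PiE I (\<lambda>_. UNIV))"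
  proof (rule inj_onI)
    fix s t assume s: "s \<in> UNIV \<times> PiE I (\<lambda>_. UNIV)" "t \<in> UNIV \<times> PiE I (\<lambda>_. UNIV)"
      and eq: "(\<lambda>(y, x). x(i := y)) s = (\<lambda>(y, x). x(i := y)) t"
    obtain a x b y where st: "s = (a, x)" "t = (b, y)" by (cases s, cases t)
    have "a = b" using fun_cong[OF eq, of i] by (simp add: st)
    moreover have "x k = y k" for k
      using fun_cong[OF eq, of k] s assms(2)
      by (cases "k = i") (auto simp: st PiE_def extensional_def)
    ultimately show "s = t" by (auto simp: st)
  qed
  have "hit mu g (insert i I) C =
      (\<Sum>(a, x)\<in>UNIV \<times> PiE I (\<lambda>_. UNIV). ?F (insert i I) (x(i := a)))"
    unfolding hit_def PiE_insert_eq
    by (subst sum.reindex[OF inj]) (simp add: case_prod_unfold)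
  also have "\<dots> = (\<Sum>a\<in>UNIV. \<Sum>x\<in>PiE I (\<lambda>_. UNIV). ?F (insert i I) (x(i := a)))"
    by (simp add: sum.cartesian_product)
  also have "\<dots> = (\<Sum>a\<in>UNIV. \<Sum>x\<in>PiE I (\<lambda>_. UNIV). mu i a *
      (if (\<Sum>i\<in>I. scal (x i) (g i)) \<in> {u. scal a (g i) + u \<in> C} then \<Prod>i\<in>I. mu i (x i) else 0))"
  proof (intro sum.cong refl)
    fix a and x :: "nat \<Rightarrow> 'a"
    have "(\<Sum>j\<in>I. scal ((x(i := a)) j) (g j)) = (\<Sum>j\<in>I. scal (x j) (g j))"
      "(\<Prod>j\<in>I. mu j ((x(i := a)) j)) = (\<Prod>j\<in>I. mu j (x j))"
      using assms by (auto intro!: sum.cong prod.cong)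
    then show "?F (insert i I) (x(i := a)) = mu i a *
      (if (\<Sum>i\<in>I. scal (x i) (g i)) \<in> {u. scal a (g i) + u \<in> C} then \<Prod>i\<in>I. mu i (x i) else 0)"
      using assms by simp
  qed
  finally show ?thesis by (simp add: hit_def sum_distrib_left)
qed

lemma hit_nonneg: "(\<And>i a. i \<in> I \<Longrightarrow> 0 \<le> mu i a) \<Longrightarrow> 0 \<le> hit mu g I C"
  unfolding hit_def by (intro sum_nonneg) (auto intro!: prod_nonneg)

lemma sum_hit_le:
  assumes I: "finite I" "\<And>i. i \<in> I \<Longrightarrow> balanced_law \<alpha> (mu i)"
    and disj: "finite A" "\<And>a b. a \<in> A \<Longrightarrow> b \<in> A \<Longrightarrow> a \<noteq> b \<Longrightarrow> C a \<inter> C b = {}"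
  shows "(\<Sum>a\<in>A. hit mu g I (C a)) \<le> 1"
proof -
  let ?s = "\<lambda>x. \<Sum>i\<in>I. scal (x i) (g i)" and ?m = "\<lambda>x. \<Prod>i\<in>I. mu i (x i)"
  have "(\<Sum>a\<in>A. hit mu g I (C a)) = (\<Sum>x\<in>PiE I (\<lambda>_. UNIV). \<Sum>a\<in>A. if ?s x \<in> C a then ?m x else 0)"
    unfolding hit_def by (rule sum.swap)
  also have "\<dots> \<le> (\<Sum>x\<in>PiE I (\<lambda>_. UNIV). ?m x)"
  proof (rule sum_mono)
    fix x
    have m: "0 \<le> ?m x" using I(2) by (auto intro: prod_nonneg balanced_lawD)
    have "(\<Sum>a\<in>A. if ?s x \<in> C a then ?m x else 0) = ?m x * real (card {a\<in>A. ?s x \<in> C a})"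
      using disj(1) by (simp add: sum.If_cases Int_def mult.commute)
    also have "\<dots> \<le> ?m x * 1"
    proof (rule mult_left_mono[OF _ m])
      have "card {a\<in>A. ?s x \<in> C a} \<le> 1"
        using disj by (subst One_nat_def, subst card_le_Suc0_iff_eq) auto
      then show "real (card {a\<in>A. ?s x \<in> C a}) \<le> 1" by simp
    qed
    finally show "(\<Sum>a\<in>A. if ?s x \<in> C a then ?m x else 0) \<le> ?m x" by simp
  qed
  also have "\<dots> = (\<Prod>i\<in>I. \<Sum>a\<in>UNIV. mu i a)"
    using I by (subst prod_sum_PiE) auto
  also have "\<dots> = 1" by (simp add: balanced_lawD(3)[OF I(2)])
  finally show ?thesis .
qed

text \<open>Since \<open>g i \<notin> W\<close>, different values of the coefficient at
  \<open>i\<close> ask the remaining sum to lie in disjoint cosets. These probabilities add up to at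
  most 1 and each is at most the previous bound \<open>m\<close>, so \<open>balanced_sum_le\<close>
  gives the recursion \<open>m \<mapsto> \<alpha> + (1 - 2 * \<alpha>) * m\<close>. Started at 1,
  with fixed point 1/2, it solves to the stated formula.\<close>

lemma hit_coset_le:
  fixes g :: "nat \<Rightarrow> nat \<Rightarrow> 'a::{field,finite}"
  assumes "finite S" "\<And>i. i \<in> S \<Longrightarrow> balanced_law \<alpha> (mu i)" and \<alpha>: "0 \<le> \<alpha>" "\<alpha> \<le> 1 / 2"
    and W: "subsp W" and "\<And>i. i \<in> S \<Longrightarrow> g i \<notin> W"
  shows "hit mu g S {u. w - u \<in> W} \<le> (1 + (1 - 2 * \<alpha>) ^ card S) / 2"
  using assms(1,2,6)
proof (induction S arbitrary: w rule: finite_induct)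
  case empty
  then show ?case by (simp add: hit_empty)
next
  case (insert i S)
  let ?C = "\<lambda>a. {u. w - scal a (g i) - u \<in> W}"
  let ?m = "(1 + (1 - 2 * \<alpha>) ^ card S) / 2"
  have "hit mu g (insert i S) {u. w - u \<in> W} = (\<Sum>a\<in>UNIV. mu i a * hit mu g S (?C a))"
    by (subst hit_insert) (use insert.hyps in \<open>auto simp: diff_diff_eq\<close>)
  also have "\<dots> \<le> \<alpha> + (1 - 2 * \<alpha>) * ?m"
  proof (rule balanced_sum_le)
    show "(\<Sum>a\<in>UNIV. hit mu g S (?C a)) \<le> 1"
    proof (rule sum_hit_le)
      fix a b :: 'a assume "a \<noteq> b"
      show "?C a \<inter> ?C b = {}"
      proof (rule ccontr)
        assume "?C a \<inter> ?C b \<noteq> {}"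
        then obtain u where "w - scal a (g i) - u \<in> W" "w - scal b (g i) - u \<in> W" by blast
        then have "(w - scal a (g i) - u) - (w - scal b (g i) - u) \<in> W"
          using W by (rule_tac subsp_diff)
        then have "scal (1 / (b - a)) ((w - scal a (g i) - u) - (w - scal b (g i) - u)) \<in> W"
          using W by (rule_tac subsp_scal)
        also have "scal (1 / (b - a)) ((w - scal a (g i) - u) - (w - scal b (g i) - u)) = g i"
          using \<open>a \<noteq> b\<close> by (intro ext) (simp add: field_simps)
        finally show False using insert.prems by blast
      qed
    qed (use insert in auto)
    show "0 \<le> hit mu g S (?C a)" for a
      using insert.prems by (intro hit_nonneg) (auto intro: balanced_lawD)
    show "hit mu g S (?C a) \<le> ?m" for a
      using insert by (metis insert_iff)
  qed (use insert.prems \<alpha> in auto)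
  also have "\<dots> = (1 + (1 - 2 * \<alpha>) ^ card (insert i S)) / 2"
    using insert.hyps by (simp add: field_simps)
  finally show ?case .
qed

text \<open>Conditioning on the coefficients in \<open>S\<close>: the part over \<open>J\<close>
  always lies in \<open>W\<close>, so the part over \<open>S\<close> must reach the coset of
  \<open>w\<close>, after which \<open>m\<close> bounds the chance of the exact remaining
  target.\<close>

lemma hit_Un_le:
  assumes "finite S" "finite J" "S \<inter> J = {}" "\<And>i a. i \<in> S \<Longrightarrow> 0 \<le> mu i a"
    and W: "subsp W" "\<And>i. i \<in> J \<Longrightarrow> g i \<in> W" and m: "0 \<le> m" "\<And>u. u \<in> W \<Longrightarrow> hit mu g J {u} \<le> m"
  shows "hit mu g (S \<union> J) {w} \<le> hit mu g S {u. w - u \<in> W} * m"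
  using assms(1,3,4)
proof (induction S arbitrary: w rule: finite_induct)
  case empty
  have "hit mu g J {w} = 0" if "w \<notin> W"
    unfolding hit_def
  proof (rule sum.neutral, rule ballI)
    fix x
    have "(\<Sum>i\<in>J. scal (x i) (g i)) \<in> W"
      using W by (intro subsp_sum subsp_scal) auto
    then show "(if (\<Sum>i\<in>J. scal (x i) (g i)) \<in> {w} then \<Prod>i\<in>J. mu i (x i) else 0) = 0"
      using that by auto
  qed
  then show ?case using m by (simp add: hit_empty)
next
  case (insert i S)
  have "hit mu g (insert i S \<union> J) {w} = (\<Sum>a\<in>UNIV. mu i a * hit mu g (S \<union> J) {w - scal a (g i)})"
  proof -
    have eq: "{u. scal a (g i) + u \<in> {w}} = {w - scal a (g i)}" for a
      by (auto simp: eq_diff_eq add.commute)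
    have "hit mu g (insert i (S \<union> J)) {w} =
        (\<Sum>a\<in>UNIV. mu i a * hit mu g (S \<union> J) {u. scal a (g i) + u \<in> {w}})"
      using insert.hyps insert.prems assms(2) by (intro hit_insert) auto
    then show ?thesis unfolding eq by simp
  qed
  also have "\<dots> \<le> (\<Sum>a\<in>UNIV. mu i a * (hit mu g S {u. w - scal a (g i) - u \<in> W} * m))"
    using insert.prems by (intro sum_mono mult_left_mono insert.IH) auto
  also have "\<dots> = hit mu g (insert i S) {u. w - u \<in> W} * m"
    by (subst hit_insert) (use insert.hyps in \<open>simp_all add: diff_diff_eq sum_distrib_right mult.assoc\<close>)
  finally show ?case .
qed

text \<open>The indicator that the sum equals \<open>w\<close> is expanded in the characters
  \<open>chi (dot r u (s - w))\<close>; independence of the coefficients then turns each term into a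
  product over \<open>I\<close>.\<close>

lemma hit_fourier:
  fixes g :: "nat \<Rightarrow> nat \<Rightarrow> 'p::prime_card mod_ring" and r :: nat
  defines "V \<equiv> vspace r :: (nat \<Rightarrow> 'p mod_ring) set"
  assumes I: "finite I" "\<And>i. i \<in> I \<Longrightarrow> g i \<in> V" and w: "w \<in> V"
  shows "of_nat (card V) * complex_of_real (hit mu g I {w}) =
    (\<Sum>u\<in>V. cnj (chi (dot r u w)) * (\<Prod>i\<in>I. muhat (mu i) (dot r u (g i))))"
proof -
  let ?X = "PiE I (\<lambda>_. UNIV :: 'p mod_ring set)"
  let ?s = "\<lambda>x. \<Sum>i\<in>I. scal (x i) (g i)" and ?m = "\<lambda>x. \<Prod>i\<in>I. mu i (x i)"
  have "of_nat (card V) * complex_of_real (hit mu g I {w}) =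
      (\<Sum>x\<in>?X. of_real (?m x) * (if ?s x - w = 0 then of_nat (card V) else 0))"
    unfolding hit_def of_real_sum sum_distrib_left by (intro sum.cong) auto
  also have "\<dots> = (\<Sum>x\<in>?X. of_real (?m x) * (\<Sum>u\<in>V. chi (dot r u (?s x - w))))"
  proof (intro sum.cong refl arg_cong2[where f = "(*)"])
    fix x
    have "?s x - w \<in> V"
      unfolding V_def
      by (intro subsp_diff subsp_sum subsp_scal subsp_vspace) (use I w in \<open>auto simp: V_def\<close>)
    then show "(if ?s x - w = 0 then of_nat (card V) else 0) = (\<Sum>u\<in>V. chi (dot r u (?s x - w)))"
      unfolding V_def by (subst sum_chi_vspace) auto
  qed
  also have "\<dots> = (\<Sum>u\<in>V. cnj (chi (dot r u w)) *
      (\<Sum>x\<in>?X. \<Prod>i\<in>I. of_real (mu i (x i)) * chi (x i * dot r u (g i))))"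
    unfolding sum_distrib_left
    by (subst sum.swap)
      (simp add: dot_diff_right chi_diff dot_sum_right chi_sum dot_scal_right prod.distrib mult_ac)
  also have "\<dots> = (\<Sum>u\<in>V. cnj (chi (dot r u w)) * (\<Prod>i\<in>I. muhat (mu i) (dot r u (g i))))"
    unfolding muhat_def using I(1) by (subst prod_sum_PiE) auto
  finally show ?thesis .
qed

text \<open>Functionals vanishing on \<open>W\<close> contribute exactly 1 each, since all
  \<open>g i\<close> and \<open>w\<close> lie in \<open>W\<close>; by \<open>card_annih\<close> they
  form the main term \<open>1 / card W\<close>. Each remaining functional contributes at most
  \<open>B\<close>, and there are at most \<open>card V\<close> of them.\<close>

lemma hit_estimate:
  fixes g :: "nat \<Rightarrow> nat \<Rightarrow> 'p::prime_card mod_ring" and r :: nat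
  defines "V \<equiv> vspace r :: (nat \<Rightarrow> 'p mod_ring) set"
  assumes W: "subsp W" "W \<subseteq> V" and I: "finite I" "\<And>i. i \<in> I \<Longrightarrow> g i \<in> W"
    and mu: "\<And>i. i \<in> I \<Longrightarrow> balanced_law \<alpha> (mu i)" and w: "w \<in> W"
    and B: "\<And>u. u \<in> V - annih r W \<Longrightarrow> (\<Prod>i\<in>I. norm (muhat (mu i) (dot r u (g i)))) \<le> B"
    and B0: "0 \<le> B"
  shows "\<bar>hit mu g I {w} - 1 / real (card W)\<bar> \<le> B"
proof -
  let ?f = "\<lambda>u. cnj (chi (dot r u w)) * (\<Prod>i\<in>I. muhat (mu i) (dot r u (g i)))"
  have fin: "finite V" by (simp add: V_def)
  have q: "card (annih r W) * card W = card V"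
    unfolding V_def by (rule card_annih) (use W in \<open>auto simp: V_def\<close>)
  have V0: "card V > 0"
    using fin subsp_zero[OF subsp_vspace, of r] by (auto simp: V_def card_gt_0_iff)
  then have W0: "card W > 0" by (metis q bot_nat_0.not_eq_extremum mult_0_right)
  have mu1: "muhat (mu i) 0 = 1" if "i \<in> I" for i
    using balanced_lawD(3)[OF mu[OF that]] by (simp add: muhat_def flip: of_real_sum)
  have ann: "annih r W \<subseteq> V" by (auto simp: annih_def V_def)
  have "of_nat (card V) * complex_of_real (hit mu g I {w}) = (\<Sum>u\<in>V. ?f u)"
    unfolding V_def by (rule hit_fourier) (use I W w in \<open>auto simp: V_def\<close>)
  also have "\<dots> = (\<Sum>u\<in>annih r W. ?f u) + (\<Sum>u\<in>V - annih r W. ?f u)"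
    using fin ann by (simp add: sum.subset_diff add.commute)
  also have "(\<Sum>u\<in>annih r W. ?f u) = (\<Sum>u\<in>annih r W. 1)"
    using I(2) w mu1 by (intro sum.cong refl) (auto simp: annih_def)
  finally have "complex_of_real (card V * hit mu g I {w} - card (annih r W)) =
      (\<Sum>u\<in>V - annih r W. ?f u)"
    by simp
  then have "\<bar>card V * hit mu g I {w} - card (annih r W)\<bar> = norm (\<Sum>u\<in>V - annih r W. ?f u)"
    by (metis norm_of_real)
  also have "\<dots> \<le> (\<Sum>u\<in>V - annih r W. B)"
    by (rule sum_norm_le) (use B in \<open>simp add: norm_mult flip: prod_norm\<close>)
  also have "\<dots> \<le> card V * B"
    using fin B0 by (simp add: card_mono mult_right_mono)
  finally have "\<bar>card V * hit mu g I {w} - card (annih r W)\<bar> / card V \<le> B"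
    using V0 by (simp add: divide_le_eq mult.commute)
  moreover have "\<bar>card V * hit mu g I {w} - card (annih r W)\<bar> / card V =
      \<bar>(card V * hit mu g I {w} - card (annih r W)) / card V\<bar>"
    by simp
  moreover have "(card V * hit mu g I {w} - card (annih r W)) / card V =
      hit mu g I {w} - 1 / card W"
    using V0 W0 by (simp add: field_simps flip: q)
  ultimately show ?thesis by simp
qed

section \<open>Concentration and the stratification by subspaces\<close>

lemma exp_minus_le_quadratic:
  fixes y :: real
  assumes "0 \<le> y"
  shows "exp (- y) \<le> 1 - y + y\<^sup>2 / 2"
proof -
  have pos: "0 < 1 + y + y\<^sup>2 / 2" using assms by (simp add: add_pos_nonneg)
  have "exp (- y) \<le> 1 / (1 + y + y\<^sup>2 / 2)"
    unfolding exp_minus inverse_eq_divide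
    by (rule divide_left_mono) (use exp_lower_Taylor_quadratic[OF assms] pos in auto)
  also have "\<dots> \<le> 1 - y + y\<^sup>2 / 2"
  proof -
    \<comment> \<open>With \<open>z = 1 + y^2 / 2\<close> this is
      \<open>(z - y) * (z + y) = z^2 - y^2\<close>, in which the terms \<open>y^2\<close>
      cancel.\<close>
    have "(1 - y + y\<^sup>2 / 2) * (1 + y + y\<^sup>2 / 2) = 1 + (y\<^sup>2 / 2)\<^sup>2"
      by (simp add: power2_eq_square field_simps)
    then have "1 \<le> (1 - y + y\<^sup>2 / 2) * (1 + y + y\<^sup>2 / 2)" by simp
    then show ?thesis using pos by (simp add: divide_le_eq)
  qed
  finally show ?thesis .
qed

text \<open>As \<open>v\<close> runs over \<open>W\<close>, \<open>dot r u v\<close> is uniform on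
  the field, so only the sum over the field matters. In the second-order expansion
  \<open>sum_tgap_ge\<close> controls the linear term and the truncation level the quadratic one;
  both depend on \<open>s * \<alpha>\<close>, so \<open>s\<close> may be of order
  \<open>1 / \<alpha>\<close>.\<close>

lemma sum_exp_tgap_le:
  fixes W :: "(nat \<Rightarrow> 'p::prime_card mod_ring) set" and m :: "'p mod_ring \<Rightarrow> real"
  assumes W: "finite W" "subsp W" "\<exists>w\<in>W. dot r u w \<noteq> 0"
    and m: "balanced_law \<alpha> m" "0 \<le> \<alpha>" "\<alpha> \<le> 1 / 2" and s: "0 \<le> s"
  shows "(\<Sum>v\<in>W. exp (- s * tgap \<alpha> m (dot r u v))) \<le>
    real (card W) * exp (- 2 * (s * \<alpha>) * (1 - \<alpha>) + 2 * (real CARD('p))\<^sup>2 * (s * \<alpha>)\<^sup>2)"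
proof -
  let ?p = "real CARD('p)"
  let ?E = "- 2 * (s * \<alpha>) * (1 - \<alpha>) + 2 * ?p\<^sup>2 * (s * \<alpha>)\<^sup>2"
  have p: "?p > 0" by simp
  have "exp (- s * tgap \<alpha> m c) \<le> 1 - s * tgap \<alpha> m c + (2 * ?p * (s * \<alpha>))\<^sup>2 / 2" for c
  proof -
    have z: "0 \<le> s * tgap \<alpha> m c" using m s by (simp add: tgap_nonneg)
    have "s * tgap \<alpha> m c \<le> s * (2 * ?p * \<alpha>)"
      by (intro mult_left_mono tgap_le s)
    then have "(s * tgap \<alpha> m c)\<^sup>2 \<le> (2 * ?p * (s * \<alpha>))\<^sup>2"
      using z by (intro power_mono) (auto simp: mult_ac)
    then show ?thesis using exp_minus_le_quadratic[OF z] by simp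
  qed
  then have "(\<Sum>c\<in>UNIV. exp (- s * tgap \<alpha> m c)) \<le>
      (\<Sum>c\<in>UNIV. 1 - s * tgap \<alpha> m c + (2 * ?p * (s * \<alpha>))\<^sup>2 / 2)"
    by (intro sum_mono)
  also have "\<dots> = ?p - s * (\<Sum>c\<in>UNIV. tgap \<alpha> m c) + ?p * ((2 * ?p * (s * \<alpha>))\<^sup>2 / 2)"
    by (simp add: sum.distrib sum_subtractf sum_distrib_left)
  also have "\<dots> \<le> ?p - s * (2 * ?p * \<alpha> * (1 - \<alpha>)) + ?p * ((2 * ?p * (s * \<alpha>))\<^sup>2 / 2)"
    using mult_left_mono[OF sum_tgap_ge[OF m] s] by simp
  also have "\<dots> = ?p * (1 + ?E)" by (simp add: power2_eq_square algebra_simps)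
  also have "\<dots> \<le> ?p * exp ?E" using p by (intro mult_left_mono exp_ge_add_one_self) auto
  finally have "real (card W) * (\<Sum>c\<in>UNIV. exp (- s * tgap \<alpha> m c)) \<le> real (card W) * (?p * exp ?E)"
    by (rule mult_left_mono) simp
  moreover have "?p * (\<Sum>v\<in>W. exp (- s * tgap \<alpha> m (dot r u v))) =
      real (card W) * (\<Sum>c\<in>UNIV. exp (- s * tgap \<alpha> m c))"
    using equidistributed_dot[OF W, of "\<lambda>c. exp (- s * tgap \<alpha> m c)"] by simp
  ultimately have "?p * (\<Sum>v\<in>W. exp (- s * tgap \<alpha> m (dot r u v))) \<le> ?p * (real (card W) * exp ?E)"
    by (simp add: mult_ac)
  then show ?thesis using p by (metis mult_le_cancel_left_pos)
qed

text \<open>Chernoff's bound for a uniform tuple \<open>h\<close>. The summands are independent but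
  follow different laws; this is harmless because the moment bound for each factor depends on
  \<open>\<alpha>\<close> alone.\<close>

lemma card_small_tgap_le:
  fixes W :: "(nat \<Rightarrow> 'p::prime_card mod_ring) set" and m :: "nat \<Rightarrow> 'p mod_ring \<Rightarrow> real"
  assumes W: "finite W" "subsp W" "\<exists>w\<in>W. dot r u w \<noteq> 0" and I: "finite I"
    and m: "\<And>i. i \<in> I \<Longrightarrow> balanced_law \<alpha> (m i)" "0 \<le> \<alpha>" "\<alpha> \<le> 1 / 2" and s: "0 \<le> s"
  shows "real (card {h \<in> PiE I (\<lambda>_. W). (\<Sum>i\<in>I. tgap \<alpha> (m i) (dot r u (h i))) < x}) \<le>
    real (card W) ^ card I * exp (real (card I) *
      (- 2 * (s * \<alpha>) * (1 - \<alpha>) + 2 * (real CARD('p))\<^sup>2 * (s * \<alpha>)\<^sup>2) + s * x)"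
proof -
  let ?E = "- 2 * (s * \<alpha>) * (1 - \<alpha>) + 2 * (real CARD('p))\<^sup>2 * (s * \<alpha>)\<^sup>2"
  let ?X = "PiE I (\<lambda>_. W)" and ?t = "\<lambda>h. \<Sum>i\<in>I. tgap \<alpha> (m i) (dot r u (h i))"
  have fin: "finite ?X" using I W by (simp add: finite_PiE)
  have "real (card {h \<in> ?X. ?t h < x}) * exp (- s * x) = (\<Sum>h\<in>{h \<in> ?X. ?t h < x}. exp (- s * x))"
    by simp
  also have "\<dots> \<le> (\<Sum>h\<in>{h \<in> ?X. ?t h < x}. exp (- s * ?t h))"
    using s by (intro sum_mono) (auto intro!: mult_left_mono)
  also have "\<dots> \<le> (\<Sum>h\<in>?X. exp (- s * ?t h))"
    using fin by (intro sum_mono2) auto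
  also have "\<dots> = (\<Sum>h\<in>?X. \<Prod>i\<in>I. exp (- s * tgap \<alpha> (m i) (dot r u (h i))))"
    using I by (simp add: sum_distrib_left flip: exp_sum sum_negf)
  also have "\<dots> = (\<Prod>i\<in>I. \<Sum>v\<in>W. exp (- s * tgap \<alpha> (m i) (dot r u v)))"
    using I W by (subst prod_sum_PiE) auto
  also have "\<dots> \<le> (\<Prod>i\<in>I. real (card W) * exp ?E)"
    using sum_exp_tgap_le[OF W m s] by (intro prod_mono) (auto intro: sum_nonneg)
  also have "\<dots> = real (card W) ^ card I * exp (real (card I) * ?E)"
    by (simp add: power_mult_distrib exp_of_nat_mult)
  finally have "real (card {h \<in> ?X. ?t h < x}) * exp (- s * x) * exp (s * x) \<le>
      real (card W) ^ card I * exp (real (card I) * ?E) * exp (s * x)"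
    by (rule mult_right_mono) simp
  then show ?thesis by (simp add: exp_add mult.assoc flip: exp_add)
qed

text \<open>\<open>W\<close> minimises the number of \<open>i\<close> with \<open>g i \<notin> W\<close> plus \<open>d\<close> times the cardinality of \<open>W\<close>.\<close>

lemma robust_subspace_exists:
  fixes g :: "nat \<Rightarrow> nat \<Rightarrow> 'p::prime_card mod_ring" and r :: nat
  defines "V \<equiv> vspace r :: (nat \<Rightarrow> 'p mod_ring) set"
  assumes g: "\<And>i. i < n \<Longrightarrow> g i \<in> V" and d: "0 \<le> d"
  obtains W where "subsp W" "W \<subseteq> V" "real (card {i\<in>{..<n}. g i \<notin> W}) \<le> d * real (card V)"
    "\<And>u. u \<in> V - annih r W \<Longrightarrow> d \<le> real (card {i\<in>{..<n}. g i \<in> W \<and> dot r u (g i) \<noteq> 0})"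
proof -
  define F where "F W = real (card {i\<in>{..<n}. g i \<notin> W}) + d * real (card W)" for W
  let ?\<W> = "{W. subsp W \<and> W \<subseteq> V}"
  have finV: "finite V" by (simp add: V_def)
  have fin: "finite ?\<W>" using finV by simp
  have V: "V \<in> ?\<W>" by (simp add: V_def subsp_vspace)
  define W where "W = arg_min_on F ?\<W>"
  have W: "W \<in> ?\<W>"
    unfolding W_def by (rule arg_min_if_finite(1)[OF fin]) (use V in blast)
  have min: "F W \<le> F W'" if "W' \<in> ?\<W>" for W'
    unfolding W_def by (rule arg_min_least[OF fin _ that]) (use V in blast)
  show ?thesis
  proof
    show "subsp W" "W \<subseteq> V" using W by auto
    have "real (card {i\<in>{..<n}. g i \<notin> W}) \<le> F W" using d by (simp add: F_def)
    also have "\<dots> \<le> F V" by (rule min[OF V])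
    also have "{i\<in>{..<n}. g i \<notin> V} = {}" using g by auto
    then have "F V = d * real (card V)" by (simp add: F_def)
    finally show "real (card {i\<in>{..<n}. g i \<notin> W}) \<le> d * real (card V)" .
  next
    fix u assume u: "u \<in> V - annih r W"
    \<comment> \<open>The competitor is the kernel of \<open>u\<close> in \<open>W\<close>. It has
      at least one element fewer, which lowers the functional by at least \<open>d\<close>; by
      minimality at least \<open>d\<close> indices must leave \<open>W\<close> in return.\<close>
    let ?W' = "{v\<in>W. dot r u v = 0}"
    have W': "?W' \<in> ?\<W>"
      using W by (auto simp: dot_add_right dot_scal_right intro: subsp_zero subsp_add subsp_scal)
        (auto simp: subsp_def dot_add_right dot_scal_right)
    have "?W' \<subset> W" using u by (auto simp: annih_def V_def)
    then have "card ?W' < card W"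
      using W finV by (intro psubset_card_mono) (auto intro: finite_subset)
    then have "real (card ?W') + 1 \<le> real (card W)" by linarith
    then have "d * (real (card ?W') + 1) \<le> d * real (card W)" using d by (rule mult_left_mono)
    moreover have "{i\<in>{..<n}. g i \<notin> ?W'} =
        {i\<in>{..<n}. g i \<notin> W} \<union> {i\<in>{..<n}. g i \<in> W \<and> dot r u (g i) \<noteq> 0}"
      by auto
    then have "card {i\<in>{..<n}. g i \<notin> ?W'} =
        card {i\<in>{..<n}. g i \<notin> W} + card {i\<in>{..<n}. g i \<in> W \<and> dot r u (g i) \<noteq> 0}"
      by (simp only:) (intro card_Un_disjoint, auto)
    ultimately show "d \<le> real (card {i\<in>{..<n}. g i \<in> W \<and> dot r u (g i) \<noteq> 0})"
      using min[OF W'] by (simp add: F_def algebra_simps)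
  qed
qed

lemma sum_UN_le:
  fixes f :: "'b \<Rightarrow> real"
  assumes "finite J" "\<And>x. x \<in> J \<Longrightarrow> finite (A x)" "\<And>y. 0 \<le> f y"
  shows "(\<Sum>y\<in>(\<Union>x\<in>J. A x). f y) \<le> (\<Sum>x\<in>J. \<Sum>y\<in>A x. f y)"
  using assms(1,2)
proof (induction J rule: finite_induct)
  case (insert x J)
  have "(\<Sum>y\<in>A x \<union> (\<Union>x\<in>J. A x). f y) \<le> (\<Sum>y\<in>A x. f y) + (\<Sum>y\<in>(\<Union>x\<in>J. A x). f y)"
    using insert assms(3) by (subst sum_Un) (auto intro!: sum_nonneg)
  then show ?case using insert by simp
qed simp

lemma hit_cong: "(\<And>i. i \<in> I \<Longrightarrow> g i = g' i) \<Longrightarrow> hit mu g I C = hit mu g' I C"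
  by (simp add: hit_def)

text \<open>Spanning over the field, stated through containing subspaces: this is the form in which
  an empty exceptional set forces \<open>W = V\<close>.\<close>

definition spanning :: "(nat \<Rightarrow> 'a::comm_ring_1) set \<Rightarrow> nat \<Rightarrow> (nat \<Rightarrow> nat \<Rightarrow> 'a) set" where
  "spanning V n = {g \<in> PiE {..<n} (\<lambda>_. V).
    \<forall>W. subsp W \<longrightarrow> W \<subseteq> V \<longrightarrow> (\<forall>i<n. g i \<in> W) \<longrightarrow> W = V}"

text \<open>\<open>mu j i\<close> is the law of the entry in row \<open>i\<close> and column
  \<open>j\<close>, column index first. The product over \<open>j\<close> reflects the independence
  of the columns.\<close>

definition weight :: "(nat \<Rightarrow> nat \<Rightarrow> 'a::{comm_ring_1,finite} \<Rightarrow> real) \<Rightarrow>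
    ((nat \<Rightarrow> 'a) \<Rightarrow> nat \<Rightarrow> 'a) \<Rightarrow> nat \<Rightarrow> (nat \<Rightarrow> nat \<Rightarrow> 'a) \<Rightarrow> real" where
  "weight mu T n g = (\<Prod>j<n. hit (mu j) g {..<n} {T (g j)})"

text \<open>One fixed \<open>n\<close> with all constants, so that the estimates are explicit
  inequalities. \<open>\<theta>\<close> is the share of \<open>n \<alpha>\<close> kept in the
  exponent and \<open>\<eta>\<close> a quarter of what is given up. \<open>\<delta>\<close> is the
  proportion in robustness, and \<open>\<delta> * q \<le> \<eta>\<close> keeps exceptional sets
  below \<open>\<eta> n\<close>.\<close>

locale column_model =
  fixes r n :: nat and mu :: "nat \<Rightarrow> nat \<Rightarrow> 'p::prime_card mod_ring \<Rightarrow> real"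
    and T :: "(nat \<Rightarrow> 'p mod_ring) \<Rightarrow> nat \<Rightarrow> 'p mod_ring"
    and \<alpha> \<theta> \<eta> \<delta> \<kappa> :: real and V :: "(nat \<Rightarrow> 'p mod_ring) set" and q :: real
  assumes V_def: "V = vspace r" and q_def: "q = real (card V)"
    and law: "\<And>j i. j < n \<Longrightarrow> i < n \<Longrightarrow> balanced_law \<alpha> (mu j i)"
    and T: "\<And>v. v \<in> V \<Longrightarrow> T v \<in> V"
    and \<theta>: "0 < \<theta>" "\<theta> < 1" and \<eta>: "\<eta> = (1 - \<theta>) / 4" and \<alpha>: "0 < \<alpha>" "\<alpha> \<le> \<eta>"
    and \<delta>: "0 < \<delta>" "\<delta> * q \<le> \<eta>"
    and \<kappa>: "0 < \<kappa>" "\<kappa> \<le> 1" "\<And>a :: 'p mod_ring. a \<noteq> 0 \<Longrightarrow> \<kappa> \<le> 1 - Re (chi a)"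
begin

text \<open>
  \<open>X1\<close> and \<open>X2\<close> bound the distance of a column probability from uniform for a typical (\<open>good\<close>) and
  for a merely \<open>robust\<close> tuple; \<open>n q X3\<close> bounds the proportion of tuples that are not \<open>good\<close>.
\<close>

definition X1 :: real where "X1 = exp (- (\<theta> * (real n * \<alpha>)))"
definition X2 :: real where "X2 = exp (- (\<delta> * \<kappa> / 2 * (real n * \<alpha>)))"
definition X3 :: real where "X3 = exp (- (2 * \<eta>\<^sup>2 / (real CARD('p))\<^sup>2 * real n))"

lemma finite_V: "finite V"
  by (simp add: V_def)

lemma q_ge_1: "1 \<le> q"
proof -
  have "card V > 0"
    using finite_V subsp_zero[OF subsp_vspace, of r] by (auto simp: V_def card_gt_0_iff)
  then show ?thesis by (simp add: q_def)
qed

lemma \<alpha>_le_half: "\<alpha> \<le> 1 / 2"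
  using \<alpha> \<eta> \<theta> by simp

lemma card_subsp:
  assumes "subsp W" "W \<subseteq> V"
  shows "finite W" "1 \<le> real (card W)" "real (card W) \<le> q"
proof -
  show fin: "finite W" using assms finite_V finite_subset by blast
  then have "card W > 0" using subsp_zero[OF assms(1)] by (auto simp: card_gt_0_iff)
  then show "1 \<le> real (card W)" by simp
  show "real (card W) \<le> q" using assms finite_V by (simp add: q_def card_mono)
qed

text \<open>The factor 2 compensates the halving in \<open>norm_muhat_le\<close>, so that good
  tuples have column error \<open>X1\<close>.\<close>

definition good :: "(nat \<Rightarrow> 'p mod_ring) set \<Rightarrow> nat set \<Rightarrow> (nat \<Rightarrow> nat \<Rightarrow> 'p mod_ring) set" where
  "good W I = {h \<in> PiE I (\<lambda>_. W). \<forall>j<n. \<forall>u\<in>V - annih r W.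
    2 * (\<theta> * (real n * \<alpha>)) \<le> (\<Sum>i\<in>I. tgap \<alpha> (mu j i) (dot r u (h i)))}"

definition robust :: "(nat \<Rightarrow> 'p mod_ring) set \<Rightarrow> nat set \<Rightarrow> (nat \<Rightarrow> nat \<Rightarrow> 'p mod_ring) set" where
  "robust W I = {h \<in> PiE I (\<lambda>_. W). \<forall>u\<in>V - annih r W.
    \<delta> * real n \<le> real (card {i\<in>I. dot r u (h i) \<noteq> 0})}"

text \<open>A union bound over at most \<open>n\<close> columns and \<open>q\<close> functionals,
  each treated by \<open>card_small_tgap_le\<close> with \<open>s = lam / \<alpha>\<close>. Of the
  four portions \<open>\<eta>\<close> in \<open>1 - \<theta>\<close>, one pays for
  \<open>\<alpha>\<close>, one for the quadratic term, one for the indices missing from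
  \<open>I\<close>, and one is left as decay.\<close>

lemma card_not_good_le:
  assumes W: "subsp W" "W \<subseteq> V" and I: "I \<subseteq> {..<n}" "(1 - \<eta>) * real n \<le> real (card I)"
  shows "real (card (PiE I (\<lambda>_. W) - good W I)) \<le> real (card W) ^ card I * (real n * q * X3)"
proof -
  define B where "B = (\<lambda>(j, u). {h \<in> PiE I (\<lambda>_. W).
    (\<Sum>i\<in>I. tgap \<alpha> (mu j i) (dot r u (h i))) < 2 * (\<theta> * (real n * \<alpha>))})"
  let ?p = "real CARD('p)" and ?J = "{..<n} \<times> (V - annih r W)"
  \<comment> \<open>With this choice the quadratic term \<open>2 * ?p^2 * lam^2\<close> equals
    \<open>2 * lam * \<eta>\<close>.\<close>
  define lam where "lam = \<eta> / ?p\<^sup>2"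
  have fI: "finite I" using I finite_subset by blast
  have \<eta>0: "0 < \<eta>" "\<eta> < 1 / 4" using \<theta> \<eta> by auto
  then have lam: "0 < lam" by (simp add: lam_def)
  have \<theta>_eq: "\<theta> = 1 - 4 * \<eta>" using \<eta> by simp
  have B: "real (card (B (j, u))) \<le> real (card W) ^ card I * X3" if "(j, u) \<in> ?J" for j u
  proof -
    let ?s = "lam / \<alpha>"
    let ?E = "- 2 * (?s * \<alpha>) * (1 - \<alpha>) + 2 * ?p\<^sup>2 * (?s * \<alpha>)\<^sup>2"
    have s: "?s * \<alpha> = lam" using \<alpha> by simp
    have "real (card (B (j, u))) \<le> real (card W) ^ card I *
        exp (real (card I) * ?E + ?s * (2 * (\<theta> * (real n * \<alpha>))))"
      unfolding B_def prod.case
      by (rule card_small_tgap_le)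
        (use that W I fI card_subsp[OF W] law \<alpha> \<alpha>_le_half lam in \<open>auto simp: annih_def V_def\<close>)
    also have "real (card I) * ?E + ?s * (2 * (\<theta> * (real n * \<alpha>))) \<le> - (2 * \<eta>\<^sup>2 / ?p\<^sup>2 * real n)"
    proof -
      have "?E = - 2 * lam * (1 - \<alpha> - \<eta>)"
        unfolding s by (simp add: lam_def power2_eq_square field_simps)
      also have "\<dots> \<le> - 2 * lam * (1 - 2 * \<eta>)"
        using \<alpha> lam by (intro mult_left_mono_neg) auto
      finally have "real (card I) * ?E \<le> real (card I) * (- 2 * lam * (1 - 2 * \<eta>))"
        by (rule mult_left_mono) simp
      also have "\<dots> \<le> ((1 - \<eta>) * real n) * (- 2 * lam * (1 - 2 * \<eta>))"
        using I(2) lam \<eta>0 by (intro mult_right_mono_neg) (auto simp: mult_nonneg_nonneg)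
      \<comment> \<open>Uses \<open>(1 - \<eta>) * (1 - 2 * \<eta>) \<ge> 1 - 3 * \<eta>\<close>.
        Since \<open>\<theta> = 1 - 4 * \<eta>\<close>, an excess of
        \<open>2 * lam * \<eta> * n\<close> remains, which is the exponent of
        \<open>X3\<close>.\<close>
      also have "\<dots> \<le> real n * (- 2 * lam * (1 - 3 * \<eta>))"
        using lam \<eta>0 by (simp add: algebra_simps)
      also have "\<dots> = - (2 * \<eta>\<^sup>2 / ?p\<^sup>2 * real n) - ?s * (2 * (\<theta> * (real n * \<alpha>)))"
        unfolding \<theta>_eq using \<alpha>(1) by (simp add: lam_def power2_eq_square field_simps)
      finally show ?thesis by simp
    qed
    finally show ?thesis by (simp add: X3_def mult_left_mono)
  qed
  have "PiE I (\<lambda>_. W) - good W I \<subseteq> \<Union> (B ` ?J)"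
    by (auto simp: good_def B_def not_le)
  moreover have "finite (\<Union> (B ` ?J))"
    using finite_V card_subsp[OF W] fI by (auto simp: B_def finite_PiE)
  ultimately have "card (PiE I (\<lambda>_. W) - good W I) \<le> card (\<Union> (B ` ?J))"
    by (rule card_mono[rotated])
  also have "\<dots> \<le> (\<Sum>x\<in>?J. card (B x))"
    using finite_V by (intro card_UN_le) auto
  finally have "real (card (PiE I (\<lambda>_. W) - good W I)) \<le> (\<Sum>x\<in>?J. real (card (B x)))"
    by (simp flip: of_nat_sum)
  also have "\<dots> \<le> (\<Sum>x\<in>?J. real (card W) ^ card I * X3)"
    using B by (intro sum_mono) auto
  also have "\<dots> \<le> (real n * q) * (real (card W) ^ card I * X3)"
    using finite_V unfolding q_def
    by (simp add: card_cartesian_product X3_def mult_mono card_mono)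
  finally show ?thesis by (simp add: mult_ac)
qed

lemma hit_close:
  assumes W: "subsp W" "W \<subseteq> V" and I: "I \<subseteq> {..<n}" and j: "j < n"
    and h: "\<And>i. i \<in> I \<Longrightarrow> h i \<in> W" and w: "w \<in> W"
    and x: "\<And>u. u \<in> V - annih r W \<Longrightarrow> 2 * x \<le> (\<Sum>i\<in>I. tgap \<alpha> (mu j i) (dot r u (h i)))"
  shows "\<bar>hit (mu j) h I {w} - 1 / real (card W)\<bar> \<le> exp (- x)"
proof -
  have fI: "finite I" using I finite_subset by blast
  show ?thesis
  proof (rule hit_estimate[where r = r and \<alpha> = \<alpha>])
    fix u assume "u \<in> vspace r - annih r W"
    then have u: "u \<in> V - annih r W" by (simp add: V_def)
    have "(\<Prod>i\<in>I. norm (muhat (mu j i) (dot r u (h i)))) \<le>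
        (\<Prod>i\<in>I. exp (- tgap \<alpha> (mu j i) (dot r u (h i)) / 2))"
      by (intro prod_mono conjI norm_muhat_le norm_ge_zero)
    also have "\<dots> = exp (- (\<Sum>i\<in>I. tgap \<alpha> (mu j i) (dot r u (h i))) / 2)"
      using fI by (simp add: sum_negf sum_divide_distrib flip: exp_sum)
    also have "\<dots> \<le> exp (- x)" using x[OF u] by simp
    finally show "(\<Prod>i\<in>I. norm (muhat (mu j i) (dot r u (h i)))) \<le> exp (- x)" .
  qed (use W I fI h w j law in \<open>auto simp: V_def\<close>)
qed

lemma hit_close_good:
  assumes W: "subsp W" "W \<subseteq> V" and I: "I \<subseteq> {..<n}" and j: "j < n" and h: "h \<in> good W I" and w: "w \<in> W"
  shows "\<bar>hit (mu j) h I {w} - 1 / real (card W)\<bar> \<le> X1"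
  unfolding X1_def using h by (intro hit_close W I j w) (auto simp: good_def j)

text \<open>At least \<open>\<delta> n\<close> indices see a nonzero value of the functional, and
  each contributes \<open>\<kappa> * \<alpha>\<close>. This holds for every robust tuple and every
  admissible law, at the price of a poor constant.\<close>

lemma hit_close_robust:
  assumes W: "subsp W" "W \<subseteq> V" and I: "I \<subseteq> {..<n}" and j: "j < n" and h: "h \<in> robust W I" and w: "w \<in> W"
  shows "\<bar>hit (mu j) h I {w} - 1 / real (card W)\<bar> \<le> X2"
  unfolding X2_def
proof (intro hit_close W I j w)
  show "h i \<in> W" if "i \<in> I" for i using h that by (auto simp: robust_def)
  fix u assume u: "u \<in> V - annih r W"
  have fI: "finite I" using I finite_subset by blast
  have "2 * (\<delta> * \<kappa> / 2 * (real n * \<alpha>)) = (\<delta> * real n) * (\<kappa> * \<alpha>)" by simp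
  also have "\<dots> \<le> real (card {i\<in>I. dot r u (h i) \<noteq> 0}) * (\<kappa> * \<alpha>)"
    using h u \<kappa> \<alpha> by (intro mult_right_mono) (auto simp: robust_def)
  also have "\<dots> = (\<Sum>i\<in>{i\<in>I. dot r u (h i) \<noteq> 0}. \<kappa> * \<alpha>)" by simp
  also have "\<dots> \<le> (\<Sum>i\<in>{i\<in>I. dot r u (h i) \<noteq> 0}. tgap \<alpha> (mu j i) (dot r u (h i)))"
    using I j law \<alpha> \<kappa> by (intro sum_mono tgap_ge) auto
  also have "\<dots> \<le> (\<Sum>i\<in>I. tgap \<alpha> (mu j i) (dot r u (h i)))"
    using fI I j law \<alpha> by (intro sum_mono2) (auto intro!: tgap_nonneg)
  finally show "2 * (\<delta> * \<kappa> / 2 * (real n * \<alpha>)) \<le> \<dots>" .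
qed

section \<open>The upper bound: summing weights over the strata\<close>

definition bound :: "(nat \<Rightarrow> 'p mod_ring) set \<Rightarrow> nat set \<Rightarrow> (nat \<Rightarrow> nat \<Rightarrow> 'p mod_ring) \<Rightarrow> real" where
  "bound W I h = (1 + q * (if h \<in> good W I then X1 else X2)) / real (card W)"

lemma hit_le_bound:
  assumes W: "subsp W" "W \<subseteq> V" and I: "I \<subseteq> {..<n}" and j: "j < n" and h: "h \<in> robust W I" and w: "w \<in> W"
  shows "hit (mu j) h I {w} \<le> bound W I h"
proof -
  let ?B = "if h \<in> good W I then X1 else X2"
  have B0: "0 \<le> ?B" by (simp add: X1_def X2_def)
  have "hit (mu j) h I {w} \<le> 1 / real (card W) + ?B"
    using hit_close_good[OF W I j _ w, of h] hit_close_robust[OF W I j h w] by (auto split: if_splits)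
  also have "?B \<le> (q * ?B) / real (card W)"
    using mult_right_mono[OF card_subsp(3)[OF W] B0] card_subsp(2)[OF W]
    by (simp add: le_divide_eq mult.commute)
  finally show ?thesis by (simp add: bound_def add_divide_distrib)
qed

text \<open>The contribution of the good tuples plus that of the others. Although
  \<open>(1 + q * X2) ^ n\<close> may grow with \<open>n\<close>, for \<open>\<alpha>\<close> of
  order \<open>ln n / n\<close> its logarithm is of smaller order than \<open>n\<close>, so
  \<open>X3\<close> dominates it.\<close>

definition C :: real where
  "C = (1 + q * X1) ^ n + real n * q * X3 * (1 + q * X2) ^ n"

lemma C_nonneg: "0 \<le> C"
  using q_ge_1 by (simp add: C_def X1_def X2_def X3_def)

text \<open>At most \<open>card W ^ card I\<close> tuples meet \<open>n\<close> column factors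
  \<open>1 / card W\<close>, and \<open>card I \<le> n\<close>, so the powers of
  \<open>card W\<close> cost nothing.\<close>

lemma sum_bound_le:
  assumes W: "subsp W" "W \<subseteq> V" and I: "I \<subseteq> {..<n}" "(1 - \<eta>) * real n \<le> real (card I)"
  shows "(\<Sum>h\<in>robust W I. bound W I h ^ n) \<le> C"
proof -
  let ?X = "PiE I (\<lambda>_. W)" and ?w = "real (card W)"
  have fI: "finite I" using I finite_subset by blast
  have fX: "finite ?X" using fI card_subsp[OF W] by (simp add: finite_PiE)
  have gX: "good W I \<subseteq> ?X" by (auto simp: good_def)
  have w: "1 \<le> ?w" by (rule card_subsp[OF W])
  have X: "0 \<le> X1" "0 \<le> X2" "0 \<le> X3" by (simp_all add: X1_def X2_def X3_def)
  have b0: "0 \<le> bound W I h" for h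
    using q_ge_1 X by (auto simp: bound_def)
  have "(\<Sum>h\<in>robust W I. bound W I h ^ n) \<le> (\<Sum>h\<in>?X. bound W I h ^ n)"
    by (rule sum_mono2[OF fX]) (auto simp: robust_def b0)
  also have "\<dots> = (\<Sum>h\<in>good W I. bound W I h ^ n) + (\<Sum>h\<in>?X - good W I. bound W I h ^ n)"
    using fX gX by (simp add: sum.subset_diff add.commute)
  also have "(\<Sum>h\<in>good W I. bound W I h ^ n) = real (card (good W I)) * ((1 + q * X1) ^ n / ?w ^ n)"
    by (simp add: bound_def power_divide)
  also have "(\<Sum>h\<in>?X - good W I. bound W I h ^ n) =
      real (card (?X - good W I)) * ((1 + q * X2) ^ n / ?w ^ n)"
    by (simp add: bound_def power_divide)
  also have "real (card (good W I)) * ((1 + q * X1) ^ n / ?w ^ n) \<le>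
      ?w ^ card I * ((1 + q * X1) ^ n / ?w ^ n)"
  proof (rule mult_right_mono)
    have "card (good W I) \<le> card ?X" by (rule card_mono[OF fX gX])
    then show "real (card (good W I)) \<le> ?w ^ card I"
      using fI by (simp add: card_PiE flip: of_nat_power)
  qed (use q_ge_1 X in auto)
  also have "real (card (?X - good W I)) * ((1 + q * X2) ^ n / ?w ^ n) \<le>
      (?w ^ card I * (real n * q * X3)) * ((1 + q * X2) ^ n / ?w ^ n)"
    using card_not_good_le[OF W I] q_ge_1 X by (intro mult_right_mono) auto
  also have "?w ^ card I * ((1 + q * X1) ^ n / ?w ^ n) +
      (?w ^ card I * (real n * q * X3)) * ((1 + q * X2) ^ n / ?w ^ n) = ?w ^ card I / ?w ^ n * C"
    by (simp add: C_def algebra_simps add_divide_distrib)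
  also have "\<dots> \<le> 1 * C"
  proof (rule mult_right_mono[OF _ C_nonneg])
    have "card I \<le> n" using I(1) card_mono[of "{..<n}" I] by simp
    then have "?w ^ card I \<le> ?w ^ n" using w by (rule power_increasing)
    then show "?w ^ card I / ?w ^ n \<le> 1" using w by (simp add: divide_le_eq_1)
  qed
  finally show ?thesis by simp
qed

definition stratum :: "(nat \<Rightarrow> 'p mod_ring) set \<Rightarrow> nat set \<Rightarrow> (nat \<Rightarrow> nat \<Rightarrow> 'p mod_ring) set" where
  "stratum W S = {g \<in> PiE {..<n} (\<lambda>_. V). {i\<in>{..<n}. g i \<notin> W} = S \<and>
    restrict g ({..<n} - S) \<in> robust W ({..<n} - S)}"

lemma mu_nonneg: "j < n \<Longrightarrow> i < n \<Longrightarrow> 0 \<le> mu j i a"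
  using law by (rule balanced_lawD(1))

lemma hit_mu_nonneg: "j < n \<Longrightarrow> I \<subseteq> {..<n} \<Longrightarrow> 0 \<le> hit (mu j) g I D"
  by (intro hit_nonneg) (auto intro: mu_nonneg)

lemma weight_nonneg: "0 \<le> weight mu T n g"
  unfolding weight_def by (intro prod_nonneg) (auto intro: hit_mu_nonneg)

text \<open>\<open>hit_Un_le\<close> splits every column probability into a coset factor, bounded
  through \<open>card S\<close> alone, and a factor depending only on the restriction of
  \<open>g\<close> to the complement. The two restrictions determine \<open>g\<close>, so the sum
  factorises; the vectors at \<open>S\<close> are counted freely by
  \<open>q ^ card S\<close>.\<close>

lemma sum_stratum_le:
  assumes W: "subsp W" "W \<subseteq> V" and S: "S \<subseteq> {..<n}" "real (card S) \<le> \<eta> * real n"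
  shows "(\<Sum>g\<in>stratum W S. weight mu T n g) \<le>
    q ^ card S * ((1 + (1 - 2 * \<alpha>) ^ card S) / 2) ^ n * C"
proof -
  let ?I = "{..<n} - S" and ?b = "(1 + (1 - 2 * \<alpha>) ^ card S) / 2"
  have fS: "finite S" using S finite_subset by blast
  have b0: "0 \<le> ?b" using \<alpha>_le_half by simp
  have I: "?I \<subseteq> {..<n}" "(1 - \<eta>) * real n \<le> real (card ?I)"
    using S fS by (auto simp: card_Diff_subset of_nat_diff card_mono algebra_simps
        subset_eq_atLeast0_lessThan_card)
  have w: "weight mu T n g \<le> ?b ^ n * bound W ?I (restrict g ?I) ^ n" if g: "g \<in> stratum W S" for g
  proof -
    have gW: "g i \<in> W" if "i \<in> ?I" for i using g that by (auto simp: stratum_def)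
    have gS: "g i \<notin> W" if "i \<in> S" for i using g that by (auto simp: stratum_def)
    have gI: "restrict g ?I \<in> robust W ?I" using g by (simp add: stratum_def)
    have "hit (mu j) g {..<n} {T (g j)} \<le> ?b * bound W ?I (restrict g ?I)" if j: "j < n" for j
    proof -
      have m: "hit (mu j) g ?I {u} \<le> bound W ?I (restrict g ?I)" if "u \<in> W" for u
      proof -
        have "hit (mu j) g ?I {u} = hit (mu j) (restrict g ?I) ?I {u}" by (rule hit_cong) simp
        then show ?thesis using hit_le_bound[OF W I(1) j gI that] by simp
      qed
      have m0: "0 \<le> bound W ?I (restrict g ?I)"
        using q_ge_1 by (auto simp: bound_def X1_def X2_def)
      have "hit (mu j) g {..<n} {T (g j)} = hit (mu j) g (S \<union> ?I) {T (g j)}"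
        using S by (simp add: Un_absorb1)
      also have "\<dots> \<le> hit (mu j) g S {u. T (g j) - u \<in> W} * bound W ?I (restrict g ?I)"
        by (rule hit_Un_le) (use fS W gW m m0 S j in \<open>auto intro!: mu_nonneg\<close>)
      also have "\<dots> \<le> ?b * bound W ?I (restrict g ?I)"
        by (intro mult_right_mono m0 hit_coset_le)
          (use fS S j law \<alpha> \<alpha>_le_half W gS in auto)
      finally show ?thesis .
    qed
    then have "weight mu T n g \<le> (\<Prod>j<n. ?b * bound W ?I (restrict g ?I))"
      unfolding weight_def by (intro prod_mono) (auto intro: hit_mu_nonneg)
    then show ?thesis by (simp only: prod_constant card_lessThan power_mult_distrib)
  qed
  have fX: "finite (PiE S (\<lambda>_. V) \<times> robust W ?I)"
    using fS finite_V card_subsp[OF W] by (auto simp: finite_PiE robust_def)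
  let ?f = "\<lambda>g. (restrict g S, restrict g ?I)"
  have inj: "inj_on ?f (stratum W S)"
  proof (rule inj_onI)
    fix g g' assume g: "g \<in> stratum W S" "g' \<in> stratum W S" and eq: "?f g = ?f g'"
    show "g = g'"
    proof (rule extensionalityI[of _ "{..<n}"])
      fix i assume "i \<in> {..<n}"
      then show "g i = g' i"
        using eq by (cases "i \<in> S") (metis DiffI prod.inject restrict_apply')+
    qed (use g in \<open>simp_all add: stratum_def PiE_def\<close>)
  qed
  have "(\<Sum>g\<in>stratum W S. weight mu T n g) \<le> (\<Sum>g\<in>stratum W S. ?b ^ n * bound W ?I (restrict g ?I) ^ n)"
    by (rule sum_mono) (rule w)
  also have "\<dots> = (\<Sum>(a, h)\<in>?f ` stratum W S. ?b ^ n * bound W ?I h ^ n)"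
    by (subst sum.reindex[OF inj]) (simp add: case_prod_unfold)
  also have "\<dots> \<le> (\<Sum>(a, h)\<in>PiE S (\<lambda>_. V) \<times> robust W ?I. ?b ^ n * bound W ?I h ^ n)"
  proof (rule sum_mono2[OF fX])
    show "?f ` stratum W S \<subseteq> PiE S (\<lambda>_. V) \<times> robust W ?I"
      using S by (fastforce simp: stratum_def PiE_iff restrict_def)
    show "0 \<le> (case x of (a, h) \<Rightarrow> ?b ^ n * bound W ?I h ^ n)" for x
      using b0 q_ge_1 by (auto simp: bound_def X1_def X2_def split: prod.split)
  qed
  also have "\<dots> = q ^ card S * ?b ^ n * (\<Sum>h\<in>robust W ?I. bound W ?I h ^ n)"
    using fS unfolding sum.cartesian_product[symmetric]
    by (simp add: card_PiE q_def sum_distrib_left mult_ac)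
  also have "\<dots> \<le> q ^ card S * ?b ^ n * C"
    using q_ge_1 b0 by (intro mult_left_mono sum_bound_le W I) auto
  finally show ?thesis .
qed

definition D :: real where
  "D = (\<Sum>S | S \<subseteq> {..<n} \<and> S \<noteq> {} \<and> real (card S) \<le> \<delta> * q * real n.
    q ^ card S * ((1 + (1 - 2 * \<alpha>) ^ card S) / 2) ^ n)"

text \<open>For a spanning tuple an empty exceptional set forces \<open>W = V\<close>; this stratum
  gives the main term \<open>C\<close>. All others have nonempty \<open>S\<close> and are collected
  in \<open>D\<close>. The number of subspaces is bounded by \<open>2 ^ card V\<close>, a constant
  as \<open>n\<close> grows, and overlaps of strata only help.\<close>

lemma sum_weight_le: "(\<Sum>g\<in>spanning V n. weight mu T n g) \<le> C * (1 + 2 ^ card V * D)"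
proof -
  define \<S> where "\<S> = {S. S \<subseteq> {..<n} \<and> S \<noteq> {} \<and> real (card S) \<le> \<delta> * q * real n}"
  define \<W> where "\<W> = {W. subsp W \<and> W \<subseteq> V}"
  let ?J = "insert (V, {}) (\<W> \<times> \<S>)"
  let ?c = "\<lambda>S. q ^ card S * ((1 + (1 - 2 * \<alpha>) ^ card S) / 2) ^ n * C"
  have c0: "0 \<le> ?c S" for S using q_ge_1 \<alpha>_le_half C_nonneg by simp
  have fin: "finite \<S>" "finite \<W>" using finite_V by (auto simp: \<S>_def \<W>_def)
  have fst: "finite (stratum W S)" for W S
    using finite_V by (auto simp: stratum_def finite_PiE)
  have "spanning V n \<subseteq> (\<Union>(W, S)\<in>?J. stratum W S)"
  proof
    fix g assume g: "g \<in> spanning V n"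
    then have gV: "\<And>i. i < n \<Longrightarrow> g i \<in> V" by (auto simp: spanning_def)
    obtain W where W: "subsp W" "W \<subseteq> V"
      "real (card {i\<in>{..<n}. g i \<notin> W}) \<le> \<delta> * real n * real (card V)"
      and rob: "\<And>u. u \<in> V - annih r W \<Longrightarrow>
        \<delta> * real n \<le> real (card {i\<in>{..<n}. g i \<in> W \<and> dot r u (g i) \<noteq> 0})"
      using robust_subspace_exists[where n = n and g = g and r = r and d = "\<delta> * real n",
          folded V_def, OF gV] \<delta> by auto
    define S where "S = {i\<in>{..<n}. g i \<notin> W}"
    have "{i\<in>{..<n} - S. dot r u (restrict g ({..<n} - S) i) \<noteq> 0} =
        {i\<in>{..<n}. g i \<in> W \<and> dot r u (g i) \<noteq> 0}" for u
      by (auto simp: S_def)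
    then have "g \<in> stratum W S"
      using g rob by (auto simp: stratum_def robust_def spanning_def S_def)
    moreover have "(W, S) \<in> ?J"
    proof (cases "S = {}")
      case True
      then have "\<forall>i<n. g i \<in> W" by (auto simp: S_def)
      then have "W = V" using g W by (auto simp: spanning_def)
      then show ?thesis using True by simp
    next
      case False
      then show ?thesis using W by (auto simp: \<S>_def \<W>_def S_def q_def mult_ac)
    qed
    ultimately show "g \<in> (\<Union>(W, S)\<in>?J. stratum W S)" by blast
  qed
  then have "(\<Sum>g\<in>spanning V n. weight mu T n g) \<le> (\<Sum>g\<in>(\<Union>(W, S)\<in>?J. stratum W S). weight mu T n g)"
    using fin fst by (intro sum_mono2) (auto intro: weight_nonneg)
  also have "\<dots> \<le> (\<Sum>x\<in>?J. \<Sum>g\<in>(case x of (W, S) \<Rightarrow> stratum W S). weight mu T n g)"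
    using fin fst by (intro sum_UN_le) (auto intro: weight_nonneg)
  also have "\<dots> \<le> (\<Sum>(W, S)\<in>?J. ?c S)"
  proof (rule sum_mono)
    fix x assume x: "x \<in> ?J"
    obtain W S where xWS: "x = (W, S)" by (cases x)
    then have WS: "(W, S) \<in> ?J" using x by simp
    have "(\<Sum>g\<in>stratum W S. weight mu T n g) \<le> ?c S"
    proof (rule sum_stratum_le)
      have "\<delta> * q * real n \<le> \<eta> * real n" using \<delta> by (intro mult_right_mono) auto
      moreover have "0 \<le> \<eta> * real n" using \<eta> \<theta> by simp
      ultimately show "real (card S) \<le> \<eta> * real n" using WS by (auto simp: \<S>_def)
    qed (use WS in \<open>auto simp: \<S>_def \<W>_def V_def subsp_vspace\<close>)
    then show "(\<Sum>g\<in>(case x of (W, S) \<Rightarrow> stratum W S). weight mu T n g) \<le> (case x of (W, S) \<Rightarrow> ?c S)"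
      by (simp add: xWS)
  qed
  also have "\<dots> = C + real (card \<W>) * (\<Sum>S\<in>\<S>. ?c S)"
  proof -
    have "(V, {}) \<notin> \<W> \<times> \<S>" by (simp add: \<S>_def)
    then have "(\<Sum>(W, S)\<in>?J. ?c S) = ?c {} + (\<Sum>(W, S)\<in>\<W> \<times> \<S>. ?c S)"
      using fin by (subst sum.insert) simp_all
    also have "(\<Sum>(W, S)\<in>\<W> \<times> \<S>. ?c S) = (\<Sum>W\<in>\<W>. \<Sum>S\<in>\<S>. ?c S)"
      by (rule sum.cartesian_product[symmetric])
    finally show ?thesis by simp
  qed
  also have "(\<Sum>S\<in>\<S>. ?c S) = D * C"
    by (simp add: D_def \<S>_def sum_distrib_right)
  also have "C + real (card \<W>) * (D * C) \<le> C + 2 ^ card V * (D * C)"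
  proof (intro add_left_mono mult_right_mono)
    have "card \<W> \<le> card (Pow V)" using finite_V by (intro card_mono) (auto simp: \<W>_def)
    then have "card \<W> \<le> 2 ^ card V" using finite_V by (simp add: card_Pow)
    then have "real (card \<W>) \<le> real (2 ^ card V)" by (simp only: of_nat_le_iff)
    then show "real (card \<W>) \<le> 2 ^ card V" by simp
    show "0 \<le> D * C"
      using q_ge_1 \<alpha>_le_half C_nonneg by (auto simp: D_def intro!: mult_nonneg_nonneg sum_nonneg)
  qed
  finally show ?thesis by (simp add: algebra_simps)
qed

text \<open>
  While \<open>card S * \<alpha> \<le> 1 - \<theta>\<close> the coset bound is at most \<open>exp (- \<theta> * card S * \<alpha>)\<close> and the sum over \<open>S\<close>
  is binomial. Larger \<open>S\<close> cost a constant factor below 1 per column, which beats the entropy of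
  \<open>S\<close> once \<open>\<delta>\<close> is small.
\<close>

lemma D_le:
  assumes t: "0 \<le> t"
  shows "D \<le> ((1 + q * X1) ^ n - 1) +
    (((1 + exp (- 2 * (1 - \<theta>))) / 2) * exp (t * (\<delta> * q) + q * exp (- t))) ^ n"
proof -
  let ?b = "(1 + exp (- 2 * (1 - \<theta>))) / 2"
  let ?f = "\<lambda>S::nat set. q ^ card S * ((1 + (1 - 2 * \<alpha>) ^ card S) / 2) ^ n"
  let ?g = "\<lambda>S::nat set. (q * X1) ^ card S"
  let ?h = "\<lambda>S::nat set. ?b ^ n * exp (t * (\<delta> * q) * real n) * (q * exp (- t)) ^ card S"
  define \<S> where "\<S> = {S. S \<subseteq> {..<n} \<and> S \<noteq> {} \<and> real (card S) \<le> \<delta> * q * real n}"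
  have pow: "(\<Sum>S\<in>Pow {..<n}. x ^ card S) = (1 + x) ^ n" for x :: real
    using prod_add[of "{..<n}" "\<lambda>_. x" "\<lambda>_. 1"] by (simp add: add.commute)
  have f: "?f S \<le> ?g S + ?h S" if S: "S \<in> \<S>" for S
  proof -
    let ?k = "real (card S)" and ?x = "real (card S) * \<alpha>"
    have g0: "0 \<le> ?g S" and h0: "0 \<le> ?h S" using q_ge_1 by (auto simp: X1_def)
    have x0: "0 \<le> ?x" using \<alpha> by simp
    have "(1 - 2 * \<alpha>) ^ card S \<le> exp (- 2 * \<alpha>) ^ card S"
      using exp_ge_add_one_self[of "- 2 * \<alpha>"] \<alpha>_le_half by (intro power_mono) auto
    also have "\<dots> = exp (- (2 * ?x))" by (simp flip: exp_of_nat_mult)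
    finally have e: "(1 - 2 * \<alpha>) ^ card S \<le> exp (- (2 * ?x))" .
    have b0: "0 \<le> (1 + (1 - 2 * \<alpha>) ^ card S) / 2" using \<alpha>_le_half by simp
    show ?thesis
    proof (cases "?x \<le> 1 - \<theta>")
      case True
      \<comment> \<open>The quadratic bound for \<open>exp (- 2 * ?x)\<close> yields
        \<open>1 - ?x + ?x^2\<close>, and the case assumption makes \<open>1 - ?x\<close> at least
        \<open>\<theta>\<close>.\<close>
      have "(1 + (1 - 2 * \<alpha>) ^ card S) / 2 \<le> 1 + - (?x - ?x\<^sup>2)"
        using e exp_minus_le_quadratic[of "2 * ?x"] x0 by (simp add: power_mult_distrib mult_ac)
      also have "\<dots> \<le> exp (- (?x - ?x\<^sup>2))" by (rule exp_ge_add_one_self)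
      also have "\<dots> \<le> exp (- (?x * \<theta>))"
      proof -
        have "?x * \<theta> \<le> ?x * (1 - ?x)" using True x0 by (intro mult_left_mono) auto
        then show ?thesis by (simp add: power2_eq_square algebra_simps)
      qed
      finally have "((1 + (1 - 2 * \<alpha>) ^ card S) / 2) ^ n \<le> exp (- (?x * \<theta>)) ^ n"
        using b0 by (rule power_mono)
      also have "\<dots> = X1 ^ card S"
        by (simp add: X1_def mult_ac flip: exp_of_nat_mult)
      finally have "?f S \<le> q ^ card S * X1 ^ card S"
        using q_ge_1 by (intro mult_left_mono) auto
      then have "?f S \<le> ?g S" by (simp add: power_mult_distrib)
      then show ?thesis using h0 by linarith
    next
      case False
      have "(1 + (1 - 2 * \<alpha>) ^ card S) / 2 \<le> ?b"
      proof -
        have "exp (- (2 * ?x)) \<le> exp (- 2 * (1 - \<theta>))" using False by simp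
        with e have "(1 - 2 * \<alpha>) ^ card S \<le> exp (- 2 * (1 - \<theta>))" by (rule order.trans)
        then show ?thesis by simp
      qed
      then have "((1 + (1 - 2 * \<alpha>) ^ card S) / 2) ^ n \<le> ?b ^ n"
        using b0 by (rule power_mono)
      then have "?f S \<le> q ^ card S * ?b ^ n"
        using q_ge_1 by (intro mult_left_mono) auto
      \<comment> \<open>Exponential tilting: on \<open>\<S>\<close> the size of \<open>S\<close> is
        at most \<open>\<delta> q n\<close>, so this factor is at least 1. It replaces the size
        constraint by a weight \<open>exp (- t)\<close> per element, and the sum over all subsets
        becomes binomial.\<close>
      also have "\<dots> \<le> q ^ card S * ?b ^ n * exp (t * (\<delta> * q * real n - ?k))"
      proof -
        have "0 \<le> t * (\<delta> * q * real n - ?k)" using t S by (simp add: \<S>_def)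
        then have "1 \<le> exp (t * (\<delta> * q * real n - ?k))" by simp
        moreover have "0 \<le> q ^ card S * ?b ^ n"
          using q_ge_1 by (intro mult_nonneg_nonneg zero_le_power) (auto intro: add_nonneg_nonneg)
        ultimately show ?thesis by (metis mult_left_mono mult.right_neutral)
      qed
      also have "\<dots> = ?h S"
      proof -
        have "exp (t * (\<delta> * q * real n - ?k)) = exp (t * (\<delta> * q) * real n + ?k * - t)"
          by (simp add: algebra_simps)
        also have "\<dots> = exp (t * (\<delta> * q) * real n) * exp (- t) ^ card S"
          by (simp only: exp_add exp_of_nat_mult)
        finally show ?thesis by (simp only: power_mult_distrib mult_ac)
      qed
      finally show ?thesis using g0 by linarith
    qed
  qed
  have "D = (\<Sum>S\<in>\<S>. ?f S)" by (simp add: D_def \<S>_def)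
  also have "\<dots> \<le> (\<Sum>S\<in>\<S>. ?g S + ?h S)" by (rule sum_mono) (rule f)
  also have "\<dots> \<le> (\<Sum>S\<in>Pow {..<n} - {{}}. ?g S + ?h S)"
    using q_ge_1 by (intro sum_mono2) (auto simp: \<S>_def X1_def intro!: add_nonneg_nonneg mult_nonneg_nonneg)
  also have "\<dots> = (\<Sum>S\<in>Pow {..<n} - {{}}. ?g S) + (\<Sum>S\<in>Pow {..<n} - {{}}. ?h S)"
    by (rule sum.distrib)
  also have "(\<Sum>S\<in>Pow {..<n} - {{}}. ?g S) = (1 + q * X1) ^ n - 1"
    by (subst sum_diff1) (simp_all add: pow)
  also have "(\<Sum>S\<in>Pow {..<n} - {{}}. ?h S) \<le> (\<Sum>S\<in>Pow {..<n}. ?h S)"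
    using q_ge_1 by (intro sum_mono2) (auto intro!: mult_nonneg_nonneg add_nonneg_nonneg)
  also have "\<dots> = ?b ^ n * exp (t * (\<delta> * q) * real n) * (1 + q * exp (- t)) ^ n"
    by (simp add: pow flip: sum_distrib_left)
  also have "\<dots> \<le> ?b ^ n * exp (t * (\<delta> * q) * real n) * exp (q * exp (- t)) ^ n"
    using q_ge_1 exp_ge_add_one_self[of "q * exp (- t)"]
    by (intro mult_left_mono power_mono) (auto intro: add_nonneg_nonneg mult_nonneg_nonneg)
  also have "\<dots> = (?b * exp (t * (\<delta> * q) + q * exp (- t))) ^ n"
    unfolding exp_of_nat2_mult exp_add power_mult_distrib by (simp only: mult_ac)
  finally show ?thesis by simp
qed

text \<open>If all \<open>g i\<close> lay in a proper subspace, \<open>card_annih\<close> would give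
  a nonzero functional vanishing on it. Every \<open>tgap\<close> would then be 0 in column 0,
  against the positive lower bound in \<open>good\<close>.\<close>

lemma good_subset_spanning:
  assumes "0 < n"
  shows "good V {..<n} \<subseteq> spanning V n"
proof
  fix g assume g: "g \<in> good V {..<n}"
  show "g \<in> spanning V n"
    unfolding spanning_def
  proof (intro CollectI conjI allI impI)
    show "g \<in> PiE {..<n} (\<lambda>_. V)" using g by (simp add: good_def)
    fix W assume W: "subsp W" "W \<subseteq> V" "\<forall>i<n. g i \<in> W"
    show "W = V"
    proof (rule ccontr)
      assume "W \<noteq> V"
      then have "card W < card V" using W finite_V by (intro psubset_card_mono) auto
      then have "card (annih r W) \<noteq> 1"
        using card_annih[OF W(1), of r] W(2) by (auto simp: V_def)
      moreover have "{0} \<subseteq> annih r W"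
        by (simp add: annih_def subsp_zero[OF subsp_vspace] dot_commute[of r 0])
      ultimately have "\<not> annih r W \<subseteq> {0}"
        using subset_antisym[of "annih r W" "{0}"] by force
      then have "\<exists>u\<in>annih r W. u \<noteq> 0" by (simp add: subset_eq)
      then obtain u where u: "u \<in> annih r W" "u \<noteq> 0" by (rule bexE)
      have uV: "u \<in> V" using u(1) by (simp add: annih_def V_def)
      then obtain v where v: "v \<in> V" "dot r u v \<noteq> 0"
        using dot_nondegenerate[of u r] u(2) unfolding V_def by blast
      then have "u \<notin> annih r V" by (auto simp: annih_def)
      then have uV: "u \<in> V - annih r V" using uV by simp
      have "(\<Sum>i<n. tgap \<alpha> (mu 0 i) (dot r u (g i))) = 0"
        using u W(3) law[OF assms] \<alpha> by (intro sum.neutral) (auto simp: annih_def tgap_zero)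
      moreover have "2 * (\<theta> * (real n * \<alpha>)) \<le> (\<Sum>i<n. tgap \<alpha> (mu 0 i) (dot r u (g i)))"
        using g uV assms by (auto simp: good_def)
      moreover have "0 < 2 * (\<theta> * (real n * \<alpha>))" using \<theta> \<alpha> assms by simp
      ultimately show False by linarith
    qed
  qed
qed

text \<open>It suffices to keep the good tuples for \<open>W = V\<close>: they are nearly all of the
  \<open>q ^ n\<close> tuples, and each of their column probabilities is at least
  \<open>1 / q - X1\<close>.\<close>

lemma sum_weight_ge:
  assumes n: "0 < n" and X1: "q * X1 \<le> 1"
  shows "(1 - real n * q * X3) * (1 - q * X1) ^ n \<le> (\<Sum>g\<in>spanning V n. weight mu T n g)"
proof -
  let ?I = "{..<n}" and ?X = "PiE {..<n} (\<lambda>_. V)"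
  have V: "subsp V" "V \<subseteq> V" by (auto simp: V_def subsp_vspace)
  have I: "?I \<subseteq> {..<n}" "(1 - \<eta>) * real n \<le> real (card ?I)"
    using \<eta> \<theta> by (auto simp: algebra_simps)
  have fX: "finite ?X" using finite_V by (simp add: finite_PiE)
  have gX: "good V ?I \<subseteq> ?X" by (auto simp: good_def)
  have w: "((1 - q * X1) / q) ^ n \<le> weight mu T n g" if g: "g \<in> good V ?I" for g
  proof -
    have "(1 - q * X1) / q \<le> hit (mu j) g ?I {T (g j)}" if j: "j < n" for j
    proof -
      have "T (g j) \<in> V" using g j T by (auto simp: good_def)
      then have "\<bar>hit (mu j) g ?I {T (g j)} - 1 / q\<bar> \<le> X1"
        using hit_close_good[OF V I(1) j g] by (simp add: q_def)
      then have "1 / q - X1 \<le> hit (mu j) g ?I {T (g j)}" by linarith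
      then show ?thesis using q_ge_1 by (simp add: diff_divide_distrib)
    qed
    then have "(\<Prod>j<n. (1 - q * X1) / q) \<le> weight mu T n g"
      unfolding weight_def using X1 q_ge_1 by (intro prod_mono) auto
    then show ?thesis by simp
  qed
  have "(1 - real n * q * X3) * (1 - q * X1) ^ n = q ^ n * (1 - real n * q * X3) * ((1 - q * X1) / q) ^ n"
    using q_ge_1 by (simp add: power_divide)
  also have "\<dots> \<le> real (card (good V ?I)) * ((1 - q * X1) / q) ^ n"
  proof (rule mult_right_mono)
    have "real (card (?X - good V ?I)) = real (card ?X) - real (card (good V ?I))"
      using fX gX by (simp add: card_Diff_subset finite_subset card_mono of_nat_diff)
    moreover have "real (card ?X) = q ^ n" by (simp add: card_PiE q_def)
    ultimately show "q ^ n * (1 - real n * q * X3) \<le> real (card (good V ?I))"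
      using card_not_good_le[OF V I] by (simp add: algebra_simps q_def)
  qed (use X1 q_ge_1 in auto)
  also have "\<dots> = (\<Sum>g\<in>good V ?I. ((1 - q * X1) / q) ^ n)" by simp
  also have "\<dots> \<le> (\<Sum>g\<in>good V ?I. weight mu T n g)" by (rule sum_mono) (rule w)
  also have "\<dots> \<le> (\<Sum>g\<in>spanning V n. weight mu T n g)"
    by (rule sum_mono2[OF _ good_subset_spanning[OF n]])
      (use fX in \<open>auto simp: spanning_def intro: weight_nonneg\<close>)
  finally show ?thesis .
qed

section \<open>Both bounds in terms of \<open>n q X1\<close>, \<open>n q X2\<close> and
  \<open>n q X3\<close>\<close>

lemma one_add_power_le: "0 \<le> x \<Longrightarrow> (1 + x) ^ n \<le> exp (real n * x)"
  using power_mono[OF exp_ge_add_one_self, of x n] by (simp add: exp_of_nat_mult)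

lemma sum_weight_le_exp:
  assumes t: "0 \<le> t"
    and \<rho>: "(1 + exp (- 2 * (1 - \<theta>))) / 2 * exp (t * (\<delta> * q) + q * exp (- t)) \<le> \<rho>"
  shows "(\<Sum>g\<in>spanning V n. weight mu T n g) \<le>
    (exp (real n * (q * X1)) + real n * q * X3 * exp (real n * (q * X2))) *
    (1 + 2 ^ card V * (exp (real n * (q * X1)) - 1 + \<rho> ^ n))"
proof -
  have X: "0 \<le> q * X1" "0 \<le> q * X2" "0 \<le> real n * q * X3"
    using q_ge_1 by (simp_all add: X1_def X2_def X3_def)
  have C: "C \<le> exp (real n * (q * X1)) + real n * q * X3 * exp (real n * (q * X2))"
    unfolding C_def using X by (intro add_mono mult_left_mono one_add_power_le) auto
  have "((1 + exp (- 2 * (1 - \<theta>))) / 2 * exp (t * (\<delta> * q) + q * exp (- t))) ^ n \<le> \<rho> ^ n"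
    by (rule power_mono[OF \<rho>]) (simp add: add_nonneg_nonneg)
  then have D: "D \<le> exp (real n * (q * X1)) - 1 + \<rho> ^ n"
    using D_le[OF t] one_add_power_le[OF X(1)] by linarith
  have D0: "0 \<le> D"
    using q_ge_1 \<alpha>_le_half unfolding D_def by (intro sum_nonneg mult_nonneg_nonneg) auto
  have "C * (1 + 2 ^ card V * D) \<le>
      (exp (real n * (q * X1)) + real n * q * X3 * exp (real n * (q * X2))) *
      (1 + 2 ^ card V * (exp (real n * (q * X1)) - 1 + \<rho> ^ n))"
    using C D D0 C_nonneg X by (intro mult_mono add_left_mono mult_left_mono) auto
  with sum_weight_le show ?thesis by (rule order.trans)
qed

lemma sum_weight_ge_linear:
  assumes "0 < n" "real n * (q * X1) \<le> 1" "real n * q * X3 \<le> 1"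
  shows "(1 - real n * q * X3) * (1 - real n * (q * X1)) \<le> (\<Sum>g\<in>spanning V n. weight mu T n g)"
proof -
  have "0 \<le> q * X1" using q_ge_1 by (simp add: X1_def)
  then have X1: "q * X1 \<le> 1"
    using assms(1,2) mult_right_mono[of 1 "real n" "q * X1"] by linarith
  then have "1 - real n * (q * X1) \<le> (1 - q * X1) ^ n"
    using Bernoulli_inequality[of "- (q * X1)" n] by simp
  then have "(1 - real n * q * X3) * (1 - real n * (q * X1)) \<le> (1 - real n * q * X3) * (1 - q * X1) ^ n"
    using assms by (intro mult_left_mono) auto
  also have "\<dots> \<le> (\<Sum>g\<in>spanning V n. weight mu T n g)"
    by (rule sum_weight_ge[OF assms(1) X1])
  finally show ?thesis .
qed

end

section \<open>The asymptotic estimate\<close>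

text \<open>With the balance parameter exactly \<open>a * ln n / n\<close>, both \<open>X1\<close>
  and \<open>X2\<close> are powers of \<open>n\<close>, and the smallness condition on
  \<open>\<alpha>\<close> in the model holds eventually.\<close>

theorem sum_weight_tendsto:
  fixes mu :: "nat \<Rightarrow> nat \<Rightarrow> nat \<Rightarrow> 'p::prime_card mod_ring \<Rightarrow> real" and r :: nat
  defines "V \<equiv> vspace r :: (nat \<Rightarrow> 'p mod_ring) set"
  assumes a: "1 < a"
    and law: "\<forall>\<^sub>F n in sequentially. \<forall>j<n. \<forall>i<n. balanced_law (a * ln (real n) / real n) (mu n j i)"
    and T: "\<And>v. v \<in> V \<Longrightarrow> T v \<in> V"
  shows "(\<lambda>n. \<Sum>g\<in>spanning V n. weight (mu n) T n g) \<longlonglongrightarrow> 1"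
proof -
  define q where "q = real (card V)"
  have q: "1 \<le> q"
  proof -
    have "card V > 0"
      using subsp_zero[OF subsp_vspace, of r] by (auto simp: V_def card_gt_0_iff)
    then show ?thesis by (simp add: q_def)
  qed
  \<comment> \<open>The midpoint of \<open>1 / a\<close> and 1. It makes
    \<open>\<theta> * a > 1\<close>, so that \<open>n q X1\<close>, which is \<open>q\<close> times
    \<open>n\<close> to the power \<open>1 - \<theta> a\<close>, tends to 0.\<close>
  define \<theta> where "\<theta> = (1 + 1 / a) / 2"
  have \<theta>: "0 < \<theta>" "\<theta> < 1" "1 < \<theta> * a" using a by (auto simp: \<theta>_def field_simps)
  define \<eta> where "\<eta> = (1 - \<theta>) / 4"
  have \<eta>: "0 < \<eta>" using \<theta> by (simp add: \<eta>_def)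
  obtain \<kappa> :: real where \<kappa>: "0 < \<kappa>" "\<kappa> \<le> 1"
    "\<And>b :: 'p mod_ring. b \<noteq> 0 \<Longrightarrow> \<kappa> \<le> 1 - Re (chi b)"
    by (rule chi_separates) blast
  \<comment> \<open>\<open>\<beta>\<close> bounds the coset factor once
    \<open>card S * \<alpha>\<close> exceeds \<open>1 - \<theta>\<close>, and
    \<open>\<omega>\<close> is the resulting gain per column. A quarter of it pays for
    \<open>q * exp (- t)\<close>, a quarter for \<open>t * (\<delta> * q)\<close>, and the other
    half becomes the decay rate in \<open>\<rho>\<close>.\<close>
  define \<beta> where "\<beta> = (1 + exp (- 2 * (1 - \<theta>))) / 2"
  have \<beta>: "0 < \<beta>" "\<beta> < 1" using \<theta> by (auto simp: \<beta>_def add_pos_pos)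
  define \<omega> where "\<omega> = - ln \<beta>"
  have \<omega>: "0 < \<omega>" using \<beta> by (simp add: \<omega>_def)
  \<comment> \<open>The absolute value only ensures \<open>t \<ge> 0\<close>; without it
    \<open>q * exp (- t)\<close> would be exactly \<open>\<omega> / 4\<close>.\<close>
  define t where "t = \<bar>ln (4 * q / \<omega>)\<bar>"
  have t: "0 \<le> t" "q * exp (- t) \<le> \<omega> / 4"
  proof -
    have "exp (- t) \<le> exp (- ln (4 * q / \<omega>))" by (simp add: t_def)
    also have "\<dots> = \<omega> / (4 * q)" using q \<omega> by (simp add: exp_minus)
    finally show "q * exp (- t) \<le> \<omega> / 4" using q by (simp add: field_simps)
  qed (simp add: t_def)
  \<comment> \<open>The first bound keeps exceptional sets below \<open>\<eta> n\<close>, the second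
    their entropy below \<open>\<omega> / 4\<close> per column; \<open>t + 1\<close> guards against
    \<open>t = 0\<close>.\<close>
  define \<delta> where "\<delta> = min (\<eta> / q) (\<omega> / (4 * (t + 1) * q))"
  have \<delta>: "0 < \<delta>" "\<delta> * q \<le> \<eta>" "t * (\<delta> * q) \<le> \<omega> / 4"
  proof -
    show "0 < \<delta>" using \<eta> q \<omega> t by (simp add: \<delta>_def)
    have "\<delta> * q \<le> \<eta> / q * q" using q by (intro mult_right_mono) (auto simp: \<delta>_def)
    then show "\<delta> * q \<le> \<eta>" using q by simp
    have "\<delta> * q \<le> \<omega> / (4 * (t + 1) * q) * q" using q by (intro mult_right_mono) (auto simp: \<delta>_def)
    also have "\<dots> = \<omega> / (4 * (t + 1))" using q by simp
    finally have "t * (\<delta> * q) \<le> t * (\<omega> / (4 * (t + 1)))" using t(1) by (rule mult_left_mono)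
    also have "\<dots> \<le> \<omega> / 4" using t(1) \<omega> by (simp add: field_simps)
    finally show "t * (\<delta> * q) \<le> \<omega> / 4" .
  qed
  define \<rho> where "\<rho> = exp (- \<omega> / 2)"
  have \<rho>: "0 < \<rho>" "\<rho> < 1" using \<omega> by (auto simp: \<rho>_def)
  have \<rho>_ge: "\<beta> * exp (t * (\<delta> * q) + q * exp (- t)) \<le> \<rho>"
  proof -
    have "\<beta> = exp (- \<omega>)" using \<beta> by (simp add: \<omega>_def)
    then have "\<beta> * exp (t * (\<delta> * q) + q * exp (- t)) = exp (- \<omega> + (t * (\<delta> * q) + q * exp (- t)))"
      by (simp only: exp_add)
    also have "\<dots> \<le> \<rho>" unfolding \<rho>_def using t \<delta> by simp
    finally show ?thesis .
  qed

  define c where "c = 2 * \<eta>\<^sup>2 / (real CARD('p))\<^sup>2"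
  have c: "0 < c" using \<eta> by (simp add: c_def)
  define d where "d = \<delta> * \<kappa> / 2 * a"
  have d: "0 < d" using \<delta> \<kappa> a by (simp add: d_def)
  define x1 where "x1 n = real n * (q * exp (- (\<theta> * a * ln (real n))))" for n
  define x2 where "x2 n = real n * (q * exp (- (d * ln (real n))))" for n
  define x3 where "x3 n = real n * q * exp (- (c * real n))" for n
  define S where "S n = (\<Sum>g\<in>spanning V n. weight (mu n) T n g)" for n
  have x1: "x1 \<longlonglongrightarrow> 0" unfolding x1_def using \<theta>(3) q by real_asymp
  have x3: "x3 \<longlonglongrightarrow> 0" unfolding x3_def using c by real_asymp
  \<comment> \<open>\<open>x2\<close> itself may be unbounded, because \<open>d\<close> can be less
    than 1. It is still of smaller order than \<open>n\<close>, so half of the decay of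
    \<open>x3\<close> absorbs it.\<close>
  have x23: "(\<lambda>n. x3 n * exp (x2 n)) \<longlonglongrightarrow> 0"
  proof (rule tendsto_sandwich)
    show "(\<lambda>n. 0 :: real) \<longlonglongrightarrow> 0" by simp
    show "(\<lambda>n. real n * q * exp (- (c / 2 * real n))) \<longlonglongrightarrow> 0" using c by real_asymp
    show "\<forall>\<^sub>F n in sequentially. 0 \<le> x3 n * exp (x2 n)"
      using q by (simp add: x3_def)
    have "(\<lambda>n. q * exp (- (d * ln (real n)))) \<longlonglongrightarrow> 0" using d by real_asymp
    then have "\<forall>\<^sub>F n in sequentially. q * exp (- (d * ln (real n))) < c / 2"
      using c by (intro order_tendstoD) auto
    then show "\<forall>\<^sub>F n in sequentially. x3 n * exp (x2 n) \<le> real n * q * exp (- (c / 2 * real n))"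
    proof eventually_elim
      case (elim n)
      have "x2 n \<le> real n * (c / 2)" unfolding x2_def using elim by (intro mult_left_mono) auto
      then have "exp (- (c * real n) + x2 n) \<le> exp (- (c / 2 * real n))"
        by (simp add: field_simps)
      then have "real n * q * exp (- (c * real n) + x2 n) \<le> real n * q * exp (- (c / 2 * real n))"
        using q by (intro mult_left_mono) auto
      then show ?case by (simp only: x3_def exp_add mult.assoc)
    qed
  qed
  have \<alpha>: "\<forall>\<^sub>F n in sequentially. a * ln (real n) / real n < \<eta>"
  proof -
    have "(\<lambda>n. a * ln (real n) / real n) \<longlonglongrightarrow> 0" by real_asymp
    then show ?thesis using \<eta> by (intro order_tendstoD) auto
  qed
  have x_less: "\<forall>\<^sub>F n in sequentially. x1 n < 1 \<and> x3 n < 1"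
    by (intro eventually_conj order_tendstoD(2)[OF x1] order_tendstoD(2)[OF x3]) auto
  have bounds: "\<forall>\<^sub>F n in sequentially. (1 - x3 n) * (1 - x1 n) \<le> S n \<and>
      S n \<le> (exp (x1 n) + x3 n * exp (x2 n)) * (1 + 2 ^ card V * (exp (x1 n) - 1 + \<rho> ^ n))"
    using law \<alpha> eventually_ge_at_top[of 2] x_less
  proof eventually_elim
    case (elim n)
    let ?\<alpha> = "a * ln (real n) / real n"
    interpret column_model r n "mu n" T ?\<alpha> \<theta> \<eta> \<delta> \<kappa> V q
      by unfold_locales (use elim a \<theta> \<eta> \<delta> \<kappa> T in \<open>auto simp: V_def q_def \<eta>_def\<close>)
    have n: "real n * ?\<alpha> = a * ln (real n)" using elim by simp
    have X: "real n * (q * X1) = x1 n" "real n * (q * X2) = x2 n" "real n * q * X3 = x3 n"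
      unfolding X1_def X2_def X3_def n x1_def x2_def x3_def d_def c_def by (simp_all add: mult.assoc)
    show ?case
      using sum_weight_le_exp[OF t(1) \<rho>_ge[unfolded \<beta>_def]] sum_weight_ge_linear elim
      unfolding X S_def by auto
  qed
  show ?thesis
    unfolding S_def[symmetric]
  proof (rule tendsto_sandwich)
    show "\<forall>\<^sub>F n in sequentially. (1 - x3 n) * (1 - x1 n) \<le> S n"
      using bounds by eventually_elim simp
    show "\<forall>\<^sub>F n in sequentially.
        S n \<le> (exp (x1 n) + x3 n * exp (x2 n)) * (1 + 2 ^ card V * (exp (x1 n) - 1 + \<rho> ^ n))"
      using bounds by eventually_elim simp
    have "(\<lambda>n. (1 - x3 n) * (1 - x1 n)) \<longlonglongrightarrow> (1 - 0) * (1 - 0)"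
      by (intro tendsto_intros x1 x3)
    then show "(\<lambda>n. (1 - x3 n) * (1 - x1 n)) \<longlonglongrightarrow> 1" by simp
    have "(\<lambda>n. (exp (x1 n) + x3 n * exp (x2 n)) *
        (1 + 2 ^ card V * (exp (x1 n) - 1 + \<rho> ^ n))) \<longlonglongrightarrow>
        (exp 0 + 0) * (1 + 2 ^ card V * (exp 0 - 1 + 0))"
      by (intro tendsto_intros x1 x23) (use \<rho> in auto)
    then show "(\<lambda>n. (exp (x1 n) + x3 n * exp (x2 n)) *
        (1 + 2 ^ card V * (exp (x1 n) - 1 + \<rho> ^ n))) \<longlonglongrightarrow> 1" by simp
  qed
qed

section \<open>From random matrices to finite sums\<close>

definition entry_law :: "'w measure \<Rightarrow> ('w \<Rightarrow> 'a mat) \<Rightarrow> nat \<Rightarrow> nat \<Rightarrow> 'a \<Rightarrow> real" where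
  "entry_law M A j i a = measure M {\<omega> \<in> space M. A \<omega> $$ (i, j) = a}"

lemma entry_measurable:
  assumes "balanced_matrix M n \<alpha> A" "i < n" "j < n"
  shows "(\<lambda>\<omega>. A \<omega> $$ (i, j)) \<in> measurable M (count_space UNIV)"
  using assms by (auto simp: balanced_matrix_def balanced_def)

lemma entry_event:
  assumes "balanced_matrix M n \<alpha> A" "i < n" "j < n"
  shows "{\<omega> \<in> space M. A \<omega> $$ (i, j) \<in> B} \<in> sets M"
  using measurable_sets[OF entry_measurable[OF assms], of B]
  by (simp add: vimage_def Int_def conj_commute)

text \<open>Allowing any \<open>\<beta> \<le> \<alpha>\<close> lets the given parameters be lowered
  to a convenient sequence.\<close>

lemma balanced_law_entry:
  fixes A :: "'w \<Rightarrow> 'a::finite mat"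
  assumes "prob_space M" and A: "balanced_matrix M n \<alpha> A" and ij: "i < n" "j < n" and "\<beta> \<le> \<alpha>"
  shows "balanced_law \<beta> (entry_law M A j i)"
  unfolding balanced_law_def
proof (intro conjI allI)
  interpret prob_space M by fact
  show "0 \<le> entry_law M A j i a" for a by (simp add: entry_law_def)
  have "entry_law M A j i a \<le> 1 - \<alpha>" for a
    using A ij by (auto simp: balanced_matrix_def balanced_def entry_law_def)
  then show "entry_law M A j i a \<le> 1 - \<beta>" for a
    using \<open>\<beta> \<le> \<alpha>\<close> by (smt (verit))
  have "(\<Sum>a\<in>UNIV. entry_law M A j i a) = prob (\<Union>a\<in>UNIV. {\<omega> \<in> space M. A \<omega> $$ (i, j) \<in> {a}})"
    unfolding entry_law_def
    by (subst finite_measure_finite_Union)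
      (auto simp: disjoint_family_on_def intro: entry_event[OF A ij, of "{_}", simplified])
  also have "(\<Union>a\<in>UNIV. {\<omega> \<in> space M. A \<omega> $$ (i, j) \<in> {a}}) = space M" by auto
  finally show "(\<Sum>a\<in>UNIV. entry_law M A j i a) = 1" by (simp add: prob_space)
qed

lemma prob_entries_eq:
  fixes A :: "'w \<Rightarrow> 'a mat"
  assumes "prob_space M" and A: "balanced_matrix M n \<alpha> A" and n: "0 < n"
  shows "measure M {\<omega> \<in> space M. \<forall>j<n. \<forall>i<n. A \<omega> $$ (i, j) = x j i} =
    (\<Prod>j<n. \<Prod>i<n. entry_law M A j i (x j i))"
proof -
  interpret prob_space M by fact
  let ?J = "{..<n} \<times> {..<n}"
  let ?X = "\<lambda>ij \<omega>. A \<omega> $$ ij" and ?B = "\<lambda>(i, j). {x j i}"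
  have "indep_vars (\<lambda>_. count_space UNIV) ?X ?J"
    using A by (simp add: balanced_matrix_def)
  then have "prob (\<Inter>ij\<in>?J. ?X ij -` ?B ij \<inter> space M) = (\<Prod>ij\<in>?J. prob (?X ij -` ?B ij \<inter> space M))"
    using n by (intro indep_varsD) auto
  also have "(\<Inter>ij\<in>?J. ?X ij -` ?B ij \<inter> space M) =
      {\<omega> \<in> space M. \<forall>j<n. \<forall>i<n. A \<omega> $$ (i, j) = x j i}"
    using n by auto
  also have "(\<Prod>ij\<in>?J. prob (?X ij -` ?B ij \<inter> space M)) =
      (\<Prod>(i, j)\<in>?J. entry_law M A j i (x j i))"
    unfolding entry_law_def
    by (intro prod.cong refl) (auto simp: vimage_def Int_def conj_commute split: prod.split)
  also have "\<dots> = (\<Prod>i<n. \<Prod>j<n. entry_law M A j i (x j i))"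
    by (rule prod.cartesian_product[symmetric])
  also have "\<dots> = (\<Prod>j<n. \<Prod>i<n. entry_law M A j i (x j i))"
    by (rule prod.swap)
  finally show ?thesis .
qed

text \<open>Viewing \<open>g\<close> as the linear map sending the j-th basis vector to
  \<open>g j\<close>, this says that \<open>g\<close> after \<open>B\<close> agrees with
  \<open>T\<close> after \<open>g\<close> on basis vectors.\<close>

definition intertwines :: "((nat \<Rightarrow> 'a::comm_ring_1) \<Rightarrow> nat \<Rightarrow> 'a) \<Rightarrow> nat \<Rightarrow> 'a mat \<Rightarrow> (nat \<Rightarrow> nat \<Rightarrow> 'a) \<Rightarrow> bool" where
  "intertwines T n B g \<longleftrightarrow> (\<forall>j<n. (\<Sum>i<n. scal (B $$ (i, j)) (g i)) = T (g j))"

text \<open>The event splits into the disjoint events that the matrix takes a given value. The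
  condition concerns each column separately, so the sum over all matrices of the product of entry
  probabilities factorises into column sums.\<close>

lemma weight_eq_prob:
  fixes A :: "'w \<Rightarrow> 'a::{comm_ring_1,finite} mat"
  assumes M: "prob_space M" and A: "balanced_matrix M n \<alpha> A" and n: "0 < n"
  shows "{\<omega> \<in> space M. intertwines T n (A \<omega>) g} \<in> sets M"
    and "measure M {\<omega> \<in> space M. intertwines T n (A \<omega>) g} = weight (entry_law M A) T n g"
proof -
  interpret prob_space M by fact
  let ?Y = "PiE {..<n} (\<lambda>_. UNIV :: 'a set)"
  let ?X = "PiE {..<n} (\<lambda>_. ?Y)"
  let ?E = "\<lambda>x. {\<omega> \<in> space M. \<forall>j<n. \<forall>i<n. A \<omega> $$ (i, j) = x j i}"
  let ?c = "\<lambda>j y. (\<Sum>i<n. scal (y i) (g i)) \<in> {T (g j)}"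
  let ?G = "{x\<in>?X. \<forall>j\<in>{..<n}. ?c j (x j)}"
  have fin: "finite ?X" by (simp add: finite_PiE)
  have finG: "finite ?G" by (rule finite_subset[OF Collect_restrict fin])
  have E: "?E x \<in> sets M" for x
  proof -
    have entry: "{\<omega> \<in> space M. A \<omega> $$ (i, j) = x j i} \<in> sets M" if "i < n" "j < n" for i j
      using entry_event[OF A that, of "{x j i}"] by simp
    have "?E x = {\<omega> \<in> space M. \<forall>j\<in>{..<n}. \<forall>i\<in>{..<n}. A \<omega> $$ (i, j) = x j i}" by auto
    also have "\<dots> \<in> sets M"
      using entry n by (intro sets.sets_Collect_finite_All') auto
    finally show ?thesis .
  qed
  have eq: "{\<omega> \<in> space M. intertwines T n (A \<omega>) g} = (\<Union>x\<in>?G. ?E x)"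
  proof (intro equalityI subsetI)
    fix \<omega> assume \<omega>: "\<omega> \<in> {\<omega> \<in> space M. intertwines T n (A \<omega>) g}"
    let ?x = "\<lambda>j\<in>{..<n}. \<lambda>i\<in>{..<n}. A \<omega> $$ (i, j)"
    have "?x \<in> ?G" using \<omega> by (auto simp: intertwines_def)
    moreover have "\<omega> \<in> ?E ?x" using \<omega> by auto
    ultimately show "\<omega> \<in> (\<Union>x\<in>?G. ?E x)"
      by (rule UN_I[where a = ?x and B = ?E])
  qed (auto simp: intertwines_def)
  show "{\<omega> \<in> space M. intertwines T n (A \<omega>) g} \<in> sets M"
    unfolding eq by (rule sets.finite_UN[OF finG E])
  have disj: "disjoint_family_on ?E ?G"
    unfolding disjoint_family_on_def
  proof (intro ballI impI)
    fix x y assume xy: "x \<in> ?G" "y \<in> ?G" "x \<noteq> y"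
    show "?E x \<inter> ?E y = {}"
    proof (rule ccontr)
      assume "?E x \<inter> ?E y \<noteq> {}"
      then have eq: "x j i = y j i" if "j < n" "i < n" for i j using that by auto
      have xj: "x j = y j" if "j < n" for j
        by (rule PiE_ext[of _ "{..<n}" "\<lambda>_. UNIV"]) (use xy eq that in auto)
      have "x = y"
        by (rule PiE_ext[of _ "{..<n}" "\<lambda>_. ?Y"]) (use xy xj in auto)
      with xy show False by simp
    qed
  qed
  have "prob {\<omega> \<in> space M. intertwines T n (A \<omega>) g} = (\<Sum>x\<in>?G. prob (?E x))"
    unfolding eq by (rule finite_measure_finite_Union[OF finG _ disj]) (rule image_subsetI[OF E])
  also have "\<dots> = (\<Sum>x\<in>?G. \<Prod>j<n. \<Prod>i<n. entry_law M A j i (x j i))"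
    by (simp only: prob_entries_eq[OF M A n])
  also have "\<dots> = (\<Sum>x\<in>?X. \<Prod>j<n. if ?c j (x j) then \<Prod>i<n. entry_law M A j i (x j i) else 0)"
  proof (rule sum.mono_neutral_cong_left[OF fin])
    show "\<forall>x\<in>?X - ?G. (\<Prod>j<n. if ?c j (x j) then \<Prod>i<n. entry_law M A j i (x j i) else 0) = 0"
    proof
      fix x assume "x \<in> ?X - ?G"
      then obtain j where "j < n" "\<not> ?c j (x j)" by blast
      then show "(\<Prod>j<n. if ?c j (x j) then \<Prod>i<n. entry_law M A j i (x j i) else 0) = 0"
        by (intro prod_zero) auto
    qed
    show "(\<Prod>j<n. \<Prod>i<n. entry_law M A j i (x j i)) =
        (\<Prod>j<n. if ?c j (x j) then \<Prod>i<n. entry_law M A j i (x j i) else 0)" if "x \<in> ?G" for x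
      using that by (intro prod.cong) auto
  qed auto
  also have "\<dots> = weight (entry_law M A) T n g"
    unfolding weight_def hit_def by (rule prod_sum_PiE[symmetric]) (auto simp: finite_PiE)
  finally show "prob {\<omega> \<in> space M. intertwines T n (A \<omega>) g} = weight (entry_law M A) T n g" .
qed

lemma expectation_card_intertwines:
  fixes A :: "'w \<Rightarrow> 'a::{comm_ring_1,finite} mat"
  assumes M: "prob_space M" and A: "balanced_matrix M n \<alpha> A" and n: "0 < n" and G: "finite G"
  shows "prob_space.expectation M (\<lambda>\<omega>. real (card {g \<in> G. intertwines T n (A \<omega>) g})) =
    (\<Sum>g\<in>G. weight (entry_law M A) T n g)"
proof -
  interpret prob_space M by fact
  let ?E = "\<lambda>g. {\<omega> \<in> space M. intertwines T n (A \<omega>) g}"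
  have "expectation (\<lambda>\<omega>. real (card {g \<in> G. intertwines T n (A \<omega>) g})) =
      expectation (\<lambda>\<omega>. \<Sum>g\<in>G. indicat_real (?E g) \<omega>)"
  proof (rule Bochner_Integration.integral_cong[OF refl])
    fix \<omega> assume "\<omega> \<in> space M"
    then have "(\<Sum>g\<in>G. indicat_real (?E g) \<omega>) = (\<Sum>g\<in>G. if intertwines T n (A \<omega>) g then 1 else 0)"
      by (intro sum.cong) auto
    also have "\<dots> = real (card {g \<in> G. intertwines T n (A \<omega>) g})"
      using G by (simp add: sum.If_cases Int_def)
    finally show "real (card {g \<in> G. intertwines T n (A \<omega>) g}) = (\<Sum>g\<in>G. indicat_real (?E g) \<omega>)" ..
  qed
  also have "\<dots> = (\<Sum>g\<in>G. expectation (indicat_real (?E g)))"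
    using weight_eq_prob(1)[OF M A n]
    by (intro Bochner_Integration.integral_sum) (auto simp: emeasure_eq_measure)
  also have "\<dots> = (\<Sum>g\<in>G. weight (entry_law M A) T n g)"
    using weight_eq_prob[OF M A n] by simp
  finally show ?thesis .
qed

section \<open>Surjections from a cokernel\<close>

lemma mult_mat_unit_vec:
  fixes B :: "'a::comm_ring_1 mat"
  assumes "B \<in> carrier_mat n m" "j < m"
  shows "B *\<^sub>v unit_vec m j = col B j"
  by (rule eq_vecI) (use assms in \<open>auto simp: scalar_prod_right_unit\<close>)

lemma submodule_image:
  fixes B :: "'a::comm_ring_1 mat"
  assumes B: "B \<in> carrier_mat n m"
  shows "submodule class_ring ((\<lambda>v. B *\<^sub>v v) ` carrier_vec m) (module_vec TYPE('a) n)"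
proof (rule submodule.intro)
  interpret vec_module "TYPE('a)" n .
  let ?I = "(\<lambda>v. B *\<^sub>v v) ` carrier_vec m"
  show "Module.module class_ring V" by (rule module_axioms)
  show "?I \<subseteq> carrier V"
    by (auto simp: module_vec_simps intro: mult_mat_vec_carrier[OF B])
  show "\<zero>\<^bsub>V\<^esub> \<in> ?I"
    using B by (auto simp: module_vec_simps intro!: image_eqI[of _ _ "0\<^sub>v m"])
  show "x \<oplus>\<^bsub>V\<^esub> y \<in> ?I" if "x \<in> ?I" "y \<in> ?I" for x y
    using that by (auto simp: module_vec_simps mult_add_distrib_mat_vec[OF B, symmetric])
  show "c \<odot>\<^bsub>V\<^esub> x \<in> ?I" if "x \<in> ?I" for c x
  proof -
    from that obtain v where v: "v \<in> carrier_vec m" "x = B *\<^sub>v v" by blast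
    then have "c \<cdot>\<^sub>v x = B *\<^sub>v (c \<cdot>\<^sub>v v)" using B by (intro eq_vecI) auto
    then show ?thesis using v by (simp add: module_vec_simps)
  qed
qed

text \<open>Restates the module laws for \<open>class_ring\<close>, whose carrier is the whole type
  and whose operations are those of the type class; scalars then need no membership
  conditions.\<close>

locale class_module = Module.module "class_ring :: 'k::comm_ring_1 ring" G
  for G :: "('k::comm_ring_1, 'g) Module.module"
begin

lemma smult_carrier [simp]: "x \<in> carrier G \<Longrightarrow> a \<odot>\<^bsub>G\<^esub> x \<in> carrier G"
  using smult_closed[of a x] by simp

lemma smult_add_left: "x \<in> carrier G \<Longrightarrow> (a + b) \<odot>\<^bsub>G\<^esub> x = a \<odot>\<^bsub>G\<^esub> x \<oplus>\<^bsub>G\<^esub> b \<odot>\<^bsub>G\<^esub> x"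
  using smult_l_distr[of a b x] by simp

lemma smult_add_right:
  "x \<in> carrier G \<Longrightarrow> y \<in> carrier G \<Longrightarrow> a \<odot>\<^bsub>G\<^esub> (x \<oplus>\<^bsub>G\<^esub> y) = a \<odot>\<^bsub>G\<^esub> x \<oplus>\<^bsub>G\<^esub> a \<odot>\<^bsub>G\<^esub> y"
  using smult_r_distr[of a x y] by simp

lemma smult_smult: "x \<in> carrier G \<Longrightarrow> a \<odot>\<^bsub>G\<^esub> (b \<odot>\<^bsub>G\<^esub> x) = (a * b) \<odot>\<^bsub>G\<^esub> x"
  using smult_assoc1[of a b x] by simp

lemma smult_1 [simp]: "x \<in> carrier G \<Longrightarrow> 1 \<odot>\<^bsub>G\<^esub> x = x"
  using smult_one[of x] by simp

lemma smult_0 [simp]: "x \<in> carrier G \<Longrightarrow> 0 \<odot>\<^bsub>G\<^esub> x = \<zero>\<^bsub>G\<^esub>"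
  using smult_l_null[of x] by simp

lemma smult_finsum:
  "finite A \<Longrightarrow> f \<in> A \<rightarrow> carrier G \<Longrightarrow> a \<odot>\<^bsub>G\<^esub> (\<Oplus>\<^bsub>G\<^esub>i\<in>A. f i) = (\<Oplus>\<^bsub>G\<^esub>i\<in>A. a \<odot>\<^bsub>G\<^esub> f i)"
  using finsum_smult_ldistr[of A a f] by simp

section \<open>Homomorphisms out of a free module\<close>

definition comb :: "nat \<Rightarrow> (nat \<Rightarrow> 'g) \<Rightarrow> 'k vec \<Rightarrow> 'g" where
  "comb n y v = (\<Oplus>\<^bsub>G\<^esub>i\<in>{..<n}. vec_index v i \<odot>\<^bsub>G\<^esub> y i)"

lemma comb_hom:
  assumes y: "\<And>i. i < n \<Longrightarrow> y i \<in> carrier G"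
  shows "comb n y \<in> module_hom class_ring (module_vec TYPE('k) n) G"
  unfolding LinearCombinations.module_hom_def
proof (intro CollectI conjI allI impI funcsetI)
  show "comb n y v \<in> carrier G" for v
    unfolding comb_def using y by (intro finsum_closed) auto
  fix v w :: "'k Matrix.vec" assume "v \<in> carrier (module_vec TYPE('k) n) \<and> w \<in> carrier (module_vec TYPE('k) n)"
  then have vw: "v \<in> carrier_vec n" "w \<in> carrier_vec n" by (auto simp: module_vec_simps)
  have "comb n y (v + w) = (\<Oplus>\<^bsub>G\<^esub>i\<in>{..<n}. vec_index v i \<odot>\<^bsub>G\<^esub> y i \<oplus>\<^bsub>G\<^esub> vec_index w i \<odot>\<^bsub>G\<^esub> y i)"
    unfolding comb_def using vw y by (intro finsum_cong') (auto simp: smult_add_left)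
  also have "\<dots> = comb n y v \<oplus>\<^bsub>G\<^esub> comb n y w"
    unfolding comb_def using y by (intro finsum_addf) auto
  finally show "comb n y (v \<oplus>\<^bsub>module_vec TYPE('k) n\<^esub> w) = comb n y v \<oplus>\<^bsub>G\<^esub> comb n y w"
    by (simp add: module_vec_simps)
next
  fix c :: 'k and v :: "'k Matrix.vec" assume "c \<in> carrier class_ring \<and> v \<in> carrier (module_vec TYPE('k) n)"
  then have v: "v \<in> carrier_vec n" by (auto simp: module_vec_simps)
  have "comb n y (c \<cdot>\<^sub>v v) = (\<Oplus>\<^bsub>G\<^esub>i\<in>{..<n}. c \<odot>\<^bsub>G\<^esub> (vec_index v i \<odot>\<^bsub>G\<^esub> y i))"
    unfolding comb_def using v y by (intro finsum_cong') (auto simp: smult_smult)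
  also have "\<dots> = c \<odot>\<^bsub>G\<^esub> comb n y v"
    unfolding comb_def using y by (intro smult_finsum[symmetric]) auto
  finally show "comb n y (c \<odot>\<^bsub>module_vec TYPE('k) n\<^esub> v) = c \<odot>\<^bsub>G\<^esub> comb n y v"
    by (simp add: module_vec_simps)
qed

lemma comb_unit:
  assumes y: "\<And>i. i < n \<Longrightarrow> y i \<in> carrier G" and j: "j < n"
  shows "comb n y (unit_vec n j) = y j"
proof -
  have "comb n y (unit_vec n j) = (\<Oplus>\<^bsub>G\<^esub>i\<in>{..<n}. if j = i then y i else \<zero>\<^bsub>G\<^esub>)"
    unfolding comb_def using y j by (intro finsum_cong') auto
  also have "\<dots> = y j"
    using y j by (intro finsum_singleton) auto
  finally show ?thesis .
qed

text \<open>Induction on a bound \<open>k\<close> for the support: the coordinate at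
  \<open>k\<close> is split off as a multiple of a unit vector.\<close>

lemma vec_hom_eqI:
  assumes f: "f \<in> module_hom class_ring (module_vec TYPE('k) n) G"
    and g: "g \<in> module_hom class_ring (module_vec TYPE('k) n) G"
    and eq: "\<And>i. i < n \<Longrightarrow> f (unit_vec n i) = g (unit_vec n i)"
    and v: "v \<in> carrier_vec n"
  shows "f v = g v"
proof -
  have add: "h (v + w) = h v \<oplus>\<^bsub>G\<^esub> h w" and smult: "h (c \<cdot>\<^sub>v v) = c \<odot>\<^bsub>G\<^esub> h v"
    and closed: "h v \<in> carrier G"
    if "h \<in> module_hom class_ring (module_vec TYPE('k) n) G" "v \<in> carrier_vec n" "w \<in> carrier_vec n"
    for h v w c
    using that unfolding LinearCombinations.module_hom_def by (auto simp: module_vec_simps)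
  have "f v = g v" if "v \<in> carrier_vec n" "\<And>i. k \<le> i \<Longrightarrow> i < n \<Longrightarrow> vec_index v i = 0" "k \<le> n" for k v
    using that
  proof (induction k arbitrary: v)
    case 0
    have "v = 0 \<cdot>\<^sub>v v" by (rule eq_vecI) (use 0 in auto)
    then show ?case
      using smult[OF f 0(1) 0(1), of 0] smult[OF g 0(1) 0(1), of 0]
        closed[OF f 0(1) 0(1)] closed[OF g 0(1) 0(1)] by simp
  next
    case (Suc k)
    let ?w = "vec n (\<lambda>i. if i = k then 0 else vec_index v i)"
    have v: "v = ?w + vec_index v k \<cdot>\<^sub>v unit_vec n k"
      by (rule eq_vecI) (use Suc.prems in auto)
    have w: "?w \<in> carrier_vec n" "f ?w = g ?w"
      by (simp, rule Suc.IH) (use Suc.prems in auto)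
    have u: "unit_vec n k \<in> carrier_vec n" by simp
    have "f v = f ?w \<oplus>\<^bsub>G\<^esub> vec_index v k \<odot>\<^bsub>G\<^esub> f (unit_vec n k)"
      by (subst v, subst add[OF f w(1)]) (simp_all add: smult[OF f u u])
    moreover have "g v = g ?w \<oplus>\<^bsub>G\<^esub> vec_index v k \<odot>\<^bsub>G\<^esub> g (unit_vec n k)"
      by (subst v, subst add[OF g w(1)]) (simp_all add: smult[OF g u u])
    ultimately show ?case using w(2) eq[of k] Suc.prems by simp
  qed
  then show ?thesis using v by (meson le_refl not_le)
qed

text \<open>The composite of \<open>comb n y\<close> with \<open>B\<close> is a homomorphism that
  vanishes on unit vectors, so it agrees with the zero map.\<close>

lemma comb_mult_mat_vec_eq_0:
  assumes B: "B \<in> carrier_mat n m" and y: "\<And>i. i < n \<Longrightarrow> y i \<in> carrier G"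
    and rel: "\<And>j. j < m \<Longrightarrow> comb n y (col B j) = \<zero>\<^bsub>G\<^esub>" and v: "v \<in> carrier_vec m"
  shows "comb n y (B *\<^sub>v v) = \<zero>\<^bsub>G\<^esub>"
proof -
  have "comb n y \<in> module_hom class_ring (module_vec TYPE('k) n) G"
    using y by (rule comb_hom)
  note h = this[unfolded LinearCombinations.module_hom_def module_vec_simps]
  have Bc: "B *\<^sub>v w \<in> carrier_vec n" if "w \<in> carrier_vec m" for w
    using B that by auto
  have B_smult: "B *\<^sub>v (c \<cdot>\<^sub>v w) = c \<cdot>\<^sub>v (B *\<^sub>v w)" if "w \<in> carrier_vec m" for c w
    using B that by (intro eq_vecI) auto
  have "(\<lambda>v. comb n y (B *\<^sub>v v)) \<in> module_hom class_ring (module_vec TYPE('k) m) G"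
    using h Bc unfolding LinearCombinations.module_hom_def module_vec_simps
    by (auto simp: mult_add_distrib_mat_vec[OF B] B_smult)
  moreover have "(\<lambda>v. \<zero>\<^bsub>G\<^esub>) \<in> module_hom class_ring (module_vec TYPE('k) m) G"
    using smult_r_null by (auto simp: LinearCombinations.module_hom_def)
  moreover have "comb n y (B *\<^sub>v unit_vec m j) = \<zero>\<^bsub>G\<^esub>" if "j < m" for j
    using rel[OF that] B that by (simp add: mult_mat_unit_vec[OF B])
  ultimately show ?thesis using v by (rule vec_hom_eqI)
qed

text \<open>A surjection from the cokernel is determined by the images of the standard basis vectors.\<close>

lemma card_module_sur_cokernel:
  assumes B: "B \<in> carrier_mat n m"
  shows "card (module_sur class_ring (cokernel B) G) =
    card {y \<in> PiE {..<n} (\<lambda>_. carrier G). (\<forall>j<m. comb n y (col B j) = \<zero>\<^bsub>G\<^esub>) \<and>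
      comb n y ` carrier_vec n = carrier G}"
    (is "card ?S = card ?Y")
proof (rule bij_betw_same_card[of "\<lambda>f. \<lambda>i\<in>{..<n}. f ((\<lambda>v. B *\<^sub>v v) ` carrier_vec m
    +>\<^bsub>module_vec TYPE('k) n\<^esub> unit_vec n i)"])
  define V where "V = module_vec TYPE('k) n"
  define N where "N = (\<lambda>v. B *\<^sub>v v) ` carrier_vec m"
  have V [simp]: "carrier V = carrier_vec n" "add V = (+)" "zero V = 0\<^sub>v n" "Module.smult V = (\<cdot>\<^sub>v)"
    by (simp_all add: V_def module_vec_simps)
  have cok: "cokernel B = quotient_module V N"
    using B by (simp add: cokernel_def V_def N_def)
  have sub: "submodule class_ring N V"
    unfolding N_def V_def by (rule submodule_image[OF B])
  interpret N: abelian_subgroup N V using sub by (rule abelian_subgroup_submodule)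
  let ?c = "\<lambda>v. N +>\<^bsub>V\<^esub> v" and ?Q = "quotient_module V N"
  have Q: "carrier ?Q = ?c ` carrier_vec n"
    by (auto simp: quotient_module_def A_RCOSETS_def' a_r_coset_def)
  have Qadd: "?c v \<oplus>\<^bsub>?Q\<^esub> ?c w = ?c (v + w)" if "v \<in> carrier_vec n" "w \<in> carrier_vec n" for v w
    using that N.a_rcos_sum by (simp add: quotient_module_def)
  have Qsmult: "a \<odot>\<^bsub>?Q\<^esub> ?c v = ?c (a \<cdot>\<^sub>v v)" if "v \<in> carrier_vec n" for a v
    using quotient_module_smult_coset[OF sub, of a v] that by simp
  have NV: "N \<subseteq> carrier_vec n" using N.a_subset by simp
  let ?g = "\<lambda>f. \<lambda>i\<in>{..<n}. f (?c (unit_vec n i))"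
  have hom: "(\<lambda>v. f (?c v)) \<in> module_hom class_ring (module_vec TYPE('k) n) G"
    and comb: "v \<in> carrier_vec n \<Longrightarrow> comb n (?g f) v = f (?c v)"
    and gc: "i < n \<Longrightarrow> ?g f i \<in> carrier G"
    if f: "f \<in> module_sur class_ring ?Q G" for f v i
  proof -
    have f': "f \<in> carrier ?Q \<rightarrow> carrier G"
      "\<And>X Y. X \<in> carrier ?Q \<Longrightarrow> Y \<in> carrier ?Q \<Longrightarrow> f (X \<oplus>\<^bsub>?Q\<^esub> Y) = f X \<oplus>\<^bsub>G\<^esub> f Y"
      "\<And>a X. X \<in> carrier ?Q \<Longrightarrow> f (a \<odot>\<^bsub>?Q\<^esub> X) = a \<odot>\<^bsub>G\<^esub> f X"
      using f by (auto simp: module_sur_def LinearCombinations.module_hom_def)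
    show h: "(\<lambda>v. f (?c v)) \<in> module_hom class_ring (module_vec TYPE('k) n) G"
      unfolding LinearCombinations.module_hom_def module_vec_simps
      using f' by (auto simp: Q Qadd[symmetric] Qsmult[symmetric])
    show gc: "?g f i \<in> carrier G" if "i < n" for i
      using f' that by (auto simp: Q)
    show "comb n (?g f) v = f (?c v)" if "v \<in> carrier_vec n" for v
      by (rule vec_hom_eqI[OF comb_hom h _ that]) (use gc in \<open>auto simp: comb_unit\<close>)
  qed
  have c0: "?c v = N" if "v \<in> N" for v
    using that N.a_rcos_const by simp
  have "bij_betw ?g (module_sur class_ring ?Q G) ?Y"
    unfolding bij_betw_def
  proof
    show "inj_on ?g (module_sur class_ring ?Q G)"
    proof (rule inj_onI)
      fix f h assume f: "f \<in> module_sur class_ring ?Q G" and h: "h \<in> module_sur class_ring ?Q G"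
        and eq: "?g f = ?g h"
      show "f = h"
      proof (rule extensionalityI[of _ "carrier ?Q"])
        fix X assume "X \<in> carrier ?Q"
        then obtain v where "v \<in> carrier_vec n" "X = ?c v" by (auto simp: Q)
        then show "f X = h X" using comb[OF f] comb[OF h] eq by metis
      qed (use f h in \<open>auto simp: module_sur_def\<close>)
    qed
    show "?g ` module_sur class_ring ?Q G = ?Y"
    proof (intro equalityI subsetI)
      fix y assume "y \<in> ?g ` module_sur class_ring ?Q G"
      then obtain f where f: "f \<in> module_sur class_ring ?Q G" and y: "y = ?g f" by blast
      have "comb n y (col B j) = \<zero>\<^bsub>G\<^esub>" if "j < m" for j
      proof -
        have "col B j = B *\<^sub>v unit_vec m j" using B that by (simp add: mult_mat_unit_vec[OF B])
        then have cN: "col B j \<in> N" by (auto simp: N_def)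
        then have "comb n y (col B j) = f N"
          using NV by (simp add: y comb[OF f] subset_iff c0)
        also have "f N = comb n y (0\<^sub>v n)"
          using N.a_subset submodule.zero_closed[OF sub] by (simp add: y comb[OF f] c0)
        also have "\<dots> = \<zero>\<^bsub>G\<^esub>"
          unfolding comb_def using gc[OF f] by (subst finsum_cong'[of _ "{..<n}" "\<lambda>_. \<zero>\<^bsub>G\<^esub>"]) (auto simp: y)
        finally show ?thesis .
      qed
      moreover have "comb n y ` carrier_vec n = f ` carrier ?Q"
        unfolding Q image_image using comb[OF f] by (simp add: y)
      ultimately show "y \<in> ?Y" using f gc[OF f] by (auto simp: module_sur_def y)
    next
      fix y assume y: "y \<in> ?Y"
      then have yc: "\<And>i. i < n \<Longrightarrow> y i \<in> carrier G" by auto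
      have hc: "comb n y \<in> module_hom class_ring (module_vec TYPE('k) n) G"
        using yc by (rule comb_hom)
      have ch: "comb n y (v + w) = comb n y v \<oplus>\<^bsub>G\<^esub> comb n y w" "comb n y (a \<cdot>\<^sub>v v) = a \<odot>\<^bsub>G\<^esub> comb n y v"
        "comb n y v \<in> carrier G"
        if "v \<in> carrier_vec n" "w \<in> carrier_vec n" for v w a
        using hc that unfolding LinearCombinations.module_hom_def module_vec_simps by auto
      \<comment> \<open>The relations put \<open>N\<close> into the kernel of
        \<open>comb n y\<close>, which is therefore constant on cosets; \<open>the_elem\<close>
        reads off that value, and the restriction makes \<open>f\<close> extensional.\<close>
      define f where "f = (\<lambda>X\<in>carrier ?Q. the_elem (comb n y ` X))"
      have f: "f (?c v) = comb n y v" if v: "v \<in> carrier_vec n" for v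
      proof -
        have "comb n y w = comb n y v" if "w \<in> ?c v" for w
        proof -
          from that obtain u where u: "u \<in> N" "w = u + v"
            by (auto simp: a_r_coset_def r_coset_def)
          then have "comb n y u = \<zero>\<^bsub>G\<^esub>"
            using comb_mult_mat_vec_eq_0[OF B yc] y by (auto simp: N_def)
          then show ?thesis using u NV v ch by (auto simp: subset_iff)
        qed
        moreover have "v \<in> ?c v" using v N.a_rcos_self by simp
        ultimately have "comb n y ` ?c v = {comb n y v}" by blast
        then show ?thesis using v by (simp add: f_def Q)
      qed
      have "f \<in> module_sur class_ring ?Q G"
        unfolding module_sur_def LinearCombinations.module_hom_def
        using ch y by (auto simp: Q f Qadd Qsmult image_image) (auto simp: f_def Q)
      moreover have "y = ?g f"
        using y by (intro extensionalityI[of _ "{..<n}"]) (auto simp: f comb_unit yc PiE_def)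
      ultimately show "y \<in> ?g ` module_sur class_ring ?Q G" by blast
    qed
  qed
  then show "bij_betw (\<lambda>f. \<lambda>i\<in>{..<n}. f ((\<lambda>v. B *\<^sub>v v) ` carrier_vec m
    +>\<^bsub>module_vec TYPE('k) n\<^esub> unit_vec n i)) ?S ?Y"
    by (simp add: cok V_def N_def)
qed

end

section \<open>Coordinates on a finite module\<close>

locale finite_poly_module = class_module G
  for G :: "('p::prime_card mod_ring poly, 'g) Module.module" +
  assumes finite_carrier: "finite (carrier G)"
begin

text \<open>Linearity over F_p: the field acts on \<open>G\<close> through the constant polynomials
  \<open>[:a:]\<close>.\<close>

definition lin :: "((nat \<Rightarrow> 'p mod_ring) \<Rightarrow> 'g) \<Rightarrow> nat \<Rightarrow> bool" where
  "lin L r \<longleftrightarrow> (\<forall>v\<in>vspace r. L v \<in> carrier G) \<and>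
    (\<forall>v\<in>vspace r. \<forall>w\<in>vspace r. L (v + w) = L v \<oplus>\<^bsub>G\<^esub> L w) \<and>
    (\<forall>a. \<forall>v\<in>vspace r. L (scal a v) = [:a:] \<odot>\<^bsub>G\<^esub> L v)"

lemma linD:
  assumes "lin L r"
  shows "v \<in> vspace r \<Longrightarrow> L v \<in> carrier G"
    and "v \<in> vspace r \<Longrightarrow> w \<in> vspace r \<Longrightarrow> L (v + w) = L v \<oplus>\<^bsub>G\<^esub> L w"
    and "v \<in> vspace r \<Longrightarrow> L (scal a v) = [:a:] \<odot>\<^bsub>G\<^esub> L v"
  using assms by (auto simp: lin_def)

lemma lin_zero:
  assumes "lin L r"
  shows "L 0 = \<zero>\<^bsub>G\<^esub>"
proof -
  have z: "(0 :: nat \<Rightarrow> 'p mod_ring) \<in> vspace r" by (rule subsp_zero[OF subsp_vspace])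
  have "scal 0 0 = (0 :: nat \<Rightarrow> 'p mod_ring)" by (rule ext) simp
  then show ?thesis
    using linD(3)[OF assms z, of 0] linD(1)[OF assms z] by simp
qed

lemma lin_sum:
  assumes L: "lin L r" and "finite A" "\<And>i. i \<in> A \<Longrightarrow> f i \<in> vspace r"
  shows "L (sum f A) = (\<Oplus>\<^bsub>G\<^esub>i\<in>A. L (f i))"
  using assms(2,3)
proof (induction A rule: finite_induct)
  case empty
  show ?case by (simp only: sum.empty finsum_empty lin_zero[OF L])
next
  case (insert x A)
  have "L (f x + sum f A) = L (f x) \<oplus>\<^bsub>G\<^esub> L (sum f A)"
    by (intro linD(2)[OF L] subsp_sum[OF subsp_vspace]) (use insert.prems in auto)
  then show ?case
    using insert linD(1)[OF L] by (subst finsum_insert) auto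
qed

lemma lin_inj:
  assumes L: "lin L r" and ker: "\<And>v. v \<in> vspace r \<Longrightarrow> L v = \<zero>\<^bsub>G\<^esub> \<Longrightarrow> v = 0"
  shows "inj_on L (vspace r)"
proof (rule inj_onI)
  fix v w :: "nat \<Rightarrow> 'p mod_ring"
  assume v: "v \<in> vspace r" and w: "w \<in> vspace r" and eq: "L v = L w"
  have d: "v - w \<in> vspace r" using subsp_vspace v w by (rule subsp_diff)
  have "L ((v - w) + w) = L (v - w) \<oplus>\<^bsub>G\<^esub> L w" by (rule linD(2)[OF L d w])
  then have "\<zero>\<^bsub>G\<^esub> \<oplus>\<^bsub>G\<^esub> L w = L (v - w) \<oplus>\<^bsub>G\<^esub> L w"
    using eq linD(1)[OF L w] by simp
  then have "L (v - w) = \<zero>\<^bsub>G\<^esub>"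
    using linD(1)[OF L w] linD(1)[OF L d] by simp
  then have "v - w = 0" by (rule ker[OF d])
  then show "v = w" by (rule iffD1[OF right_minus_eq])
qed

text \<open>The new coordinate \<open>r\<close> is sent to \<open>x\<close>. A kernel vector with
  \<open>v r \<noteq> 0\<close>, rescaled by \<open>- 1 / v r\<close>, would exhibit
  \<open>x\<close> as a value of \<open>L\<close>.\<close>

lemma lin_extend:
  assumes L: "lin L r" and inj: "inj_on L (vspace r)"
    and x: "x \<in> carrier G" "x \<notin> L ` vspace r"
  shows "\<exists>L'. lin L' (Suc r) \<and> inj_on L' (vspace (Suc r))"
proof (intro exI conjI)
  let ?L = "\<lambda>v. L (v(r := 0)) \<oplus>\<^bsub>G\<^esub> [:v r:] \<odot>\<^bsub>G\<^esub> x"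
  have v0: "v(r := 0) \<in> vspace r" if "v \<in> vspace (Suc r)" for v :: "nat \<Rightarrow> 'p mod_ring"
    using that by (auto simp: vspace_def)
  note Lc = linD(1)[OF L v0]
  show lin: "lin ?L (Suc r)"
    unfolding lin_def
  proof (intro conjI ballI allI)
    fix v w :: "nat \<Rightarrow> 'p mod_ring" and a
    assume v: "v \<in> vspace (Suc r)"
    show "?L v \<in> carrier G" using Lc[OF v] x by simp
    have "(scal a v)(r := 0) = scal a (v(r := 0))" by (rule ext) simp
    then show "?L (scal a v) = [:a:] \<odot>\<^bsub>G\<^esub> ?L v"
      using linD(3)[OF L v0[OF v], of a] Lc[OF v] x
      by (simp add: smult_add_right smult_smult mult.commute)
    assume w: "w \<in> vspace (Suc r)"
    have "(v + w)(r := 0) = v(r := 0) + w(r := 0)" by (rule ext) simp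
    moreover have "[:v r + w r:] = [:v r:] + [:w r:]" by simp
    ultimately show "?L (v + w) = ?L v \<oplus>\<^bsub>G\<^esub> ?L w"
      using linD(2)[OF L v0[OF v] v0[OF w]] Lc[OF v] Lc[OF w] x
      by (simp only: plus_fun_apply smult_add_left) (simp add: a_ac)
  qed
  show "inj_on ?L (vspace (Suc r))"
  proof (rule lin_inj[OF lin])
    fix v :: "nat \<Rightarrow> 'p mod_ring"
    assume v: "v \<in> vspace (Suc r)" and eq: "?L v = \<zero>\<^bsub>G\<^esub>"
    show "v = 0"
    proof (cases "v r = 0")
      case True
      then have "L (v(r := 0)) = L 0"
        using eq Lc[OF v] x lin_zero[OF L] by simp
      then have "v(r := 0) = 0"
        by (rule inj_onD[OF inj _ v0[OF v] subsp_zero[OF subsp_vspace]])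
      then show ?thesis using True by (metis fun_upd_triv)
    next
      case False
      let ?a = "- 1 / v r" and ?u = "scal (- 1 / v r) (v(r := 0))"
      have u: "?u \<in> vspace r" by (rule subsp_scal[OF subsp_vspace v0[OF v]])
      have m: "[:- 1 :: 'p mod_ring:] \<odot>\<^bsub>G\<^esub> x \<oplus>\<^bsub>G\<^esub> x = \<zero>\<^bsub>G\<^esub>"
      proof -
        have "[:- 1 :: 'p mod_ring:] + 1 = 0" by (simp add: one_pCons)
        then show ?thesis using smult_add_left[OF x(1), of "[:- 1:]" 1] x by simp
      qed
      have "[:?a:] \<odot>\<^bsub>G\<^esub> ?L v = L ?u \<oplus>\<^bsub>G\<^esub> [:- 1:] \<odot>\<^bsub>G\<^esub> x"
        using linD(3)[OF L v0[OF v], of ?a] Lc[OF v] x False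
        by (simp add: smult_add_right smult_smult)
      then have "L ?u \<oplus>\<^bsub>G\<^esub> [:- 1:] \<odot>\<^bsub>G\<^esub> x = \<zero>\<^bsub>G\<^esub>"
        using eq smult_r_null[of "[:?a:]"] by simp
      then have "(L ?u \<oplus>\<^bsub>G\<^esub> [:- 1:] \<odot>\<^bsub>G\<^esub> x) \<oplus>\<^bsub>G\<^esub> x = x" using x by simp
      then have "L ?u = x" using m linD(1)[OF L u] x by (simp add: a_assoc)
      then show ?thesis using u x(2) by blast
    qed
  qed
qed

text \<open>An injective linear map from the largest possible \<open>vspace r\<close> is onto, since
  otherwise it could be extended. A largest \<open>r\<close> exists because the \<open>r\<close>
  unit vectors have distinct images in the finite carrier.\<close>

lemma coordinates_exist: "\<exists>r L. lin L r \<and> bij_betw L (vspace r) (carrier G)"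
proof -
  define P where "P r \<longleftrightarrow> (\<exists>L. lin L r \<and> inj_on L (vspace r))" for r
  have v0: "vspace 0 = {0 :: nat \<Rightarrow> 'p mod_ring}" by (auto simp: vspace_def fun_eq_iff)
  have "P 0"
    unfolding P_def lin_def v0
    by (intro exI[of _ "\<lambda>_. \<zero>\<^bsub>G\<^esub>"]) (use smult_r_null in auto)
  moreover have bound: "r \<le> card (carrier G)" if "P r" for r
  proof -
    from that obtain L where L: "lin L r" "inj_on L (vspace r)" by (auto simp: P_def)
    let ?e = "\<lambda>k j. if j = k then 1 else (0 :: 'p mod_ring)"
    have "inj_on ?e {..<r}"
    proof (rule inj_onI)
      fix k l assume "?e k = ?e l"
      then have "?e k k = ?e l k" by (rule fun_cong)
      then show "k = l" by (simp split: if_splits)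
    qed
    moreover have "?e ` {..<r} \<subseteq> vspace r" by (auto simp: vspace_def)
    ultimately have "card {..<r} \<le> card (vspace r :: (nat \<Rightarrow> 'p mod_ring) set)"
      by (rule card_inj_on_le) simp
    also have "\<dots> \<le> card (carrier G)"
      using L(2) by (rule card_inj_on_le) (use linD(1)[OF L(1)] finite_carrier in auto)
    finally show ?thesis by simp
  qed
  ultimately obtain r where r: "P r" and max: "\<And>s. P s \<Longrightarrow> s \<le> r"
    using GreatestI_nat[of P 0] Greatest_le_nat[of P] by metis
  from r obtain L where L: "lin L r" "inj_on L (vspace r)" by (auto simp: P_def)
  have "L ` vspace r = carrier G"
  proof (rule ccontr)
    assume "L ` vspace r \<noteq> carrier G"
    moreover have "L ` vspace r \<subseteq> carrier G" using linD(1)[OF L(1)] by auto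
    ultimately obtain x where "x \<in> carrier G" "x \<notin> L ` vspace r" by auto
    then have "P (Suc r)" unfolding P_def by (rule lin_extend[OF L])
    then show False using max[of "Suc r"] by simp
  qed
  then show ?thesis using L by (auto simp: bij_betw_def)
qed

end

locale coordinatised_module = finite_poly_module G
  for G :: "('p::prime_card mod_ring poly, 'g) Module.module" +
  fixes r :: nat and L :: "(nat \<Rightarrow> 'p mod_ring) \<Rightarrow> 'g" and V :: "(nat \<Rightarrow> 'p mod_ring) set"
  assumes L: "lin L r" and V_def: "V = vspace r" and bij: "bij_betw L V (carrier G)"
begin

lemma V: "subsp V"
  by (simp add: V_def subsp_vspace)

lemma L_closed: "v \<in> V \<Longrightarrow> L v \<in> carrier G"
  and L_add: "v \<in> V \<Longrightarrow> w \<in> V \<Longrightarrow> L (v + w) = L v \<oplus>\<^bsub>G\<^esub> L w"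
  and L_scal: "v \<in> V \<Longrightarrow> L (scal a v) = [:a:] \<odot>\<^bsub>G\<^esub> L v"
  and L_zero: "L 0 = \<zero>\<^bsub>G\<^esub>"
  and L_sum: "finite A \<Longrightarrow> (\<And>i. i \<in> A \<Longrightarrow> f i \<in> V) \<Longrightarrow> L (sum f A) = (\<Oplus>\<^bsub>G\<^esub>i\<in>A. L (f i))"
  unfolding V_def by (rule linD[OF L] lin_zero[OF L] lin_sum[OF L]; assumption)+

lemma L_eq_iff: "v \<in> V \<Longrightarrow> w \<in> V \<Longrightarrow> L v = L w \<longleftrightarrow> v = w"
  using bij by (auto simp: bij_betw_def dest: inj_onD)

lemma L_surj:
  assumes "x \<in> carrier G"
  shows "\<exists>v\<in>V. L v = x"
proof -
  from assms have "x \<in> L ` V" using bij by (simp add: bij_betw_def)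
  then obtain v where "x = L v" "v \<in> V" by (rule imageE)
  then show ?thesis by (intro bexI[of _ v]) simp_all
qed

section \<open>Multiplication by the variable, in coordinates\<close>

definition T :: "(nat \<Rightarrow> 'p mod_ring) \<Rightarrow> nat \<Rightarrow> 'p mod_ring" where
  "T v = inv_into V L ([:0, 1:] \<odot>\<^bsub>G\<^esub> L v)"

lemma T:
  assumes "v \<in> V"
  shows "T v \<in> V" "L (T v) = [:0, 1:] \<odot>\<^bsub>G\<^esub> L v"
proof -
  have "[:0, 1:] \<odot>\<^bsub>G\<^esub> L v \<in> L ` V"
    using bij L_closed[OF assms] by (simp add: bij_betw_def)
  then show "T v \<in> V" "L (T v) = [:0, 1:] \<odot>\<^bsub>G\<^esub> L v"
    unfolding T_def by (rule inv_into_into, rule f_inv_into_f)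
qed

text \<open>Column \<open>j\<close> of the matrix tI - B is t times a unit vector plus constants, so
  the combination is the image under \<open>L\<close> of \<open>T (g j)\<close> minus the
  B-combination of the \<open>g i\<close>; injectivity of \<open>L\<close> does the rest.\<close>

lemma comb_col_char_poly_matrix:
  assumes B: "B \<in> carrier_mat n n" and g: "\<And>i. i < n \<Longrightarrow> g i \<in> V" and j: "j < n"
  shows "comb n (\<lambda>i\<in>{..<n}. L (g i)) (col (char_poly_matrix B) j) = \<zero>\<^bsub>G\<^esub> \<longleftrightarrow>
    (\<Sum>i<n. scal (B $$ (i, j)) (g i)) = T (g j)"
proof -
  let ?X = "[:0, 1 :: 'p mod_ring:]" and ?s = "\<Sum>i<n. scal (- (B $$ (i, j))) (g i)"
  have gG: "L (g i) \<in> carrier G" if "i < n" for i using g that by (simp add: L_closed)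
  have sV: "scal a (g i) \<in> V" if "i < n" for i a using V g[OF that] by (rule subsp_scal)
  have "comb n (\<lambda>i\<in>{..<n}. L (g i)) (col (char_poly_matrix B) j) =
      (\<Oplus>\<^bsub>G\<^esub>i\<in>{..<n}. (if j = i then ?X \<odot>\<^bsub>G\<^esub> L (g i) else \<zero>\<^bsub>G\<^esub>) \<oplus>\<^bsub>G\<^esub> L (scal (- (B $$ (i, j))) (g i)))"
    unfolding comb_def
  proof (rule finsum_cong')
    fix i assume "i \<in> {..<n}"
    then have i: "i < n" by simp
    have "vec_index (col (char_poly_matrix B) j) i =
        (if j = i then ?X else 0) + [:- (B $$ (i, j)):]"
      using B i j by (auto simp: char_poly_matrix_def)
    then show "vec_index (col (char_poly_matrix B) j) i \<odot>\<^bsub>G\<^esub> (\<lambda>i\<in>{..<n}. L (g i)) i =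
        (if j = i then ?X \<odot>\<^bsub>G\<^esub> L (g i) else \<zero>\<^bsub>G\<^esub>) \<oplus>\<^bsub>G\<^esub> L (scal (- (B $$ (i, j))) (g i))"
      using i gG[OF i] by (simp only:) (simp add: smult_add_left L_scal g del: add_pCons)
  qed (use gG sV L_closed in auto)
  also have "\<dots> = (\<Oplus>\<^bsub>G\<^esub>i\<in>{..<n}. if j = i then ?X \<odot>\<^bsub>G\<^esub> L (g i) else \<zero>\<^bsub>G\<^esub>) \<oplus>\<^bsub>G\<^esub>
      (\<Oplus>\<^bsub>G\<^esub>i\<in>{..<n}. L (scal (- (B $$ (i, j))) (g i)))"
    using gG sV L_closed by (intro finsum_addf) auto
  also have "(\<Oplus>\<^bsub>G\<^esub>i\<in>{..<n}. if j = i then ?X \<odot>\<^bsub>G\<^esub> L (g i) else \<zero>\<^bsub>G\<^esub>) = L (T (g j))"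
    using gG j T(2)[OF g[OF j]] by (subst finsum_singleton) auto
  also have "(\<Oplus>\<^bsub>G\<^esub>i\<in>{..<n}. L (scal (- (B $$ (i, j))) (g i))) = L ?s"
    using sV by (subst L_sum) auto
  also have "L (T (g j)) \<oplus>\<^bsub>G\<^esub> L ?s = L (T (g j) + ?s)"
    using T(1)[OF g[OF j]] sV by (intro L_add[symmetric] subsp_sum[OF V]) auto
  finally have comb: "comb n (\<lambda>i\<in>{..<n}. L (g i)) (col (char_poly_matrix B) j) = L (T (g j) + ?s)" .
  have "?s = - (\<Sum>i<n. scal (B $$ (i, j)) (g i))"
    by (rule ext) (simp add: sum_fun_apply sum_negf)
  then have s: "T (g j) + ?s = T (g j) - (\<Sum>i<n. scal (B $$ (i, j)) (g i))"
    by (simp only: add_uminus_conv_diff)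
  have "T (g j) + ?s \<in> V"
    using T(1)[OF g[OF j]] sV by (intro subsp_add[OF V] subsp_sum[OF V]) auto
  then have "L (T (g j) + ?s) = L 0 \<longleftrightarrow> T (g j) + ?s = 0"
    by (rule L_eq_iff[OF _ subsp_zero[OF V]])
  then show ?thesis
    unfolding comb L_zero s right_minus_eq by (simp only: eq_commute)
qed

lemma comb_surj_iff_spanning:
  assumes g: "g \<in> PiE {..<n} (\<lambda>_. V)" and int: "intertwines T n B g"
  shows "comb n (\<lambda>i\<in>{..<n}. L (g i)) ` carrier_vec n = carrier G \<longleftrightarrow> g \<in> spanning V n"
proof
  let ?y = "\<lambda>i\<in>{..<n}. L (g i)"
  have gV: "g i \<in> V" if "i < n" for i using g that by auto
  have yc: "?y i \<in> carrier G" if "i < n" for i using L_closed[OF gV[OF that]] that by simp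
  have hc: "comb n ?y \<in> module_hom class_ring (module_vec TYPE('p mod_ring poly) n) G"
    using yc by (rule comb_hom)
  note hom = hc[unfolded LinearCombinations.module_hom_def module_vec_simps]
  {
    assume gen: "comb n ?y ` carrier_vec n = carrier G"
    define U where "U = (\<lambda>c. \<Sum>i<n. scal (c i) (g i)) ` (UNIV :: (nat \<Rightarrow> 'p mod_ring) set)"
    have U_I: "(\<Sum>i<n. scal (c i) (g i)) \<in> U" for c
      unfolding U_def by (rule rangeI)
    have U: "subsp U"
      unfolding subsp_def
    proof (intro conjI ballI allI)
      have "(\<Sum>i<n. scal 0 (g i)) = 0" by (rule ext) (simp add: sum_fun_apply)
      then show "0 \<in> U" using U_I[of "\<lambda>_. 0"] by (simp only:)
      fix v w a assume "v \<in> U"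
      then obtain c where v: "v = (\<Sum>i<n. scal (c i) (g i))" by (auto simp: U_def)
      have "scal a v = (\<Sum>i<n. scal (a * c i) (g i))"
        unfolding v by (rule ext) (simp add: sum_fun_apply sum_distrib_left mult.assoc)
      then show "scal a v \<in> U" by (simp only: U_I)
      assume "w \<in> U"
      then obtain d where w: "w = (\<Sum>i<n. scal (d i) (g i))" by (auto simp: U_def)
      have "v + w = (\<Sum>i<n. scal (c i + d i) (g i))"
        unfolding v w by (rule ext) (simp add: sum_fun_apply distrib_right sum.distrib)
      then show "v + w \<in> U" by (simp only: U_I)
    qed
    have UW: "U \<subseteq> W" if "subsp W" "\<And>i. i < n \<Longrightarrow> g i \<in> W" for W
      unfolding U_def using that by (auto intro!: subsp_sum subsp_scal)
    have UV: "U \<subseteq> V" by (rule UW[OF V gV])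
    have gU: "g i \<in> U" if "i < n" for i
    proof -
      have "g i k = (\<Sum>j<n. if i = j then g j k else 0)" for k using that by simp
      also have "\<dots> k = (\<Sum>j<n. scal (if j = i then 1 else 0) (g j)) k" for k
        unfolding sum_fun_apply by (intro sum.cong) auto
      finally have "g i = (\<Sum>j<n. scal (if j = i then 1 else 0) (g j))" by (rule ext)
      then show ?thesis by (simp only: U_I)
    qed
    have TgU: "T (g j) \<in> U" if "j < n" for j
    proof -
      have "T (g j) = (\<Sum>i<n. scal (B $$ (i, j)) (g i))"
        using int that by (simp add: intertwines_def)
      then show ?thesis by (simp only: U_I)
    qed
    have X_closed: "[:0, 1:] \<odot>\<^bsub>G\<^esub> x \<in> L ` U" if "x \<in> L ` U" for x
    proof -
      from that obtain c where x: "x = L (\<Sum>i<n. scal (c i) (g i))" by (auto simp: U_def)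
      have sV: "scal (c i) (g i) \<in> V" "scal (c i) (T (g i)) \<in> V" if "i < n" for i
        using gV[OF that] T(1)[OF gV[OF that]] by (auto intro: subsp_scal[OF V])
      have "[:0, 1:] \<odot>\<^bsub>G\<^esub> x = (\<Oplus>\<^bsub>G\<^esub>i\<in>{..<n}. [:0, 1:] \<odot>\<^bsub>G\<^esub> L (scal (c i) (g i)))"
        unfolding x using sV L_closed by (subst L_sum) (auto intro!: smult_finsum)
      also have "\<dots> = (\<Oplus>\<^bsub>G\<^esub>i\<in>{..<n}. L (scal (c i) (T (g i))))"
      proof (rule finsum_cong')
        fix i assume "i \<in> {..<n}"
        then have i: "g i \<in> V" using gV by simp
        show "[:0, 1:] \<odot>\<^bsub>G\<^esub> L (scal (c i) (g i)) = L (scal (c i) (T (g i)))"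
          using L_closed[OF i] T[OF i] i by (simp add: L_scal smult_smult)
      qed (use sV L_closed in auto)
      also have "\<dots> = L (\<Sum>i<n. scal (c i) (T (g i)))"
        using sV by (subst L_sum) auto
      also have "\<dots> \<in> L ` U"
        by (intro imageI subsp_sum[OF U] subsp_scal[OF U] TgU) simp
      finally show ?thesis .
    qed
    have poly_closed: "p \<odot>\<^bsub>G\<^esub> x \<in> L ` U" if x: "x \<in> L ` U" for p x
    proof (induction p rule: pCons_induct)
      case 0
      have "0 \<odot>\<^bsub>G\<^esub> x = L 0" using x UV L_closed by (auto simp: L_zero)
      then show ?case using subsp_zero[OF U] by simp
    next
      case (pCons a p)
      have xG: "x \<in> carrier G" using x UV L_closed by auto
      obtain u where u: "u \<in> U" "x = L u" using x by blast
      obtain w where w: "w \<in> U" "[:0, 1:] \<odot>\<^bsub>G\<^esub> (p \<odot>\<^bsub>G\<^esub> x) = L w"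
        using X_closed[OF pCons.IH] by blast
      have "pCons a p = [:a:] + [:0, 1:] * p" by simp
      then have "pCons a p \<odot>\<^bsub>G\<^esub> x = [:a:] \<odot>\<^bsub>G\<^esub> x \<oplus>\<^bsub>G\<^esub> [:0, 1:] \<odot>\<^bsub>G\<^esub> (p \<odot>\<^bsub>G\<^esub> x)"
        using xG by (simp only: smult_add_left smult_smult)
      also have "\<dots> = L (scal a u + w)"
        using u w UV by (subst L_add) (auto simp: L_scal intro!: subsp_scal[OF V])
      also have "\<dots> \<in> L ` U"
        using u w by (intro imageI subsp_add[OF U] subsp_scal[OF U])
      finally show ?case .
    qed
    have "carrier G \<subseteq> L ` U"
      unfolding gen[symmetric]
    proof (rule image_subsetI)
      fix v :: "'p mod_ring poly Matrix.vec"
      have "\<exists>w. \<forall>i<n. w i \<in> U \<and> vec_index v i \<odot>\<^bsub>G\<^esub> ?y i = L (w i)"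
      proof -
        have "\<exists>w. w \<in> U \<and> vec_index v i \<odot>\<^bsub>G\<^esub> ?y i = L w" if "i < n" for i
          using poly_closed[OF imageI[OF gU[OF that]], of "vec_index v i"] that by auto
        then show ?thesis by metis
      qed
      then obtain w where w: "\<And>i. i < n \<Longrightarrow> w i \<in> U"
        "\<And>i. i < n \<Longrightarrow> vec_index v i \<odot>\<^bsub>G\<^esub> ?y i = L (w i)" by auto
      have wV: "w i \<in> V" if "i < n" for i using w(1)[OF that] UV by blast
      have "comb n ?y v = (\<Oplus>\<^bsub>G\<^esub>i\<in>{..<n}. L (w i))"
        unfolding comb_def using w(2) wV L_closed by (intro finsum_cong') auto
      also have "\<dots> = L (\<Sum>i<n. w i)" using wV by (subst L_sum) auto
      also have "\<dots> \<in> L ` U" using w(1) by (intro imageI subsp_sum[OF U]) simp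
      finally show "comb n ?y v \<in> L ` U" .
    qed
    then have VU: "V \<subseteq> U"
      using UV L_closed L_eq_iff by (smt (verit, del_insts) imageE subset_iff)
    show "g \<in> spanning V n"
      unfolding spanning_def
    proof (intro CollectI conjI allI impI g)
      fix W assume W: "subsp W" "W \<subseteq> V" "\<forall>i<n. g i \<in> W"
      then have "U \<subseteq> W" by (intro UW) auto
      with VU have "V \<subseteq> W" by (rule subset_trans)
      with W(2) show "W = V" by (rule subset_antisym)
    qed
  next
    assume sp: "g \<in> spanning V n"
    let ?I = "comb n ?y ` carrier_vec n" and ?W = "{w \<in> V. L w \<in> comb n ?y ` carrier_vec n}"
    have add: "x \<oplus>\<^bsub>G\<^esub> z \<in> ?I" if "x \<in> ?I" "z \<in> ?I" for x z
    proof -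
      from that obtain v w where "v \<in> carrier_vec n" "w \<in> carrier_vec n"
        "x = comb n ?y v" "z = comb n ?y w" by blast
      then show ?thesis using hom by (intro image_eqI[of _ _ "v + w"]) auto
    qed
    have smult: "p \<odot>\<^bsub>G\<^esub> x \<in> ?I" if "x \<in> ?I" for x p
    proof -
      from that obtain v where "v \<in> carrier_vec n" "x = comb n ?y v" by blast
      then show ?thesis using hom by (intro image_eqI[of _ _ "p \<cdot>\<^sub>v v"]) auto
    qed
    have gI: "L (g i) \<in> ?I" if "i < n" for i
      using comb_unit[of n ?y i] yc that by (intro image_eqI[of _ _ "unit_vec n i"]) auto
    have "0 \<odot>\<^bsub>G\<^esub> comb n ?y (0\<^sub>v n) = \<zero>\<^bsub>G\<^esub>" using hom by (intro smult_0) auto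
    then have zero: "\<zero>\<^bsub>G\<^esub> \<in> ?I"
      using smult[of "comb n ?y (0\<^sub>v n)" 0] by auto
    have "subsp ?W"
      unfolding subsp_def
      using add smult zero by (auto simp: L_zero L_add L_scal intro: subsp_zero[OF V] subsp_add[OF V] subsp_scal[OF V])
    moreover have "\<forall>i<n. g i \<in> ?W" using gV gI by simp
    ultimately have "?W = V" using sp by (simp add: spanning_def)
    then have "carrier G \<subseteq> ?I" using L_surj by blast
    moreover have "?I \<subseteq> carrier G" using hom by auto
    ultimately show "?I = carrier G" by (rule subset_antisym[rotated])
  }
qed

lemma card_module_sur_char_poly_matrix:
  assumes B: "B \<in> carrier_mat n n"
  shows "card (module_sur class_ring (cokernel (char_poly_matrix B)) G) =
    card {g \<in> spanning V n. intertwines T n B g}"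
proof -
  let ?C = "char_poly_matrix B" and ?f = "\<lambda>g. \<lambda>i\<in>{..<n}. L (g i)"
  let ?Y = "{y \<in> PiE {..<n} (\<lambda>_. carrier G). (\<forall>j<n. comb n y (col ?C j) = \<zero>\<^bsub>G\<^esub>) \<and>
      comb n y ` carrier_vec n = carrier G}"
  have key: "?f g \<in> ?Y \<longleftrightarrow> g \<in> spanning V n \<and> intertwines T n B g"
    if g: "g \<in> PiE {..<n} (\<lambda>_. V)" for g
  proof -
    have gV: "\<And>i. i < n \<Longrightarrow> g i \<in> V" using g by auto
    have "(\<forall>j<n. comb n (?f g) (col ?C j) = \<zero>\<^bsub>G\<^esub>) \<longleftrightarrow> intertwines T n B g"
      using comb_col_char_poly_matrix[OF B gV] by (simp add: intertwines_def)
    moreover have "?f g \<in> PiE {..<n} (\<lambda>_. carrier G)" using gV L_closed by auto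
    ultimately show ?thesis using comb_surj_iff_spanning[OF g, of B] by blast
  qed
  have sp: "g \<in> PiE {..<n} (\<lambda>_. V)" if "g \<in> spanning V n" for g
    using that by (simp add: spanning_def)
  have "bij_betw ?f {g \<in> spanning V n. intertwines T n B g} ?Y"
    unfolding bij_betw_def
  proof
    show "inj_on ?f {g \<in> spanning V n. intertwines T n B g}"
    proof (rule inj_onI)
      fix g h assume gh: "g \<in> {g \<in> spanning V n. intertwines T n B g}"
        "h \<in> {g \<in> spanning V n. intertwines T n B g}" and eq: "?f g = ?f h"
      have gP: "g \<in> PiE {..<n} (\<lambda>_. V)" and hP: "h \<in> PiE {..<n} (\<lambda>_. V)" using gh sp by auto
      show "g = h"
      proof (rule PiE_ext[OF gP hP])
        fix i assume i: "i \<in> {..<n}"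
        then have "L (g i) = L (h i)" using fun_cong[OF eq, of i] by simp
        then show "g i = h i" using L_eq_iff[OF PiE_mem[OF gP i] PiE_mem[OF hP i]] by simp
      qed
    qed
    show "?f ` {g \<in> spanning V n. intertwines T n B g} = ?Y"
    proof (intro equalityI image_subsetI subsetI)
      fix g assume "g \<in> {g \<in> spanning V n. intertwines T n B g}"
      then show "?f g \<in> ?Y" using key sp by simp
    next
      fix y assume y: "y \<in> ?Y"
      let ?g = "\<lambda>i\<in>{..<n}. inv_into V L (y i)"
      have yL: "y i \<in> L ` V" if "i < n" for i
        using y that bij by (auto simp: bij_betw_def)
      have g: "?g \<in> PiE {..<n} (\<lambda>_. V)" using inv_into_into[OF yL] by auto
      have fg: "?f ?g = y"
      proof (rule PiE_ext[of _ "{..<n}" "\<lambda>_. carrier G"])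
        show "?f ?g \<in> PiE {..<n} (\<lambda>_. carrier G)"
          by (auto intro!: L_closed inv_into_into yL)
        show "y \<in> PiE {..<n} (\<lambda>_. carrier G)" using y by simp
        show "?f ?g i = y i" if "i \<in> {..<n}" for i using f_inv_into_f[OF yL] that by simp
      qed
      then have "?g \<in> {g \<in> spanning V n. intertwines T n B g}" using key[OF g] y by simp
      then show "y \<in> ?f ` {g \<in> spanning V n. intertwines T n B g}"
        using fg by (intro image_eqI[of _ ?f ?g]) simp_all
    qed
  qed
  then show ?thesis
    using card_module_sur_cokernel[OF char_poly_matrix_closed[OF B]] by (simp add: bij_betw_same_card)
qed

end

theorem theorem3p5:
  fixes \<alpha> :: "nat \<Rightarrow> real"
    and M :: "nat \<Rightarrow> 'w measure"
    and A :: "nat \<Rightarrow> 'w \<Rightarrow> 'p::prime_card mod_ring mat"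
    and G :: "('p mod_ring poly, 'g) module"
  assumes "\<And>n. n \<ge> 1 \<Longrightarrow> \<alpha> n > 0"
    and "liminf (\<lambda>n. ereal (real n * \<alpha> n / ln (real n))) > 1"
    and "\<And>n. n \<ge> 1 \<Longrightarrow> prob_space (M n)"
    and "\<And>n. n \<ge> 1 \<Longrightarrow> balanced_matrix (M n) n (\<alpha> n) (A n)"
    and "Module.module (class_ring :: 'p mod_ring poly ring) G"
    and "finite (carrier G)"
  shows "(\<lambda>n. prob_space.expectation (M n)
            (\<lambda>\<omega>. real (card (module_sur class_ring (cokernel (char_poly_matrix (A n \<omega>))) G))))
          \<longlonglongrightarrow> 1"
proof -
  interpret finite_poly_module G
    by (intro finite_poly_module.intro class_module.intro finite_poly_module_axioms.intro assms)
  obtain r L where "lin L r" "bij_betw L (vspace r) (carrier G)"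
    using coordinates_exist by blast
  then interpret coordinatised_module G r L "vspace r"
    by unfold_locales auto
  let ?V = "vspace r :: (nat \<Rightarrow> 'p mod_ring) set"
  \<comment> \<open>Choosing \<open>a\<close> strictly between 1 and the liminf gives
    \<open>a * ln n / n \<le> \<alpha> n\<close> eventually, so every entry is also balanced with
    this smaller parameter.\<close>
  obtain a :: real where a: "1 < a" "ereal a < liminf (\<lambda>n. ereal (real n * \<alpha> n / ln (real n)))"
    using ereal_dense2[OF assms(2)] by (auto simp flip: one_ereal_def)
  have "\<forall>\<^sub>F n in sequentially. ereal a < ereal (real n * \<alpha> n / ln (real n))"
    using a(2) by (rule less_LiminfD)
  then have law: "\<forall>\<^sub>F n in sequentially. \<forall>j<n. \<forall>i<n.
      balanced_law (a * ln (real n) / real n) (entry_law (M n) (A n) j i)"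
    using eventually_ge_at_top[of 2]
  proof eventually_elim
    case (elim n)
    have "a * ln (real n) / real n \<le> \<alpha> n"
      using elim by (simp add: field_simps)
    then show ?case
      using balanced_law_entry[OF assms(3) assms(4)] elim by auto
  qed
  have "(\<lambda>n. \<Sum>g\<in>spanning ?V n. weight (entry_law (M n) (A n)) T n g) \<longlonglongrightarrow> 1"
    using a(1) law T(1) by (rule sum_weight_tendsto)
  moreover have "\<forall>\<^sub>F n in sequentially. (\<Sum>g\<in>spanning ?V n. weight (entry_law (M n) (A n)) T n g) =
      prob_space.expectation (M n)
        (\<lambda>\<omega>. real (card (module_sur class_ring (cokernel (char_poly_matrix (A n \<omega>))) G)))"
    using eventually_ge_at_top[of 1]
  proof eventually_elim
    case (elim n)
    have fin: "finite (spanning ?V n)"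
      by (rule finite_subset[of _ "PiE {..<n} (\<lambda>_. ?V)"]) (auto simp: spanning_def finite_PiE)
    have "prob_space.expectation (M n)
        (\<lambda>\<omega>. real (card (module_sur class_ring (cokernel (char_poly_matrix (A n \<omega>))) G))) =
      prob_space.expectation (M n)
        (\<lambda>\<omega>. real (card {g \<in> spanning ?V n. intertwines T n (A n \<omega>) g}))"
      using assms(4)[OF elim]
      by (intro Bochner_Integration.integral_cong refl)
        (simp add: balanced_matrix_def card_module_sur_char_poly_matrix)
    also have "\<dots> = (\<Sum>g\<in>spanning ?V n. weight (entry_law (M n) (A n)) T n g)"
      by (rule expectation_card_intertwines[OF assms(3)[OF elim] assms(4)[OF elim] _ fin])
        (use elim in simp)
    finally show ?case ..
  qed
  ultimately show ?thesis by (rule Lim_transform_eventually)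
qed

end
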